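(* Let $(\mathcal E,\mathcal C)$ be an admissible form on $X$ of martingale dimension one, let $\omega\in\mathcal H$ be minimal energy-dominant, and assume that the closure of $(\mathcal E,\mathcal C)$ on $L^2(X,\nu_\omega)$ is a Dirichlet form $(\mathcal E,\mathcal D(\mathcal E))$. Let $T>0$, $b\in L^2(0,T;L^\infty(X,(\mathcal H_x)_{x\in X},\nu_\omega))$, $\mathring w\in\mathcal D(\partial^\bot)$ and $\mathring u:=\partial^\bot\mathring w$. Consider the continuity equation $$\text{(CE)}\quad \partial_t u=\partial^\ast(ub)\ \text{ on }(0,T)\times X,\qquad u(0)=\mathring u,$$ and the transport type equation $$\text{(TE)}\quad \partial_t w=-(\partial^\bot w)\star_\omega^{-1}b\ \text{ on }(0,T)\times X,\qquad w(0)=\mathring w .$$ (i) If $u$ is a solution of (CE) in the weak sense, then $w(t):=\mathring w-\int_0^t u(s)\star_\omega^{-1}b(s)\,ds$, $t\in[0,T]$, is a solution of (TE) in the integral sense. (ii) If $w$ is a solution of (TE) in the integral sense, then $u:=\partial^\bot w$ is a solution of (CE) in the weak sense.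
   Context: **Admissible forms.** $(X,\varrho)$ is a locally compact separable metric space, $C_c(X)$ the space of continuous compactly supported real functions with norm $\|\cdot\|_{\sup}$. An admissible form is a pair $(\mathcal E,\mathcal C)$, $\mathcal C\subset C_c(X)$ a subalgebra, $\mathcal E:\mathcal C\times\mathcal C\to\mathbb R$ nonnegative definite symmetric bilinear, $\mathcal E(f):=\mathcal E(f,f)$, such that: (1) $\mathcal C$ is dense in $C_c(X)$; (2) $\mathcal C$ is separable for the seminorm $\mathcal E^{1/2}$; (3) $u\in\mathcal C$ implies $(u\wedge1)\vee0\in\mathcal C$ and $\mathcal E((u\wedge1)\vee0)\le\mathcal E(u)$; (4) for $f\in\mathcal C$ the functional $g\mapsto\mathcal E(fg,f)-\frac12\mathcal E(f^2,g)$ is positive on $\mathcal C$ and bounded w.r.t. $\|\cdot\|_{\sup}$; (5) $\mathcal E(f,g)=0$ whenever $g$ is constant on a neighborhood of $\operatorname{supp}f$. **First order structure.** For $f_1,f_2\in\mathcal C$, $\nu_{f_1,f_2}$ is the unique finite signed Radon measure with $\int g\,d\nu_{f_1,f_2}=\frac12\{\mathcal E(f_1g,f_2)+\mathcal E(f_1,f_2g)-\mathcal E(f_1f_2,g)\}$, $g\in\mathcal C$; $\nu_f:=\nu_{f,f}$. Put $d_uf(x,y)=f(x)-f(y)$, $\overline g(x,y)=\frac12(g(x)+g(y))$. $\mathcal H$ is the Hilbert space obtained from the span of all $\overline g\,d_uf$ ($g\in C_c(X)$, $f\in\mathcal C$) with the nonnegative definite form $\langle\overline g_1d_uf_1,\overline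 g_2d_uf_2\rangle_{\mathcal H}=\int g_1g_2\,d\nu_{f_1,f_2}$ by factoring out null elements and completing. $\partial f$ is the class of $d_uf$, $g\,\partial f$ the class of $\overline g\,d_uf$; this extends to a bounded action of $C_c(X)$ on $\mathcal H$. One has $\|\partial f\|_{\mathcal H}^2=\mathcal E(f)$ and $\partial(fg)=f\partial g+g\partial f$. For $v,w\in\mathcal H$, $\nu_{v,w}$ is the finite signed measure determined by bilinear continuous extension of $\nu_{g_1\partial f_1,g_2\partial f_2}=g_1g_2\nu_{f_1,f_2}$; $\nu_v:=\nu_{v,v}\ge0$, $\nu_{v,w}(X)=\langle v,w\rangle_{\mathcal H}$. The map $g\mapsto gv$ extends to an isometry $L^2(X,\nu_v)\to\mathcal H$. **Energy dominance, martingale dimension.** A $\sigma$-finite Borel measure $\nu$ is energy-dominant if $\nu_f\ll\nu$ for all $f\in\mathcal C$; minimal if moreover $\nu\ll\nu'$ for every energy-dominant $\nu'$. $v\in\mathcal H$ is minimal energy-dominant if $\nu_v$ is. For a minimal energy-dominant $\nu$, the pointwise index is the ($\nu$-a.e. unique) minimal Borel function $p(\cdot):X\to\mathbb N\cup\{\infty\}$ with $\operatorname{rank}\big(\frac{d\nu_{f_i,f_j}}{d\nu}(x)\big)_{i,j=1}^N\le p(x)$ for $\nu$-a.e. $x$, for all $N$ and $f_1,\dots,f_N\in\mathcal C$. The martingale dimension is $\nu\text{-}\operatorname{ess\,sup}p(\cdot)$ (independent of $\nu$). **Direct integral.** For minimal energy-dominant $\nu$ there is a measurable field of Hilbert spaces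 $(\mathcal H_x)_{x\in X}$ such that $\mathcal H$ is identified with its direct integral $L^2(X,(\mathcal H_x)_{x\in X},\nu)$ and $\langle(\partial f_1)_x,(\partial f_2)_x\rangle_{\mathcal H_x}=\frac{d\nu_{f_1,f_2}}{d\nu}(x)$ $\nu$-a.e. $L^\infty(X,(\mathcal H_x)_{x\in X},\nu)$ is the space of essentially bounded measurable sections with norm $\operatorname{ess\,sup}_x\|v_x\|_{\mathcal H_x}$; for such $v$ and $g\in L^2(X,\nu)$, $gv:=(g(x)v_x)_x\in\mathcal H$. **Duality.** If the martingale dimension is one and $\omega$ is minimal energy-dominant, $\star_\omega:L^2(X,\nu_\omega)\to\mathcal H$, $\star_\omega g:=g\omega$, is an isometric isomorphism. It maps $L^\infty(X,\nu_\omega)$ onto $L^\infty(X,(\mathcal H_x)_{x\in X},\nu_\omega)$, so $\star_\omega^{-1}b(s)\in L^\infty(X,\nu_\omega)$ for a.e. $s$. **Operators.** $\partial$ extends to a closed operator from $L^2(X,\nu_\omega)$ to $\mathcal H$ with domain $\mathcal D(\mathcal E)$; $(\partial^\ast,\mathcal D(\partial^\ast))$ is its adjoint (from $\mathcal H$ to $L^2(X,\nu_\omega)$). $\mathcal D(\partial^\bot):=\star_\omega^{-1}\mathcal D(\partial^\ast)$ and $\partial^\bot f:=-\partial^\ast\star_\omega f$. **Solutions.** $u\in L^2(0,T;L^2(X,\nu_\omega))$ solves (CE) in the weak sense if for all $\psi\in C^1_c([0,T))$, $\varphi\in\mathcal C$: $-\int_0^T\psi'(t)\int_Xu(t)\varphi\,d\nu_\omega\,dt=\int_0^T\psi(t)\langle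 u(t)b(t),\partial\varphi\rangle_{\mathcal H}\,dt+\psi(0)\int_X\mathring u\varphi\,d\nu_\omega$. A function $w\in C([0,T];L^2(X,\nu_\omega))\cap L^0(0,T;\mathcal D(\partial^\bot))$ solves (TE) in the integral sense if $\partial^\bot w\in L^2(0,T;L^2(X,\nu_\omega))$ and $w(t)=\mathring w-\int_0^t(\partial^\bot w(s))\star_\omega^{-1}b(s)\,ds$ for all $t\in[0,T]$. Here $L^0$ denotes (strongly) measurable functions modulo equality a.e. *)

theory Defs
  imports
    "HOL-Analysis.Analysis"
    "HOL-Probability.Essential_Supremum"
    "Jordan_Normal_Form.DL_Rank"
begin

section \<open>Admissible forms\<close>

definition supp :: "('a::topological_space \<Rightarrow> real) \<Rightarrow> 'a set" where
  "supp f = closure {x. f x \<noteq> 0}"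

definition Cc :: "('a::topological_space \<Rightarrow> real) set" where
  "Cc = {f. continuous_on UNIV f \<and> compact (supp f)}"

definition sup_norm :: "('a \<Rightarrow> real) \<Rightarrow> real" where
  "sup_norm f = (SUP x. \<bar>f x\<bar>)"

definition unit_contraction :: "('a \<Rightarrow> real) \<Rightarrow> 'a \<Rightarrow> real" where
  "unit_contraction f = (\<lambda>x. max (min (f x) 1) 0)"

text \<open>Forms are HOL functions that are total on all pairs of real functions; only their
  values on \<open>C \<times> C\<close> carry meaning.\<close>

definition admissible_form ::
  "(('a::metric_space \<Rightarrow> real) \<Rightarrow> ('a \<Rightarrow> real) \<Rightarrow> real) \<Rightarrow> ('a \<Rightarrow> real) set \<Rightarrow> bool" where
  "admissible_form E C \<longleftrightarrow>
     C \<subseteq> Cc \<and> (\<lambda>x. 0) \<in> C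
   \<and> (\<forall>f\<in>C. \<forall>g\<in>C. (\<lambda>x. f x + g x) \<in> C \<and> (\<lambda>x. f x * g x) \<in> C)
   \<and> (\<forall>f\<in>C. \<forall>a. (\<lambda>x. a * f x) \<in> C)
   \<and> (\<forall>f\<in>C. \<forall>g\<in>C. \<forall>h\<in>C. \<forall>a b. E (\<lambda>x. a * f x + b * g x) h = a * E f h + b * E g h)
   \<and> (\<forall>f\<in>C. \<forall>g\<in>C. E f g = E g f)
   \<and> (\<forall>f\<in>C. 0 \<le> E f f)
   \<and> (\<forall>f\<in>Cc. \<forall>e>0. \<exists>g\<in>C. sup_norm (\<lambda>x. f x - g x) < e)
   \<and> (\<exists>D. countable D \<and> D \<subseteq> C \<and>
        (\<forall>f\<in>C. \<forall>e>0. \<exists>g\<in>D. sqrt (E (\<lambda>x. f x - g x) (\<lambda>x. f x - g x)) < e))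
   \<and> (\<forall>f\<in>C. unit_contraction f \<in> C \<and> E (unit_contraction f) (unit_contraction f) \<le> E f f)
   \<and> (\<forall>f\<in>C. (\<forall>g\<in>C. (\<forall>x. 0 \<le> g x) \<longrightarrow>
                 0 \<le> E (\<lambda>x. f x * g x) f - 1/2 * E (\<lambda>x. (f x)\<^sup>2) g)
            \<and> (\<exists>c. \<forall>g\<in>C. \<bar>E (\<lambda>x. f x * g x) f - 1/2 * E (\<lambda>x. (f x)\<^sup>2) g\<bar> \<le> c * sup_norm g))
   \<and> (\<forall>f\<in>C. \<forall>g\<in>C. (\<exists>U c. open U \<and> supp f \<subseteq> U \<and> (\<forall>x\<in>U. g x = c)) \<longrightarrow> E f g = 0)"


section \<open>Finite signed measures\<close>

text \<open>A finite signed Borel measure is represented by its set function. On a locally compact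
  separable metric space every finite Borel measure is Radon, so no regularity is required.\<close>

definition difference_of_measures ::
  "('a::topological_space set \<Rightarrow> real) \<Rightarrow> 'a measure \<Rightarrow> 'a measure \<Rightarrow> bool" where
  "difference_of_measures \<mu> P N \<longleftrightarrow>
     sets P = sets borel \<and> finite_measure P \<and> sets N = sets borel \<and> finite_measure N
   \<and> (\<forall>A\<in>sets borel. \<mu> A = measure P A - measure N A)"

definition finite_signed_measure :: "('a::topological_space set \<Rightarrow> real) \<Rightarrow> bool" where
  "finite_signed_measure \<mu> \<longleftrightarrow> (\<exists>P N. difference_of_measures \<mu> P N)"

text \<open>For bounded Borel \<open>g\<close> the value does not depend on the decomposition.\<close>

definition signed_integral :: "('a::topological_space set \<Rightarrow> real) \<Rightarrow> ('a \<Rightarrow> real) \<Rightarrow> real" where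
  "signed_integral \<mu> g =
     (THE i. \<exists>P N. difference_of_measures \<mu> P N
        \<and> i = (LINT x|P. g x) - (LINT x|N. g x))"

definition measure_from :: "('a::topological_space set \<Rightarrow> real) \<Rightarrow> 'a measure" where
  "measure_from \<mu> = measure_of UNIV (sets borel) (\<lambda>A. ennreal (\<mu> A))"

definition is_RN_deriv ::
  "'a::topological_space measure \<Rightarrow> ('a set \<Rightarrow> real) \<Rightarrow> ('a \<Rightarrow> real) \<Rightarrow> bool" where
  "is_RN_deriv M \<mu> h \<longleftrightarrow>
     integrable M h \<and> (\<forall>A\<in>sets borel. \<mu> A = (LINT x:A|M. h x))"


section \<open>Energy measures and the Hilbert space of 1-forms\<close>

definition is_energy_measures ::
  "(('a::metric_space \<Rightarrow> real) \<Rightarrow> ('a \<Rightarrow> real) \<Rightarrow> real) \<Rightarrow> ('a \<Rightarrow> real) set \<Rightarrow>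
   (('a \<Rightarrow> real) \<Rightarrow> ('a \<Rightarrow> real) \<Rightarrow> 'a set \<Rightarrow> real) \<Rightarrow> bool" where
  "is_energy_measures E C \<nu> \<longleftrightarrow>
     (\<forall>f1\<in>C. \<forall>f2\<in>C. finite_signed_measure (\<nu> f1 f2)
        \<and> (\<forall>g\<in>C. signed_integral (\<nu> f1 f2) g =
              1/2 * (E (\<lambda>x. f1 x * g x) f2 + E f1 (\<lambda>x. f2 x * g x) - E (\<lambda>x. f1 x * f2 x) g)))"

definition d_u :: "('a \<Rightarrow> real) \<Rightarrow> 'a \<times> 'a \<Rightarrow> real" where
  "d_u f = (\<lambda>(x, y). f x - f y)"

definition avg :: "('a \<Rightarrow> real) \<Rightarrow> 'a \<times> 'a \<Rightarrow> real" where
  "avg g = (\<lambda>(x, y). 1/2 * (g x + g y))"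

definition pre_form :: "('a \<Rightarrow> real) \<Rightarrow> ('a \<Rightarrow> real) \<Rightarrow> 'a \<times> 'a \<Rightarrow> real" where
  "pre_form g f = (\<lambda>z. avg g z * d_u f z)"

definition pre_forms :: "('a \<Rightarrow> real) set \<Rightarrow> ('a \<Rightarrow> real) set \<Rightarrow> ('a \<times> 'a \<Rightarrow> real) set" where
  "pre_forms G C =
     {F. \<exists>(n::nat) c g f. (\<forall>i<n. g i \<in> G \<and> f i \<in> C)
           \<and> F = (\<lambda>z. \<Sum>i<n. c i * pre_form (g i) (f i) z)}"

text \<open>The type \<open>'h\<close>, together with the canonical map \<open>j\<close> sending a function on \<open>X \<times> X\<close> to its
  class, is the Hilbert space obtained from the span of the \<open>pre_form g f\<close>, \<open>g \<in> Cc\<close>, by factoring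
  out null elements and completing. If \<open>X\<close> is not compact, \<open>d_u f = pre_form 1 f\<close> need not lie in
  this span; as \<open>\<nu> f f\<close> is finite, it has a class in the completion nevertheless. Hence \<open>j\<close>
  is also prescribed on these functions, while density is required for the smaller span.\<close>

definition is_form_space ::
  "('a::metric_space \<Rightarrow> real) set \<Rightarrow> (('a \<Rightarrow> real) \<Rightarrow> ('a \<Rightarrow> real) \<Rightarrow> 'a set \<Rightarrow> real) \<Rightarrow>
   (('a \<times> 'a \<Rightarrow> real) \<Rightarrow> 'h::{real_inner, complete_space}) \<Rightarrow> bool" where
  "is_form_space C \<nu> j \<longleftrightarrow>
     (let G = insert (\<lambda>x. 1) Cc in
       (\<forall>F1\<in>pre_forms G C. \<forall>F2\<in>pre_forms G C. \<forall>a b.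
          j (\<lambda>z. a * F1 z + b * F2 z) = a *\<^sub>R j F1 + b *\<^sub>R j F2)
     \<and> (\<forall>g1\<in>G. \<forall>g2\<in>G. \<forall>f1\<in>C. \<forall>f2\<in>C.
          inner (j (pre_form g1 f1)) (j (pre_form g2 f2)) =
            signed_integral (\<nu> f1 f2) (\<lambda>x. g1 x * g2 x)))
     \<and> closure (j ` pre_forms Cc C) = UNIV"

text \<open>\<open>\<nu>\<^sub>v\<^sub>,\<^sub>w(A)\<close> for \<open>v, w\<close> in the Hilbert space: for each Borel set \<open>A\<close>, the bilinear continuous
  extension of \<open>(g\<^sub>1\<partial>f\<^sub>1, g\<^sub>2\<partial>f\<^sub>2) \<mapsto> (g\<^sub>1g\<^sub>2\<nu>\<^sub>f\<^sub>1\<^sub>,\<^sub>f\<^sub>2)(A)\<close>.\<close>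

definition form_energy ::
  "('a::metric_space \<Rightarrow> real) set \<Rightarrow> (('a \<Rightarrow> real) \<Rightarrow> ('a \<Rightarrow> real) \<Rightarrow> 'a set \<Rightarrow> real) \<Rightarrow>
   (('a \<times> 'a \<Rightarrow> real) \<Rightarrow> 'h::{real_inner, complete_space}) \<Rightarrow> 'h \<Rightarrow> 'h \<Rightarrow> 'a set \<Rightarrow> real" where
  "form_energy C \<nu> j v w A =
     (THE B. bounded_bilinear B
        \<and> (\<forall>g1\<in>Cc. \<forall>g2\<in>Cc. \<forall>f1\<in>C. \<forall>f2\<in>C.
             B (j (pre_form g1 f1)) (j (pre_form g2 f2)) =
               signed_integral (\<nu> f1 f2) (\<lambda>x. indicator A x * (g1 x * g2 x)))) v w"

definition form_measure ::
  "('a::metric_space \<Rightarrow> real) set \<Rightarrow> (('a \<Rightarrow> real) \<Rightarrow> ('a \<Rightarrow> real) \<Rightarrow> 'a set \<Rightarrow> real) \<Rightarrow>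
   (('a \<times> 'a \<Rightarrow> real) \<Rightarrow> 'h::{real_inner, complete_space}) \<Rightarrow> 'h \<Rightarrow> 'a measure" where
  "form_measure C \<nu> j v = measure_from (form_energy C \<nu> j v v)"


section \<open>Energy dominance and martingale dimension\<close>

definition energy_dominant ::
  "('a::metric_space \<Rightarrow> real) set \<Rightarrow> (('a \<Rightarrow> real) \<Rightarrow> ('a \<Rightarrow> real) \<Rightarrow> 'a set \<Rightarrow> real) \<Rightarrow>
   'a measure \<Rightarrow> bool" where
  "energy_dominant C \<nu> M \<longleftrightarrow>
     sets M = sets borel \<and> sigma_finite_measure M
   \<and> (\<forall>f\<in>C. absolutely_continuous M (measure_from (\<nu> f f)))"

definition minimal_energy_dominant ::
  "('a::metric_space \<Rightarrow> real) set \<Rightarrow> (('a \<Rightarrow> real) \<Rightarrow> ('a \<Rightarrow> real) \<Rightarrow> 'a set \<Rightarrow> real) \<Rightarrow>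
   'a measure \<Rightarrow> bool" where
  "minimal_energy_dominant C \<nu> M \<longleftrightarrow>
     energy_dominant C \<nu> M \<and> (\<forall>M'. energy_dominant C \<nu> M' \<longrightarrow> absolutely_continuous M' M)"

definition bounds_energy_rank ::
  "('a::metric_space \<Rightarrow> real) set \<Rightarrow> (('a \<Rightarrow> real) \<Rightarrow> ('a \<Rightarrow> real) \<Rightarrow> 'a set \<Rightarrow> real) \<Rightarrow>
   'a measure \<Rightarrow> ('a \<Rightarrow> enat) \<Rightarrow> bool" where
  "bounds_energy_rank C \<nu> M p \<longleftrightarrow>
     (\<forall>(N::nat) f \<rho>. (\<forall>i<N. f i \<in> C) \<longrightarrow>
        (\<forall>i<N. \<forall>k<N. is_RN_deriv M (\<nu> (f i) (f k)) (\<rho> i k)) \<longrightarrow>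
        (AE x in M. enat (vec_space.rank N (Matrix.mat N N (\<lambda>(i, k). \<rho> i k x))) \<le> p x))"

definition is_pointwise_index ::
  "('a::metric_space \<Rightarrow> real) set \<Rightarrow> (('a \<Rightarrow> real) \<Rightarrow> ('a \<Rightarrow> real) \<Rightarrow> 'a set \<Rightarrow> real) \<Rightarrow>
   'a measure \<Rightarrow> ('a \<Rightarrow> enat) \<Rightarrow> bool" where
  "is_pointwise_index C \<nu> M p \<longleftrightarrow>
     p \<in> borel \<rightarrow>\<^sub>M count_space UNIV \<and> bounds_energy_rank C \<nu> M p
   \<and> (\<forall>q. q \<in> borel \<rightarrow>\<^sub>M count_space UNIV \<longrightarrow> bounds_energy_rank C \<nu> M q \<longrightarrow>
        (AE x in M. p x \<le> q x))"

text \<open>The essential supremum is the same for all minimal energy-dominant \<open>M\<close>.\<close>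

definition has_martingale_dimension ::
  "('a::metric_space \<Rightarrow> real) set \<Rightarrow> (('a \<Rightarrow> real) \<Rightarrow> ('a \<Rightarrow> real) \<Rightarrow> 'a set \<Rightarrow> real) \<Rightarrow>
   enat \<Rightarrow> bool" where
  "has_martingale_dimension C \<nu> d \<longleftrightarrow>
     (\<exists>M p. minimal_energy_dominant C \<nu> M \<and> is_pointwise_index C \<nu> M p
        \<and> esssup M (\<lambda>x. ereal_of_enat (p x)) = ereal_of_enat d)"


section \<open>The space of square integrable functions\<close>

definition L2_functions :: "'a measure \<Rightarrow> ('a \<Rightarrow> real) set" where
  "L2_functions M = {f. f \<in> borel_measurable M \<and> integrable M (\<lambda>x. (f x)\<^sup>2)}"

text \<open>The type \<open>'l\<close>, together with the map \<open>cls\<close> sending a square integrable function to its class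
  modulo equality a.e., is the Hilbert space \<open>L\<^sup>2(M)\<close>. It is used below for finite Borel measures on
  separable metric spaces, where \<open>L\<^sup>2(M)\<close> is separable; this justifies the class
  \<open>second_countable_topology\<close>, needed for the library's Bochner integral.\<close>

definition is_L2_space ::
  "'a measure \<Rightarrow>
   (('a \<Rightarrow> real) \<Rightarrow> 'l::{real_inner, complete_space, second_countable_topology}) \<Rightarrow> bool" where
  "is_L2_space M cls \<longleftrightarrow>
     (\<forall>f\<in>L2_functions M. \<forall>g\<in>L2_functions M. \<forall>a b.
        cls (\<lambda>x. a * f x + b * g x) = a *\<^sub>R cls f + b *\<^sub>R cls g)
   \<and> (\<forall>f\<in>L2_functions M. \<forall>g\<in>L2_functions M. inner (cls f) (cls g) = (LINT x|M. f x * g x))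
   \<and> cls ` L2_functions M = UNIV"

definition rep :: "'a measure \<Rightarrow> (('a \<Rightarrow> real) \<Rightarrow> 'l) \<Rightarrow> 'l \<Rightarrow> 'a \<Rightarrow> real" where
  "rep M cls u = (SOME f. f \<in> L2_functions M \<and> cls f = u)"

text \<open>Pointwise product, meaningful if it is again square integrable.\<close>

definition L2_mult :: "'a measure \<Rightarrow> (('a \<Rightarrow> real) \<Rightarrow> 'l) \<Rightarrow> 'l \<Rightarrow> 'l \<Rightarrow> 'l" where
  "L2_mult M cls u v = cls (\<lambda>x. rep M cls u x * rep M cls v x)"


section \<open>Direct integrals\<close>

text \<open>A measurable field of Hilbert spaces: the fibres \<open>K x\<close> are closed subspaces of a common
  Hilbert space \<open>'k\<close> (as fibres are separable, this is no restriction), \<open>S\<close> is the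
  space of measurable sections.\<close>

definition measurable_field ::
  "'a measure \<Rightarrow> ('a \<Rightarrow> 'k::{real_inner, complete_space} set) \<Rightarrow> ('a \<Rightarrow> 'k) set \<Rightarrow> bool" where
  "measurable_field M K S \<longleftrightarrow>
     (\<forall>x. Real_Vector_Spaces.subspace (K x) \<and> closed (K x))
   \<and> (\<forall>\<sigma>\<in>S. \<forall>x. \<sigma> x \<in> K x)
   \<and> (\<forall>\<sigma>\<in>S. \<forall>\<tau>\<in>S. (\<lambda>x. inner (\<sigma> x) (\<tau> x)) \<in> borel_measurable M)
   \<and> (\<forall>\<sigma>. (\<forall>x. \<sigma> x \<in> K x) \<longrightarrow>
          (\<forall>\<tau>\<in>S. (\<lambda>x. inner (\<sigma> x) (\<tau> x)) \<in> borel_measurable M) \<longrightarrow> \<sigma> \<in> S)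
   \<and> (\<exists>e :: nat \<Rightarrow> 'a \<Rightarrow> 'k. (\<forall>n. e n \<in> S) \<and> (\<forall>x. closure (Real_Vector_Spaces.span (range (\<lambda>n. e n x))) = K x))"

text \<open>\<open>sec v = (v\<^sub>x)\<^sub>x\<close> identifies \<open>'h\<close> with the direct integral of the field. Preserving inner
  products and being onto modulo null sets, \<open>sec\<close> is automatically linear and injective modulo null sets.
  As usual for direct integrals the identification respects multiplication by functions.\<close>

definition is_direct_integral ::
  "('a::metric_space \<Rightarrow> real) set \<Rightarrow> (('a \<Rightarrow> real) \<Rightarrow> ('a \<Rightarrow> real) \<Rightarrow> 'a set \<Rightarrow> real) \<Rightarrow>
   (('a \<times> 'a \<Rightarrow> real) \<Rightarrow> 'h::{real_inner, complete_space}) \<Rightarrow> 'a measure \<Rightarrow>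
   ('a \<Rightarrow> 'k::{real_inner, complete_space} set) \<Rightarrow> ('a \<Rightarrow> 'k) set \<Rightarrow> ('h \<Rightarrow> 'a \<Rightarrow> 'k) \<Rightarrow> bool" where
  "is_direct_integral C \<nu> j M K S sec \<longleftrightarrow>
     measurable_field M K S
   \<and> (\<forall>v. sec v \<in> S \<and> integrable M (\<lambda>x. (norm (sec v x))\<^sup>2))
   \<and> (\<forall>v w. inner v w = (LINT x|M. inner (sec v x) (sec w x)))
   \<and> (\<forall>\<sigma>\<in>S. integrable M (\<lambda>x. (norm (\<sigma> x))\<^sup>2) \<longrightarrow> (\<exists>v. AE x in M. sec v x = \<sigma> x))
   \<and> (\<forall>g\<in>Cc. \<forall>f\<in>C. AE x in M. sec (j (pre_form g f)) x = g x *\<^sub>R sec (j (d_u f)) x)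
   \<and> (\<forall>f1\<in>C. \<forall>f2\<in>C.
        is_RN_deriv M (\<nu> f1 f2) (\<lambda>x. inner (sec (j (d_u f1)) x) (sec (j (d_u f2)) x)))"

definition Linf_sections ::
  "'a measure \<Rightarrow> ('a \<Rightarrow> 'k::real_normed_vector) set \<Rightarrow> ('a \<Rightarrow> 'k) set" where
  "Linf_sections M S = {\<sigma>\<in>S. \<exists>c. AE x in M. norm (\<sigma> x) \<le> c}"

definition Linf_norm :: "'a measure \<Rightarrow> ('a \<Rightarrow> 'k::real_normed_vector) \<Rightarrow> real" where
  "Linf_norm M \<sigma> = real_of_ereal (esssup M (\<lambda>x. ereal (norm (\<sigma> x))))"

definition elem_of_section :: "'a measure \<Rightarrow> ('h \<Rightarrow> 'a \<Rightarrow> 'k) \<Rightarrow> ('a \<Rightarrow> 'k) \<Rightarrow> 'h" where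
  "elem_of_section M sec \<sigma> = (THE v. AE x in M. sec v x = \<sigma> x)"

definition section_mult ::
  "'a measure \<Rightarrow> ('h \<Rightarrow> 'a \<Rightarrow> 'k::real_vector) \<Rightarrow> ('a \<Rightarrow> real) \<Rightarrow> ('a \<Rightarrow> 'k) \<Rightarrow> 'h" where
  "section_mult M sec g \<sigma> = elem_of_section M sec (\<lambda>x. g x *\<^sub>R \<sigma> x)"

text \<open>\<open>\<star>\<^sub>\<omega> g = g \<omega> = (g(x) \<omega>\<^sub>x)\<^sub>x\<close>. If \<open>M\<close> is the energy measure of \<open>\<omega>\<close>, the section of \<open>\<omega>\<close> has norm one
  a.e., so this is square integrable for every \<open>g\<close> in \<open>L\<^sup>2(M)\<close>.\<close>

definition star ::
  "'a measure \<Rightarrow> (('a \<Rightarrow> real) \<Rightarrow> 'l) \<Rightarrow> ('h \<Rightarrow> 'a \<Rightarrow> 'k::real_vector) \<Rightarrow> 'h \<Rightarrow> 'l \<Rightarrow> 'h" where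
  "star M cls sec \<omega> u = section_mult M sec (rep M cls u) (sec \<omega>)"

definition star_inv ::
  "'a measure \<Rightarrow> (('a \<Rightarrow> real) \<Rightarrow> 'l) \<Rightarrow> ('h \<Rightarrow> 'a \<Rightarrow> 'k::real_vector) \<Rightarrow> 'h \<Rightarrow> 'h \<Rightarrow> 'l" where
  "star_inv M cls sec \<omega> = inv_into UNIV (star M cls sec \<omega>)"


section \<open>Closure of the form and the operators\<close>

definition energy_approx ::
  "(('a \<Rightarrow> real) \<Rightarrow> ('a \<Rightarrow> real) \<Rightarrow> real) \<Rightarrow> ('a \<Rightarrow> real) set \<Rightarrow>
   (('a \<Rightarrow> real) \<Rightarrow> 'l::real_normed_vector) \<Rightarrow> (nat \<Rightarrow> 'a \<Rightarrow> real) \<Rightarrow> 'l \<Rightarrow> bool" where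
  "energy_approx E C cls f u \<longleftrightarrow>
     (\<forall>n. f n \<in> C) \<and> (\<lambda>n. cls (f n)) \<longlonglongrightarrow> u
   \<and> (\<forall>e>0. \<exists>N. \<forall>m\<ge>N. \<forall>n\<ge>N. E (\<lambda>x. f m x - f n x) (\<lambda>x. f m x - f n x) < e)"

definition closable_form ::
  "(('a \<Rightarrow> real) \<Rightarrow> ('a \<Rightarrow> real) \<Rightarrow> real) \<Rightarrow> ('a \<Rightarrow> real) set \<Rightarrow>
   (('a \<Rightarrow> real) \<Rightarrow> 'l::real_normed_vector) \<Rightarrow> bool" where
  "closable_form E C cls \<longleftrightarrow>
     (\<forall>f. energy_approx E C cls f 0 \<longrightarrow> (\<lambda>n. E (f n) (f n)) \<longlonglongrightarrow> 0)"

definition form_domain ::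
  "(('a \<Rightarrow> real) \<Rightarrow> ('a \<Rightarrow> real) \<Rightarrow> real) \<Rightarrow> ('a \<Rightarrow> real) set \<Rightarrow>
   (('a \<Rightarrow> real) \<Rightarrow> 'l::real_normed_vector) \<Rightarrow> 'l set" where
  "form_domain E C cls = {u. \<exists>f. energy_approx E C cls f u}"

definition form_closure ::
  "(('a \<Rightarrow> real) \<Rightarrow> ('a \<Rightarrow> real) \<Rightarrow> real) \<Rightarrow> ('a \<Rightarrow> real) set \<Rightarrow>
   (('a \<Rightarrow> real) \<Rightarrow> 'l::real_normed_vector) \<Rightarrow> 'l \<Rightarrow> 'l \<Rightarrow> real" where
  "form_closure E C cls u v =
     (THE e. \<forall>f g. energy_approx E C cls f u \<longrightarrow> energy_approx E C cls g v \<longrightarrow>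
        (\<lambda>n. E (f n) (g n)) \<longlonglongrightarrow> e)"

definition dirichlet_form ::
  "'a measure \<Rightarrow> (('a \<Rightarrow> real) \<Rightarrow> 'l::real_normed_vector) \<Rightarrow>
   ('l \<Rightarrow> 'l \<Rightarrow> real) \<Rightarrow> 'l set \<Rightarrow> bool" where
  "dirichlet_form M cls Q D \<longleftrightarrow>
     Real_Vector_Spaces.subspace D \<and> closure D = UNIV
   \<and> (\<forall>u\<in>D. \<forall>v\<in>D. \<forall>w\<in>D. \<forall>a b. Q (a *\<^sub>R u + b *\<^sub>R v) w = a * Q u w + b * Q v w)
   \<and> (\<forall>u\<in>D. \<forall>v\<in>D. Q u v = Q v u)
   \<and> (\<forall>u\<in>D. 0 \<le> Q u u)
   \<and> (\<forall>u v. (\<forall>n. u n \<in> D) \<longrightarrow> u \<longlonglongrightarrow> v \<longrightarrow>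
        (\<forall>e>0. \<exists>N. \<forall>m\<ge>N. \<forall>n\<ge>N. Q (u m - u n) (u m - u n) < e) \<longrightarrow>
        v \<in> D \<and> (\<lambda>n. Q (u n - v) (u n - v)) \<longlonglongrightarrow> 0)
   \<and> (\<forall>u\<in>D. cls (unit_contraction (rep M cls u)) \<in> D
        \<and> Q (cls (unit_contraction (rep M cls u))) (cls (unit_contraction (rep M cls u))) \<le> Q u u)"

definition closure_is_dirichlet_form ::
  "(('a \<Rightarrow> real) \<Rightarrow> ('a \<Rightarrow> real) \<Rightarrow> real) \<Rightarrow> ('a \<Rightarrow> real) set \<Rightarrow> 'a measure \<Rightarrow>
   (('a \<Rightarrow> real) \<Rightarrow> 'l::real_normed_vector) \<Rightarrow> bool" where
  "closure_is_dirichlet_form E C M cls \<longleftrightarrow>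
     closable_form E C cls \<and> dirichlet_form M cls (form_closure E C cls) (form_domain E C cls)"

text \<open>The closed operator \<open>\<partial>\<close>, with domain \<open>form_domain E C cls\<close>.\<close>

definition grad ::
  "('a \<Rightarrow> real) set \<Rightarrow> (('a \<times> 'a \<Rightarrow> real) \<Rightarrow> 'h::real_normed_vector) \<Rightarrow>
   (('a \<Rightarrow> real) \<Rightarrow> 'l::real_normed_vector) \<Rightarrow> 'l \<Rightarrow> 'h" where
  "grad C j cls u =
     (THE v. \<exists>f. (\<forall>n. f n \<in> C) \<and> (\<lambda>n. cls (f n)) \<longlonglongrightarrow> u \<and> (\<lambda>n. j (d_u (f n))) \<longlonglongrightarrow> v)"

definition adj_domain :: "'l set \<Rightarrow> ('l::real_inner \<Rightarrow> 'h::real_inner) \<Rightarrow> 'h set" where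
  "adj_domain D T = {v. \<exists>g. \<forall>u\<in>D. inner v (T u) = inner g u}"

definition adj :: "'l set \<Rightarrow> ('l::real_inner \<Rightarrow> 'h::real_inner) \<Rightarrow> 'h \<Rightarrow> 'l" where
  "adj D T v = (THE g. \<forall>u\<in>D. inner v (T u) = inner g u)"

definition perp_domain ::
  "(('a \<Rightarrow> real) \<Rightarrow> ('a \<Rightarrow> real) \<Rightarrow> real) \<Rightarrow> ('a \<Rightarrow> real) set \<Rightarrow>
   (('a \<times> 'a \<Rightarrow> real) \<Rightarrow> 'h::real_inner) \<Rightarrow> 'a measure \<Rightarrow> (('a \<Rightarrow> real) \<Rightarrow> 'l::real_inner) \<Rightarrow>
   ('h \<Rightarrow> 'a \<Rightarrow> 'k::real_vector) \<Rightarrow> 'h \<Rightarrow> 'l set" where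
  "perp_domain E C j M cls sec \<omega> =
     {f. star M cls sec \<omega> f \<in> adj_domain (form_domain E C cls) (grad C j cls)}"

definition perp ::
  "(('a \<Rightarrow> real) \<Rightarrow> ('a \<Rightarrow> real) \<Rightarrow> real) \<Rightarrow> ('a \<Rightarrow> real) set \<Rightarrow>
   (('a \<times> 'a \<Rightarrow> real) \<Rightarrow> 'h::real_inner) \<Rightarrow> 'a measure \<Rightarrow> (('a \<Rightarrow> real) \<Rightarrow> 'l::real_inner) \<Rightarrow>
   ('h \<Rightarrow> 'a \<Rightarrow> 'k::real_vector) \<Rightarrow> 'h \<Rightarrow> 'l \<Rightarrow> 'l" where
  "perp E C j M cls sec \<omega> f =
     - adj (form_domain E C cls) (grad C j cls) (star M cls sec \<omega> f)"


section \<open>Vector valued functions of time\<close>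

text \<open>Strong measurability of \<open>u\<close> as a function with values in the space \<open>V\<close> with seminorm \<open>N\<close>:
  a.e. approximation by \<open>V\<close>-valued simple functions. This covers the nonseparable space of bounded
  sections and the domain of \<open>\<partial>\<^sup>\<bottom>\<close> with its graph norm.\<close>

definition strongly_measurable ::
  "real measure \<Rightarrow> 'v::minus set \<Rightarrow> ('v \<Rightarrow> real) \<Rightarrow> (real \<Rightarrow> 'v) \<Rightarrow> bool" where
  "strongly_measurable Q V N u \<longleftrightarrow>
     (AE t in Q. u t \<in> V)
   \<and> (\<exists>s :: nat \<Rightarrow> real \<Rightarrow> 'v. (\<forall>n. simple_function Q (s n) \<and> s n ` space Q \<subseteq> V)
        \<and> (AE t in Q. (\<lambda>n. N (u t - s n t)) \<longlonglongrightarrow> 0))"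

definition L2_time :: "real \<Rightarrow> 'v::minus set \<Rightarrow> ('v \<Rightarrow> real) \<Rightarrow> (real \<Rightarrow> 'v) \<Rightarrow> bool" where
  "L2_time T V N u \<longleftrightarrow>
     strongly_measurable (lebesgue_on {0<..<T}) V N u
   \<and> integrable (lebesgue_on {0<..<T}) (\<lambda>t. (N (u t))\<^sup>2)"

definition C1c :: "real \<Rightarrow> (real \<Rightarrow> real) \<Rightarrow> (real \<Rightarrow> real) \<Rightarrow> bool" where
  "C1c T \<psi> \<psi>' \<longleftrightarrow>
     (\<forall>t\<in>{0..<T}. (\<psi> has_real_derivative \<psi>' t) (at t within {0..<T}))
   \<and> continuous_on {0..<T} \<psi>'
   \<and> compact (closure {t\<in>{0..<T}. \<psi> t \<noteq> 0}) \<and> closure {t\<in>{0..<T}. \<psi> t \<noteq> 0} \<subseteq> {0..<T}"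


section \<open>Solutions\<close>

definition weak_solution_CE ::
  "('a \<Rightarrow> real) set \<Rightarrow> (('a \<times> 'a \<Rightarrow> real) \<Rightarrow> 'h::real_inner) \<Rightarrow> 'a measure \<Rightarrow>
   (('a \<Rightarrow> real) \<Rightarrow> 'l::real_normed_vector) \<Rightarrow> ('h \<Rightarrow> 'a \<Rightarrow> 'k::real_vector) \<Rightarrow>
   real \<Rightarrow> (real \<Rightarrow> 'a \<Rightarrow> 'k) \<Rightarrow> 'l \<Rightarrow> (real \<Rightarrow> 'l) \<Rightarrow> bool" where
  "weak_solution_CE C j M cls sec T b u0 u \<longleftrightarrow>
     L2_time T UNIV norm u
   \<and> (\<forall>\<psi> \<psi>'. C1c T \<psi> \<psi>' \<longrightarrow> (\<forall>\<phi>\<in>C.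
        - (LINT t|lebesgue_on {0<..<T}. \<psi>' t * (LINT x|M. rep M cls (u t) x * \<phi> x)) =
          (LINT t|lebesgue_on {0<..<T}.
             \<psi> t * inner (section_mult M sec (rep M cls (u t)) (b t)) (j (d_u \<phi>)))
          + \<psi> 0 * (LINT x|M. rep M cls u0 x * \<phi> x)))"

definition integral_solution_TE ::
  "(('a \<Rightarrow> real) \<Rightarrow> ('a \<Rightarrow> real) \<Rightarrow> real) \<Rightarrow> ('a \<Rightarrow> real) set \<Rightarrow>
   (('a \<times> 'a \<Rightarrow> real) \<Rightarrow> 'h::real_inner) \<Rightarrow> 'a measure \<Rightarrow>
   (('a \<Rightarrow> real) \<Rightarrow> 'l::{real_inner, complete_space, second_countable_topology}) \<Rightarrow>
   ('h \<Rightarrow> 'a \<Rightarrow> 'k::real_vector) \<Rightarrow> 'h \<Rightarrow> real \<Rightarrow> (real \<Rightarrow> 'a \<Rightarrow> 'k) \<Rightarrow> 'l \<Rightarrow> (real \<Rightarrow> 'l) \<Rightarrow> bool"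
  where
  "integral_solution_TE E C j M cls sec \<omega> T b w0 w \<longleftrightarrow>
     continuous_on {0..T} w
   \<and> strongly_measurable (lebesgue_on {0<..<T}) (perp_domain E C j M cls sec \<omega>)
       (\<lambda>f. sqrt ((norm f)\<^sup>2 + (norm (perp E C j M cls sec \<omega> f))\<^sup>2)) w
   \<and> L2_time T UNIV norm (\<lambda>t. perp E C j M cls sec \<omega> (w t))
   \<and> (\<forall>t\<in>{0..T}. w t = w0 - (LINT s|lebesgue_on {0<..<t}.
        L2_mult M cls (perp E C j M cls sec \<omega> (w s))
          (star_inv M cls sec \<omega> (elem_of_section M sec (b s)))))"

end

theory Submission
  imports Defs
begin

text \<open>
  Martingale dimension one forces almost every fibre of the direct integral to be spanned by
  \<open>\<omega>\<^sub>x\<close>, and \<open>\<parallel>\<omega>\<^sub>x\<parallel> = 1\<close> because the integration measure is the energy measure of \<open>\<omega>\<close>. Hence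
  \<open>\<star>\<^sub>\<omega>\<close> is a unitary map, and it turns \<open>u b\<close> into the product \<open>F = u \<star>\<^sub>\<omega>\<^sup>-\<^sup>1 b\<close> in \<open>L\<^sup>2\<close>. By the du Bois-Reymond
  lemma, (CE) tested with \<open>\<phi> \<in> C\<close> means \<open>\<langle>u(t), \<phi>\<rangle> = \<langle>u(0), \<phi>\<rangle> + \<integral>\<^sub>0\<^sup>t \<langle>F, \<star>\<^sub>\<omega>\<^sup>-\<^sup>1 \<partial>\<phi>\<rangle>\<close> for almost every \<open>t\<close>.
  As \<open>u(0) = \<partial>\<^sup>\<bottom>w(0)\<close>, the right hand side is \<open>-\<langle>w(t), \<star>\<^sub>\<omega>\<^sup>-\<^sup>1 \<partial>\<phi>\<rangle>\<close> for \<open>w(t) = w(0) - \<integral>\<^sub>0\<^sup>t F\<close>. So, by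
  separability of \<open>L\<^sup>2\<close>, (CE) is equivalent to \<open>\<partial>\<^sup>\<bottom>w(t) = u(t)\<close> almost everywhere, which is what (TE) states.
\<close>

section \<open>Bochner integrals in time\<close>

text \<open>Most objects of the statement (\<open>rep\<close>, \<open>elem_of_section\<close>,
  \<open>form_energy\<close>, \<open>grad\<close>, \<open>adj\<close>) are descriptions or choices.
  They become usable only after existence and uniqueness are shown, and then mostly as identities
  almost everywhere. This shapes the proof in four places. The reference measure is described by a
  bilinear extension; identifying its density as \<open>(norm (sec \<omega> x))\<^sup>2\<close> and
  comparing densities of \<open>M\<close> with respect to itself gives the unit norm. The constant 1
  need not lie in \<open>C\<close>, so the identity between the norm of a gradient and its energy
  needs cutoffs and locality; only this identity turns closability of the form into closability of
  the gradient. Test functions of time vanish near \<open>T\<close> but are free at 0, so their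
  derivatives have no mean value constraint and the du Bois-Reymond argument leaves no unknown
  constant. Finally, strong measurability of \<open>w\<close> in the graph norm demands simple
  approximants inside the domain of the operator, which approximation in the ambient space does not
  give.\<close>

text \<open>The library proves Bochner integrability of norm-bounded functions for the class \<open>banach\<close>,
  to which a type of sort \<open>{real_inner, complete_space}\<close> is not known to belong.\<close>

lemma integrableI_bounded_complete:
  fixes f :: "'a \<Rightarrow> 'b::{real_normed_vector, complete_space, second_countable_topology}"
  assumes f: "f \<in> borel_measurable M" and fin: "(\<integral>\<^sup>+x. norm (f x) \<partial>M) < \<infinity>"
  shows "integrable M f"
proof -
  obtain s where s: "\<And>i. simple_function M (s i)"
    and lim: "\<And>x. x \<in> space M \<Longrightarrow> (\<lambda>i. s i x) \<longlonglongrightarrow> f x"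
    and bound: "\<And>i x. x \<in> space M \<Longrightarrow> norm (s i x) \<le> 2 * norm (f x)"
    using borel_measurable_implies_sequence_metric[OF f, of 0] by simp metis
  have fin2: "(\<integral>\<^sup>+x. 2 * norm (f x) \<partial>M) < \<infinity>"
    using fin f by (simp add: nn_integral_cmult ennreal_mult ennreal_mult_less_top)
  have sb: "Bochner_Integration.simple_bochner_integrable M (s i)" for i
  proof (rule simple_bochner_integrableI_bounded[OF s])
    have "(\<integral>\<^sup>+x. norm (s i x) \<partial>M) \<le> (\<integral>\<^sup>+x. 2 * norm (f x) \<partial>M)"
      by (intro nn_integral_mono ennreal_leI bound)
    then show "(\<integral>\<^sup>+x. norm (s i x) \<partial>M) < \<infinity>" using fin2 by (rule order.strict_trans1)
  qed
  have L1: "(\<lambda>i. \<integral>\<^sup>+x. norm (f x - s i x) \<partial>M) \<longlonglongrightarrow> 0"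
    by (rule nn_integral_dominated_convergence_norm[where w="\<lambda>x. 2 * norm (f x)"])
      (use f fin2 bound lim borel_measurable_simple_function[OF s] in auto)
  \<comment> \<open>Two simple integrals differ by at most the sum of their mean errors, so
    completeness alone provides the limit.\<close>
  have "Cauchy (\<lambda>i. Bochner_Integration.simple_bochner_integral M (s i))"
  proof (rule metric_CauchyI)
    fix e :: real assume "0 < e"
    then have "\<forall>\<^sub>F i in sequentially. (\<integral>\<^sup>+x. norm (f x - s i x) \<partial>M) < ennreal (e / 2)"
      by (intro order_tendstoD(2)[OF L1]) simp
    then obtain N where N: "\<And>i. N \<le> i \<Longrightarrow> (\<integral>\<^sup>+x. norm (f x - s i x) \<partial>M) < ennreal (e / 2)"
      by (auto simp: eventually_sequentially)
    have "dist (Bochner_Integration.simple_bochner_integral M (s m)) (Bochner_Integration.simple_bochner_integral M (s n)) < e" if "N \<le> m" "N \<le> n" for m n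
    proof -
      have "ennreal (norm (Bochner_Integration.simple_bochner_integral M (s m) - Bochner_Integration.simple_bochner_integral M (s n)))
          < ennreal (e / 2) + ennreal (e / 2)"
        using that by (intro order.strict_trans1[OF simple_bochner_integral_bounded[OF f sb sb]] add_strict_mono N)
      also have "\<dots> = ennreal e" using \<open>0 < e\<close> by (simp flip: ennreal_plus)
      finally show ?thesis using \<open>0 < e\<close> by (simp add: dist_norm ennreal_less_iff)
    qed
    then show "\<exists>N. \<forall>m\<ge>N. \<forall>n\<ge>N. dist (Bochner_Integration.simple_bochner_integral M (s m)) (Bochner_Integration.simple_bochner_integral M (s n)) < e"
      by blast
  qed
  then obtain x where "(\<lambda>i. Bochner_Integration.simple_bochner_integral M (s i)) \<longlonglongrightarrow> x"
    using convergent_eq_Cauchy by blast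
  then show ?thesis
    using has_bochner_integral.intros[OF f sb L1] by (auto simp: integrable.simps)
qed

lemma integrable_norm_finite:
  assumes "integrable M f"
  shows "(\<integral>\<^sup>+x. norm (f x) \<partial>M) < \<infinity>"
  using assms has_bochner_integral_implies_finite_norm by (auto simp: integrable.simps)

lemma integrable_bound_complete:
  fixes f :: "'a \<Rightarrow> 'b::{real_normed_vector, complete_space, second_countable_topology}" and g :: "'a \<Rightarrow> real"
  assumes f: "f \<in> borel_measurable M" and g: "integrable M g" and le: "AE x in M. norm (f x) \<le> g x"
  shows "integrable M f"
proof (rule integrableI_bounded_complete[OF f])
  have "(\<integral>\<^sup>+x. norm (f x) \<partial>M) \<le> (\<integral>\<^sup>+x. norm (g x) \<partial>M)"
    by (rule nn_integral_mono_AE, use le in eventually_elim) (auto intro!: ennreal_leI)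
  then show "(\<integral>\<^sup>+x. norm (f x) \<partial>M) < \<infinity>"
    using integrable_norm_finite[OF g] by (rule order.strict_trans1)
qed

lemma integrable_norm_complete:
  assumes "integrable M f"
  shows "integrable M (\<lambda>x. norm (f x))"
  using borel_measurable_integrable[OF assms] integrable_norm_finite[OF assms]
  by (intro integrableI_bounded) auto

text \<open>Pairing the integral with itself moves the inner product under the integral sign, where
  the Cauchy-Schwarz inequality applies.\<close>

lemma norm_integral_le_inner:
  fixes f :: "'a \<Rightarrow> 'b::{real_inner, second_countable_topology}"
  assumes f: "integrable M f"
  shows "norm (integral\<^sup>L M f) \<le> (\<integral>x. norm (f x) \<partial>M)"
proof -
  let ?x = "integral\<^sup>L M f"
  have "norm ?x * norm ?x = (\<integral>x. inner (f x) ?x \<partial>M)"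
    using f by (simp add: dot_square_norm power2_eq_square)
  also have "\<dots> \<le> (\<integral>x. norm (f x) * norm ?x \<partial>M)"
    using f by (intro integral_mono norm_cauchy_schwarz) (auto intro: integrable_norm_complete)
  finally have "norm ?x * norm ?x \<le> (\<integral>x. norm (f x) \<partial>M) * norm ?x" by simp
  moreover have "0 \<le> (\<integral>x. norm (f x) \<partial>M)" by simp
  ultimately show ?thesis by (cases "?x = 0") (auto simp: mult_le_cancel_right)
qed

section \<open>Modification on null sets of times\<close>

lemma complete_measure_lebesgue_on:
  assumes "S \<in> sets lebesgue"
  shows "complete_measure (lebesgue_on S)"
proof
  fix B A :: "'a set"
  assume "B \<subseteq> A" "A \<in> null_sets (lebesgue_on S)"
  then have "A \<in> null_sets lebesgue" "A \<subseteq> S"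
    using assms by (auto simp: null_sets_restrict_space)
  then have "B \<in> null_sets lebesgue"
    using \<open>B \<subseteq> A\<close> completion.complete2 by blast
  then show "B \<in> sets (lebesgue_on S)"
    using \<open>B \<subseteq> A\<close> \<open>A \<subseteq> S\<close> assms by (auto simp: sets_restrict_space_iff)
qed

lemma borel_measurable_lebesgue_on_cong_AE:
  fixes f g :: "'a::euclidean_space \<Rightarrow> 'b::topological_space"
  assumes S: "S \<in> sets lebesgue" and f: "f \<in> borel_measurable (lebesgue_on S)"
    and ae: "AE x in lebesgue_on S. f x = g x"
  shows "g \<in> borel_measurable (lebesgue_on S)"
proof (rule borel_measurableI)
  interpret complete_measure "lebesgue_on S"
    by (rule complete_measure_lebesgue_on[OF S])
  fix U :: "'b set" assume "open U"
  then have "f -` U \<inter> space (lebesgue_on S) \<in> sets (lebesgue_on S)"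
    using f by (intro measurable_sets) auto
  from _ this show "g -` U \<inter> space (lebesgue_on S) \<in> sets (lebesgue_on S)"
  proof (rule in_sets_AE)
    show "AE x in lebesgue_on S. x \<in> f -` U \<inter> space (lebesgue_on S) \<longleftrightarrow> x \<in> g -` U \<inter> space (lebesgue_on S)"
      using ae by eventually_elim auto
  qed auto
qed

text \<open>No measurability is assumed: by completeness either both functions are measurable or
  neither is, and in the latter case both integrals have the default value 0. Integrands that are
  controlled only for almost every time can thus be exchanged freely.\<close>

lemma integral_lebesgue_on_cong_AE:
  fixes f g :: "'a::euclidean_space \<Rightarrow> 'b::{real_normed_vector, second_countable_topology}"
  assumes S: "S \<in> sets lebesgue" and ae: "AE x in lebesgue_on S. f x = g x"
  shows "integral\<^sup>L (lebesgue_on S) f = integral\<^sup>L (lebesgue_on S) g"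
proof (cases "f \<in> borel_measurable (lebesgue_on S)")
  case True
  then show ?thesis
    using borel_measurable_lebesgue_on_cong_AE[OF S True ae] ae by (intro integral_cong_AE) auto
next
  case False
  have "AE x in lebesgue_on S. g x = f x"
    using ae by eventually_elim simp
  then have "g \<notin> borel_measurable (lebesgue_on S)"
    using False borel_measurable_lebesgue_on_cong_AE[OF S] by blast
  then show ?thesis
    using False by (metis borel_measurable_integrable not_integrable_integral_eq)
qed

lemma integrable_lebesgue_on_cong_AE:
  fixes f g :: "'a::euclidean_space \<Rightarrow> 'b::{real_normed_vector, second_countable_topology}"
  assumes S: "S \<in> sets lebesgue" and f: "integrable (lebesgue_on S) f"
    and ae: "AE x in lebesgue_on S. f x = g x"
  shows "integrable (lebesgue_on S) g"
  using integrable_cong_AE_imp[OF f borel_measurable_lebesgue_on_cong_AE[OF S _ ae]] f ae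
  by (auto simp: eq_commute)

text \<open>Replacing all functions by 0 on the exceptional null set makes the limit pointwise
  everywhere; completeness then gives measurability of \<open>u\<close> itself. This converts strong
  measurability into Borel measurability.\<close>

lemma borel_measurable_lebesgue_on_AE_LIMSEQ:
  fixes u :: "'a::euclidean_space \<Rightarrow> 'b::real_normed_vector"
  assumes S: "S \<in> sets lebesgue" and s: "\<And>n. s n \<in> borel_measurable (lebesgue_on S)"
    and lim: "AE t in lebesgue_on S. (\<lambda>n. norm (u t - s n t)) \<longlonglongrightarrow> 0"
  shows "u \<in> borel_measurable (lebesgue_on S)"
proof -
  obtain N where N: "N \<in> null_sets (lebesgue_on S)"
    "{t \<in> space (lebesgue_on S). \<not> (\<lambda>n. norm (u t - s n t)) \<longlonglongrightarrow> 0} \<subseteq> N"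
    using lim by (auto simp: eventually_ae_filter)
  have Nsets [measurable]: "N \<in> sets (lebesgue_on S)" using N by auto
  note s [measurable]
  have "(\<lambda>t. if t \<in> N then 0 else u t) \<in> borel_measurable (lebesgue_on S)"
  proof (rule borel_measurable_LIMSEQ_metric)
    show "(\<lambda>t. if t \<in> N then 0 else s n t) \<in> borel_measurable (lebesgue_on S)" for n
      by measurable
    fix t assume "t \<in> space (lebesgue_on S)"
    then have "(\<lambda>n. s n t) \<longlonglongrightarrow> u t" if "t \<notin> N"
    proof -
      have "(\<lambda>n. dist (s n t) (u t)) \<longlonglongrightarrow> 0"
        using N(2) that \<open>t \<in> space (lebesgue_on S)\<close> by (auto simp: dist_norm norm_minus_commute)
      then show ?thesis by (subst tendsto_dist_iff)
    qed
    then show "(\<lambda>n. if t \<in> N then 0 else s n t) \<longlonglongrightarrow> (if t \<in> N then 0 else u t)"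
      by auto
  qed
  moreover have "AE t in lebesgue_on S. (if t \<in> N then 0 else u t) = u t"
    using AE_not_in[OF N(1)] by eventually_elim simp
  ultimately show ?thesis
    by (rule borel_measurable_lebesgue_on_cong_AE[OF S])
qed

lemma L2_time_borel_measurable:
  fixes u :: "real \<Rightarrow> 'b::{real_normed_vector}"
  assumes "L2_time T UNIV norm u"
  shows "u \<in> borel_measurable (lebesgue_on {0<..<T})"
proof -
  obtain s where s: "\<And>n. simple_function (lebesgue_on {0<..<T}) (s n)"
    "AE t in lebesgue_on {0<..<T}. (\<lambda>n. norm (u t - s n t)) \<longlonglongrightarrow> 0"
    using assms by (auto simp: L2_time_def strongly_measurable_def)
  show ?thesis
    by (rule borel_measurable_lebesgue_on_AE_LIMSEQ[OF _ borel_measurable_simple_function[OF s(1)] s(2)]) simp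
qed

lemma finite_measure_lebesgue_on_Ioo [simp]: "finite_measure (lebesgue_on {a<..<b::real})"
  by (intro finite_measure_lebesgue_on bounded_set_imp_lmeasurable) auto

lemma L2_time_integrable:
  fixes u :: "real \<Rightarrow> 'b::{real_normed_vector, complete_space, second_countable_topology}"
  assumes u: "L2_time T UNIV norm u"
  shows "integrable (lebesgue_on {0<..<T}) u"
proof (rule integrable_bound_complete[OF L2_time_borel_measurable[OF u]])
  show "integrable (lebesgue_on {0<..<T}) (\<lambda>t. 1 + (norm (u t))\<^sup>2)"
    using u by (auto simp: L2_time_def finite_measure.integrable_const)
  have "a \<le> 1 + a\<^sup>2" for a :: real
    using zero_le_power2[of "a - 1/2"] by (simp add: power2_eq_square algebra_simps)
  then show "AE t in lebesgue_on {0<..<T}. norm (u t) \<le> 1 + (norm (u t))\<^sup>2"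
    by blast
qed

lemma integrable_lebesgue_on_subset:
  fixes f :: "'a::euclidean_space \<Rightarrow> 'b::{real_normed_vector, complete_space, second_countable_topology}"
  assumes f: "integrable (lebesgue_on S) f" and AS: "A \<subseteq> S" "A \<in> sets lebesgue" "S \<in> sets lebesgue"
  shows "integrable (lebesgue_on A) f"
proof (rule integrableI_bounded_complete)
  show "f \<in> borel_measurable (lebesgue_on A)"
    using borel_measurable_integrable[OF f] AS(1) by (rule measurable_restrict_mono)
  have "(\<integral>\<^sup>+x. norm (f x) \<partial>lebesgue_on A) \<le> (\<integral>\<^sup>+x. norm (f x) \<partial>lebesgue_on S)"
    using AS by (auto simp: nn_integral_restrict_space indicator_def intro!: nn_integral_mono)
  then show "(\<integral>\<^sup>+x. norm (f x) \<partial>lebesgue_on A) < \<infinity>"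
    using integrable_norm_finite[OF f] by (rule order.strict_trans1)
qed

lemma borel_measurable_indicator_lebesgue_on:
  assumes "A \<in> sets lebesgue"
  shows "indicator A \<in> borel_measurable (lebesgue_on S)"
  using assms by (intro measurable_restrict_space1 borel_measurable_indicator)

lemma integrable_indicator_lebesgue_on:
  fixes F :: "'a::euclidean_space \<Rightarrow> 'b::{real_normed_vector, complete_space, second_countable_topology}"
  assumes F: "integrable (lebesgue_on S) F" and A: "A \<in> sets lebesgue"
  shows "integrable (lebesgue_on S) (\<lambda>s. indicator A s *\<^sub>R F s)"
proof (rule integrable_bound_complete[OF _ integrable_norm_complete[OF F]])
  show "(\<lambda>s. indicator A s *\<^sub>R F s) \<in> borel_measurable (lebesgue_on S)"
    by (intro borel_measurable_scaleR borel_measurable_indicator_lebesgue_on A borel_measurable_integrable[OF F])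
  show "AE s in lebesgue_on S. norm (indicator A s *\<^sub>R F s) \<le> norm (F s)"
    by (intro AE_I2) (simp add: indicator_def)
qed

text \<open>A fixed domain of integration is what dominated convergence and Fubini need. Equality is
  tested against every vector \<open>x\<close>, which reduces it to real integrands.\<close>

lemma integral_lebesgue_on_Ioo_restrict:
  fixes F :: "real \<Rightarrow> 'b::{real_inner, complete_space, second_countable_topology}"
  assumes F: "integrable (lebesgue_on {0<..<T}) F" and "t \<le> T"
  shows "(LINT s|lebesgue_on {0<..<t}. F s) = (LINT s|lebesgue_on {0<..<T}. indicator {0<..<t} s *\<^sub>R F s)"
    (is "?l = ?r")
proof -
  have F': "integrable (lebesgue_on {0<..<t}) F"
    by (rule integrable_lebesgue_on_subset[OF F]) (use assms(2) in auto)
  have iF: "integrable (lebesgue_on {0<..<T}) (\<lambda>s. indicator {0<..<t} s *\<^sub>R F s)"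
    by (rule integrable_indicator_lebesgue_on[OF F]) simp
  have "inner ?l x = inner ?r x" for x
  proof -
    have "inner ?l x = (LINT s|lebesgue_on {0<..<t}. inner (F s) x)"
      using F' by simp
    also have "\<dots> = (LINT s|lebesgue_on {0<..<T}. inner (indicator {0<..<t} s *\<^sub>R F s) x)"
      using assms(2) by (auto simp: integral_restrict_space indicator_def intro!: Bochner_Integration.integral_cong)
    also have "\<dots> = inner ?r x"
      using iF by (intro integral_inner_left) simp
    finally show ?thesis .
  qed
  then show ?thesis by (metis inner_commute vector_eq_rdot)
qed

lemma continuous_on_indefinite_integral:
  fixes F :: "real \<Rightarrow> 'b::{real_inner, complete_space, second_countable_topology}"
  assumes F: "integrable (lebesgue_on {0<..<T}) F"
  shows "continuous_on {0..T} (\<lambda>t. LINT s|lebesgue_on {0<..<t}. F s)"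
proof -
  let ?Q = "lebesgue_on {0<..<T}" and ?F = "\<lambda>t s. indicator {0<..<t::real} s *\<^sub>R F s"
  have iF: "integrable ?Q (?F t)" for t
    by (rule integrable_indicator_lebesgue_on[OF F]) simp
  have *: "(\<lambda>n. LINT s|?Q. ?F (r n) s) \<longlonglongrightarrow> (LINT s|?Q. ?F t s)" if r: "r \<longlonglongrightarrow> t" for r t
  proof -
    have "(\<lambda>n. LINT s|?Q. norm (?F (r n) s - ?F t s)) \<longlonglongrightarrow> (LINT s|?Q. 0)"
    proof (rule integral_dominated_convergence)
      show "integrable ?Q (\<lambda>s. norm (F s))" by (rule integrable_norm_complete[OF F])
      \<comment> \<open>Away from the single point \<open>s = t\<close> the indicators of
        \<open>{0<..<r n}\<close> and \<open>{0<..<t}\<close> eventually agree at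
        \<open>s\<close>.\<close>
      have lim: "(\<lambda>n. norm (?F (r n) s - ?F t s)) \<longlonglongrightarrow> 0" if st: "s \<noteq> t" for s
      proof (rule tendsto_eventually)
        consider "s < t" | "t < s" using st by linarith
        then show "\<forall>\<^sub>F n in sequentially. norm (?F (r n) s - ?F t s) = 0"
        proof cases
          case 1
          show ?thesis using order_tendstoD(1)[OF r 1]
            by eventually_elim (use 1 in \<open>auto simp: indicator_def\<close>)
        next
          case 2
          show ?thesis using order_tendstoD(2)[OF r 2]
            by eventually_elim (use 2 in \<open>auto simp: indicator_def\<close>)
        qed
      qed
      have "AE s in lebesgue. s \<noteq> t"
        by (intro AE_not_in[of "{t}", simplified]) auto
      then have "AE s in ?Q. s \<noteq> t" by (auto simp: AE_restrict_space_iff)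
      then show "AE s in ?Q. (\<lambda>n. norm (?F (r n) s - ?F t s)) \<longlonglongrightarrow> 0"
        by eventually_elim (rule lim)
      show "(\<lambda>s. norm (?F (r n) s - ?F t s)) \<in> borel_measurable ?Q" for n
        using borel_measurable_integrable[OF iF[of "r n"]] borel_measurable_integrable[OF iF[of t]] by measurable
      show "AE s in ?Q. norm (norm (?F (r n) s - ?F t s)) \<le> norm (F s)" for n
        by (intro AE_I2) (simp add: indicator_def)
    qed simp_all
    then have *: "(\<lambda>n. LINT s|?Q. norm (?F (r n) s - ?F t s)) \<longlonglongrightarrow> 0" by simp
    have "(\<lambda>n. (LINT s|?Q. ?F (r n) s) - (LINT s|?Q. ?F t s)) \<longlonglongrightarrow> 0"
    proof (rule Lim_null_comparison[OF _ *])
      have "norm ((LINT s|?Q. ?F (r n) s) - (LINT s|?Q. ?F t s)) \<le> (LINT s|?Q. norm (?F (r n) s - ?F t s))" for n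
        using norm_integral_le_inner[OF Bochner_Integration.integrable_diff[OF iF iF], of "r n" t]
        by (simp only: Bochner_Integration.integral_diff[OF iF iF])
      then show "\<forall>\<^sub>F n in sequentially. norm ((LINT s|?Q. ?F (r n) s) - (LINT s|?Q. ?F t s)) \<le> (LINT s|?Q. norm (?F (r n) s - ?F t s))"
        by (rule always_eventually[OF allI])
    qed
    then show ?thesis by (rule LIM_zero_cancel)
  qed
  have "continuous_on {0..T} (\<lambda>t. LINT s|?Q. ?F t s)"
    unfolding continuous_on_sequentially o_def using * by blast
  then show ?thesis
    by (rule continuous_on_eq) (simp add: integral_lebesgue_on_Ioo_restrict[OF F])
qed

section \<open>Weak derivatives in time\<close>

lemma C1c_vanishes_near_endpoint:
  assumes "T > 0" and \<psi>: "C1c T \<psi> \<psi>'"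
  obtains r where "0 < r" "r < T" "\<And>t. r \<le> t \<Longrightarrow> t < T \<Longrightarrow> \<psi> t = 0 \<and> \<psi>' t = 0"
proof -
  let ?K = "closure {t \<in> {0..<T}. \<psi> t \<noteq> 0}"
  have K: "compact ?K" "?K \<subseteq> {0..<T}" using \<psi> by (auto simp: C1c_def)
  obtain q where q: "q < T" "\<And>t. t \<in> ?K \<Longrightarrow> t \<le> q"
  proof (cases "?K = {}")
    case True
    show ?thesis
    proof (rule that[of 0])
      show "t \<le> 0" if "t \<in> ?K" for t using that unfolding True by (rule emptyE)
    qed (rule \<open>T > 0\<close>)
  next
    case False
    then obtain q where "q \<in> ?K" "\<forall>t\<in>?K. t \<le> q"
      using compact_attains_sup[OF K(1)] by blast
    then show ?thesis by (intro that[of q]) (use K(2) in auto)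
  qed
  \<comment> \<open>The midpoint lies strictly beyond the support, so \<open>\<psi>\<close> vanishes
    on an open interval around every later \<open>t\<close> and its derivative there is 0. The
    \<open>max 0\<close> keeps \<open>r\<close> positive.\<close>
  define r where "r = (max 0 q + T) / 2"
  have r: "0 < r" "r < T" "q < r" using q(1) \<open>T > 0\<close> by (auto simp: r_def max_def)
  have zero: "\<psi> t = 0" if "q < t" "t < T" "0 \<le> t" for t
  proof (rule ccontr)
    assume "\<psi> t \<noteq> 0"
    then have "t \<in> {t \<in> {0..<T}. \<psi> t \<noteq> 0}" using that by simp
    then have "t \<in> ?K" by (rule subsetD[OF closure_subset])
    then have "t \<le> q" by (rule q(2))
    with that show False by linarith
  qed
  have "\<psi>' t = 0" if t: "r \<le> t" "t < T" for t
  proof -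
    have D: "(\<psi> has_real_derivative \<psi>' t) (at t within {0..<T})"
      using \<psi> t r by (auto simp: C1c_def)
    have "t \<in> interior {0..<T}" using t r by (simp add: interior_atLeastLessThan)
    then have "(\<psi> has_real_derivative \<psi>' t) (at t)"
      using D by (simp only: at_within_interior)
    moreover have "(\<psi> has_real_derivative 0) (at t)"
      by (rule has_field_derivative_transform_within_open[of "\<lambda>x. 0" _ _ "{max 0 q<..<T}"])
        (use t r zero in auto)
    ultimately show ?thesis by (rule DERIV_unique)
  qed
  moreover have "\<psi> t = 0" if "r \<le> t" "t < T" for t
    using zero[of t] that r by simp
  ultimately show ?thesis
    by (intro that[of r] conjI r)
qed

text \<open>Continuity on the half-open interval does not exclude growth near \<open>T\<close>; the
  compact support does, and the rest is a compact interval.\<close>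

lemma C1c_derivative_bounded:
  assumes "T > 0" and \<psi>: "C1c T \<psi> \<psi>'"
  obtains c where "\<And>t. t \<in> {0..<T} \<Longrightarrow> \<bar>\<psi>' t\<bar> \<le> c"
proof -
  obtain r where r: "0 < r" "r < T" "\<And>t. r \<le> t \<Longrightarrow> t < T \<Longrightarrow> \<psi> t = 0 \<and> \<psi>' t = 0"
    using C1c_vanishes_near_endpoint[OF assms] by blast
  have "continuous_on {0..r} \<psi>'"
    using \<psi> r by (auto simp: C1c_def intro: continuous_on_subset)
  then have "bounded (\<psi>' ` {0..r})"
    by (intro compact_imp_bounded compact_continuous_image) auto
  then obtain c where "\<forall>y\<in>\<psi>' ` {0..r}. norm y \<le> c"
    unfolding bounded_iff by blast
  then have c: "\<bar>\<psi>' t\<bar> \<le> c" if "t \<in> {0..r}" for t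
    using that by auto
  have "\<bar>\<psi>' t\<bar> \<le> max c 0" if "t \<in> {0..<T}" for t
    using c[of t] r(3)[of t] that by (cases "t \<le> r") auto
  with that show ?thesis by blast
qed

lemma C1c_derivative_measurable:
  assumes "C1c T \<psi> \<psi>'"
  shows "\<psi>' \<in> borel_measurable (lebesgue_on {0<..<T})"
  using assms by (intro continuous_imp_measurable_on_sets_lebesgue)
    (auto simp: C1c_def intro: continuous_on_subset)

lemma integrable_lebesgue_on_bounded_mult:
  fixes f :: "real \<Rightarrow> 'b::{banach, second_countable_topology}"
  assumes f: "integrable (lebesgue_on {0<..<T}) f"
    and g: "g \<in> borel_measurable (lebesgue_on {0<..<T})" "\<And>t. t \<in> {0<..<T} \<Longrightarrow> \<bar>g t\<bar> \<le> c"
  shows "integrable (lebesgue_on {0<..<T}) (\<lambda>t. g t *\<^sub>R f t)"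
proof (rule Bochner_Integration.integrable_bound)
  show "integrable (lebesgue_on {0<..<T}) (\<lambda>t. c * norm (f t))" using f by simp
  show "AE t in lebesgue_on {0<..<T}. norm (g t *\<^sub>R f t) \<le> norm (c * norm (f t))"
    using g(2) by (intro AE_I2) (auto simp: abs_mult intro!: mult_right_mono order_trans[OF _ abs_ge_self])
qed (use f g in auto)

text \<open>The fundamental theorem applies up to a point beyond the support. The case
  \<open>s = 0\<close> produces the initial value term of the weak equation.\<close>

lemma integral_C1c_derivative:
  assumes "T > 0" and \<psi>: "C1c T \<psi> \<psi>'" and s: "0 \<le> s" "s < T"
  shows "(LINT t|lebesgue_on {0<..<T}. indicator {s<..} t * \<psi>' t) = - \<psi> s"
proof -
  obtain r where r: "0 < r" "r < T" "\<And>t. r \<le> t \<Longrightarrow> t < T \<Longrightarrow> \<psi> t = 0 \<and> \<psi>' t = 0"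
    using C1c_vanishes_near_endpoint[OF assms(1,2)] by blast
  obtain c where c: "\<And>t. t \<in> {0..<T} \<Longrightarrow> \<bar>\<psi>' t\<bar> \<le> c"
    using C1c_derivative_bounded[OF assms(1,2)] by blast
  \<comment> \<open>The right end must lie in the region where \<open>\<psi>\<close> vanishes and
    must not precede \<open>s\<close>, which may itself lie beyond \<open>r\<close>.\<close>
  define q where "q = max r s"
  have q: "s \<le> q" "q < T" "\<psi> q = 0" using r s by (auto simp: q_def max_def)
  have "(\<psi>' has_integral (\<psi> q - \<psi> s)) {s..q}"
  proof (rule fundamental_theorem_of_calculus[OF q(1)])
    fix t assume "t \<in> {s..q}"
    then have "(\<psi> has_real_derivative \<psi>' t) (at t within {0..<T})"
      using \<psi> s q by (auto simp: C1c_def)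
    then show "(\<psi> has_vector_derivative \<psi>' t) (at t within {s..q})"
      unfolding has_real_derivative_iff_has_vector_derivative
      by (rule has_vector_derivative_within_subset) (use s q in auto)
  qed
  then have "(\<psi>' has_integral (- \<psi> s)) {s<..<q}"
    by (simp add: q(3) has_integral_Icc_iff_Ioo)
  then have "((\<lambda>t. if t \<in> {s<..<q} then \<psi>' t else 0) has_integral (- \<psi> s)) {s<..<q}"
    by (rule has_integral_eq[rotated]) auto
  then have "((\<lambda>t. if t \<in> {s<..<q} then \<psi>' t else 0) has_integral (- \<psi> s)) {0<..<T}"
    by (rule has_integral_on_superset) (use s q in auto)
  then have "((\<lambda>t. indicator {s<..} t * \<psi>' t) has_integral (- \<psi> s)) {0<..<T}"
    by (rule has_integral_eq[rotated]) (use r(3) in \<open>auto simp: q_def indicator_def\<close>)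
  moreover have "integrable (lebesgue_on {0<..<T}) (\<lambda>t. indicator {s<..} t * \<psi>' t)"
  proof (rule finite_measure.integrable_const_bound[OF finite_measure_lebesgue_on_Ioo])
    show "AE t in lebesgue_on {0<..<T}. norm (indicator {s<..} t * \<psi>' t) \<le> \<bar>c\<bar>"
    proof (rule AE_I2)
      fix t assume "t \<in> space (lebesgue_on {0<..<T})"
      then have "\<bar>\<psi>' t\<bar> \<le> c" using c[of t] by simp
      then show "norm (indicator {s<..} t * \<psi>' t) \<le> \<bar>c\<bar>"
        by (simp add: indicator_def) linarith
    qed
    show "(\<lambda>t. indicator {s<..} t * \<psi>' t) \<in> borel_measurable (lebesgue_on {0<..<T})"
      by (intro borel_measurable_times borel_measurable_indicator_lebesgue_on C1c_derivative_measurable[OF \<psi>]) simp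
  qed
  ultimately show ?thesis
    by (subst lebesgue_integral_eq_integral) (simp_all add: integral_unique)
qed

text \<open>Integration by parts for merely integrable \<open>G\<close>: Fubini on the triangle
  \<open>s < t\<close>, with integrand dominated by \<open>c * \<bar>G s\<bar>\<close>. Integrating
  in \<open>t\<close> first leaves the derivative over \<open>t > s\<close>, that is
  \<open>- \<psi> s\<close>.\<close>

lemma integral_C1c_indefinite_integral:
  fixes G :: "real \<Rightarrow> real"
  assumes "T > 0" and \<psi>: "C1c T \<psi> \<psi>'" and G: "integrable (lebesgue_on {0<..<T}) G"
  shows "(LINT t|lebesgue_on {0<..<T}. \<psi>' t * (LINT s|lebesgue_on {0<..<t}. G s)) =
    - (LINT s|lebesgue_on {0<..<T}. \<psi> s * G s)"
proof -
  let ?Q = "lebesgue_on {0<..<T}"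
  interpret Q: finite_measure ?Q by simp
  interpret pair_sigma_finite ?Q ?Q ..
  obtain c where c: "\<And>t. t \<in> {0..<T} \<Longrightarrow> \<bar>\<psi>' t\<bar> \<le> c"
    using C1c_derivative_bounded[OF assms(1,2)] by blast
  have c0: "0 \<le> c" using c[of 0] \<open>T > 0\<close> by force
  note [measurable] = C1c_derivative_measurable[OF \<psi>] borel_measurable_integrable[OF G]
  \<comment> \<open>These facts make the condition \<open>s < t\<close> measurable for the product
    of the two Lebesgue spaces.\<close>
  have [measurable]: "(\<lambda>t. t) \<in> borel_measurable ?Q"
    by (intro continuous_imp_measurable_on_sets_lebesgue) (auto intro: continuous_intros)
  have [measurable]: "(\<lambda>p. fst p) \<in> borel_measurable (?Q \<Otimes>\<^sub>M ?Q)" "(\<lambda>p. snd p) \<in> borel_measurable (?Q \<Otimes>\<^sub>M ?Q)"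
    using measurable_compose[OF measurable_fst, of "\<lambda>t. t" ?Q borel]
      measurable_compose[OF measurable_snd, of "\<lambda>t. t" ?Q borel] by auto
  define f where "f = (\<lambda>(s, t). (if s < t then 1 else 0) * \<psi>' t * G s)"
  have f: "f \<in> borel_measurable (?Q \<Otimes>\<^sub>M ?Q)"
    unfolding f_def case_prod_beta by measurable
  have bound: "AE t in ?Q. norm (f (s, t)) \<le> c * \<bar>G s\<bar>" for s
    using c c0 by (intro AE_I2) (auto simp: f_def abs_mult intro!: mult_right_mono)
  have f_s: "integrable ?Q (\<lambda>t. f (s, t))" for s
  proof (rule Q.integrable_const_bound[OF bound])
    show "(\<lambda>t. f (s, t)) \<in> borel_measurable ?Q" unfolding f_def by simp measurable
  qed
  have f_int: "integrable (?Q \<Otimes>\<^sub>M ?Q) f"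
  proof (rule Fubini_integrable[OF f])
    show "integrable ?Q (\<lambda>s. \<integral>t. norm (f (s, t)) \<partial>?Q)"
    proof (rule Bochner_Integration.integrable_bound)
      show "integrable ?Q (\<lambda>s. c * \<bar>G s\<bar> * measure ?Q (space ?Q))" using G by simp
      show "(\<lambda>s. \<integral>t. norm (f (s, t)) \<partial>?Q) \<in> borel_measurable ?Q"
        using f by measurable
      show "AE s in ?Q. norm (\<integral>t. norm (f (s, t)) \<partial>?Q) \<le> norm (c * \<bar>G s\<bar> * measure ?Q (space ?Q))"
      proof (rule AE_I2)
        fix s
        have "(\<integral>t. norm (f (s, t)) \<partial>?Q) \<le> (\<integral>t. c * \<bar>G s\<bar> \<partial>?Q)"
          using bound f_s by (intro integral_mono_AE) auto
        then show "norm (\<integral>t. norm (f (s, t)) \<partial>?Q) \<le> norm (c * \<bar>G s\<bar> * measure ?Q (space ?Q))"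
          using c0 by (simp add: abs_mult mult_ac)
      qed
    qed
  qed (use f_s in auto)
  have "(\<integral>t. \<psi>' t * (LINT s|lebesgue_on {0<..<t}. G s) \<partial>?Q) = (\<integral>t. \<integral>s. f (s, t) \<partial>?Q \<partial>?Q)"
  proof (rule Bochner_Integration.integral_cong[OF refl])
    fix t assume t: "t \<in> space ?Q"
    have "(\<integral>s. f (s, t) \<partial>?Q) = (\<integral>s. \<psi>' t * (indicator {0<..<t} s *\<^sub>R G s) \<partial>?Q)"
      by (rule Bochner_Integration.integral_cong) (auto simp: f_def)
    then show "\<psi>' t * (LINT s|lebesgue_on {0<..<t}. G s) = (\<integral>s. f (s, t) \<partial>?Q)"
      using t by (simp add: integral_lebesgue_on_Ioo_restrict[OF G])
  qed
  also have "\<dots> = (\<integral>s. \<integral>t. f (s, t) \<partial>?Q \<partial>?Q)"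
    using Fubini_integral[of "\<lambda>s t. f (s, t)"] f_int by (simp add: f_def)
  also have "\<dots> = (\<integral>s. - (\<psi> s * G s) \<partial>?Q)"
  proof (rule Bochner_Integration.integral_cong[OF refl])
    fix s assume s: "s \<in> space ?Q"
    have "(\<integral>t. f (s, t) \<partial>?Q) = (\<integral>t. (indicator {s<..} t * \<psi>' t) * G s \<partial>?Q)"
      by (rule Bochner_Integration.integral_cong) (auto simp: f_def)
    then show "(\<integral>t. f (s, t) \<partial>?Q) = - (\<psi> s * G s)"
      using s integral_C1c_derivative[OF assms(1,2), of s] by simp
  qed
  finally show ?thesis by simp
qed

text \<open>The constant \<open>a0\<close> is paired with the total integral of
  \<open>\<psi>'\<close>, which is \<open>- \<psi> 0\<close>; the indefinite integral is handled by
  parts.\<close>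

lemma weak_derivative_of_indefinite_integral:
  fixes a G :: "real \<Rightarrow> real"
  assumes T: "T > 0" and \<psi>: "C1c T \<psi> \<psi>'" and G: "integrable (lebesgue_on {0<..<T}) G"
    and a: "AE t in lebesgue_on {0<..<T}. a t = a0 + (LINT s|lebesgue_on {0<..<t}. G s)"
  shows "- (LINT t|lebesgue_on {0<..<T}. \<psi>' t * a t) = (LINT t|lebesgue_on {0<..<T}. \<psi> t * G t) + \<psi> 0 * a0"
proof -
  let ?Q = "lebesgue_on {0<..<T}"
  obtain c where c: "\<And>t. t \<in> {0..<T} \<Longrightarrow> \<bar>\<psi>' t\<bar> \<le> c"
    using C1c_derivative_bounded[OF T \<psi>] by blast
  note m = C1c_derivative_measurable[OF \<psi>]
  have "continuous_on {0<..<T} (\<lambda>t. LINT s|lebesgue_on {0<..<t}. G s)"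
    by (rule continuous_on_subset[OF continuous_on_indefinite_integral[OF G]]) auto
  then have m2: "(\<lambda>t. LINT s|lebesgue_on {0<..<t}. G s) \<in> borel_measurable ?Q"
    by (rule continuous_imp_measurable_on_sets_lebesgue) simp
  obtain d where "\<forall>y\<in>(\<lambda>t. LINT s|lebesgue_on {0<..<t}. G s) ` {0..T}. norm y \<le> d"
    using compact_continuous_image[OF continuous_on_indefinite_integral[OF G] compact_Icc, THEN compact_imp_bounded]
    unfolding bounded_iff by blast
  then have d: "\<bar>LINT s|lebesgue_on {0<..<t}. G s\<bar> \<le> d" if "t \<in> {0..T}" for t
    using that by auto
  have i1: "integrable ?Q (\<lambda>t. \<psi>' t * a0)"
    using integrable_lebesgue_on_bounded_mult[of T "\<lambda>t. a0" \<psi>' c] m c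
    by (simp add: finite_measure.integrable_const)
  have "integrable ?Q (\<lambda>t. LINT s|lebesgue_on {0<..<t}. G s)"
    by (rule finite_measure.integrable_const_bound[where B=d]) (use m2 d in \<open>auto intro!: AE_I2\<close>)
  from integrable_lebesgue_on_bounded_mult[OF this m, of c]
  have i2: "integrable ?Q (\<lambda>t. \<psi>' t * (LINT s|lebesgue_on {0<..<t}. G s))"
    using c by simp
  have "(LINT t|?Q. \<psi>' t * a t) = (LINT t|?Q. \<psi>' t * a0 + \<psi>' t * (LINT s|lebesgue_on {0<..<t}. G s))"
    by (rule integral_lebesgue_on_cong_AE, simp, use a in eventually_elim) (simp add: algebra_simps)
  also have "\<dots> = (LINT t|?Q. \<psi>' t) * a0 + (LINT t|?Q. \<psi>' t * (LINT s|lebesgue_on {0<..<t}. G s))"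
    using i1 i2 by simp
  also have "(LINT t|?Q. \<psi>' t) = (LINT t|?Q. indicator {0<..} t * \<psi>' t)"
    by (rule Bochner_Integration.integral_cong) auto
  also have "\<dots> = - \<psi> 0"
    using integral_C1c_derivative[OF T \<psi>, of 0] T by simp
  finally show ?thesis
    by (simp add: integral_C1c_indefinite_integral[OF T \<psi> G])
qed

text \<open>Normalising the antiderivative at \<open>T\<close> instead of 0 gives compact support in
  the half-open interval without any condition on the mean of \<open>\<eta>\<close>, because the
  value at 0 is unrestricted.\<close>

lemma C1c_antiderivative:
  assumes "T > 0" and \<eta>: "continuous_on UNIV \<eta>" and r: "r < T" "\<And>t. r \<le> t \<Longrightarrow> \<eta> t = 0"
  shows "C1c T (\<lambda>t. - integral {t..T} \<eta>) \<eta>"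
  unfolding C1c_def
proof (intro conjI ballI)
  fix t assume t: "t \<in> {0..<T}"
  have "((\<lambda>x. integral {x..T} \<eta>) has_real_derivative - \<eta> t) (at t within {0..T})"
    using t by (intro integral_has_real_derivative' continuous_on_subset[OF \<eta>]) auto
  from DERIV_minus[OF this]
  show "((\<lambda>t. - integral {t..T} \<eta>) has_real_derivative \<eta> t) (at t within {0..<T})"
    by (auto intro: DERIV_subset)
next
  have "{t \<in> {0..<T}. - integral {t..T} \<eta> \<noteq> 0} \<subseteq> {0..r}"
  proof
    fix t assume t: "t \<in> {t \<in> {0..<T}. - integral {t..T} \<eta> \<noteq> 0}"
    have "integral {t..T} \<eta> = 0" if "r \<le> t"
      using that r(2) by (intro integral_eq_0_iff[THEN iffD2] integral_unique has_integral_is_0) auto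
    with t show "t \<in> {0..r}" by force
  qed
  then have *: "closure {t \<in> {0..<T}. - integral {t..T} \<eta> \<noteq> 0} \<subseteq> {0..r}"
    by (rule closure_minimal) simp
  then show "closure {t \<in> {0..<T}. - integral {t..T} \<eta> \<noteq> 0} \<subseteq> {0..<T}"
    using r(1) by auto
  show "compact (closure {t \<in> {0..<T}. - integral {t..T} \<eta> \<noteq> 0})"
    using bounded_subset[OF _ *] by (simp add: compact_eq_bounded_closed)
qed (rule continuous_on_subset[OF \<eta>], simp)

text \<open>The du Bois-Reymond lemma: \<open>h\<close> is tested against continuous approximations of its sign,
  cut off near \<open>T\<close>.\<close>

lemma AE_zero_if_C1c_derivative_orthogonal:
  fixes h :: "real \<Rightarrow> real"
  assumes "T > 0" and h: "integrable (lebesgue_on {0<..<T}) h"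
    and orth: "\<And>\<psi> \<psi>'. C1c T \<psi> \<psi>' \<Longrightarrow> (LINT t|lebesgue_on {0<..<T}. \<psi>' t * h t) = 0"
  shows "AE t in lebesgue_on {0<..<T}. h t = 0"
proof -
  let ?Q = "lebesgue_on {0<..<T}"
  have "(\<lambda>t. sgn (h t)) \<in> borel_measurable ?Q"
    using borel_measurable_integrable[OF h] by measurable
  then have "(\<lambda>t. sgn (h t)) measurable_on {0<..<T}"
    by (simp add: measurable_on_iff_borel_measurable)
  then obtain N g where N: "negligible N" and g: "\<And>n. continuous_on UNIV (g n)"
    and lim: "\<And>t. t \<notin> N \<Longrightarrow> (\<lambda>n. g n t) \<longlonglongrightarrow> (if t \<in> {0<..<T} then sgn (h t) else 0)"
    unfolding measurable_on_def by blast
  \<comment> \<open>The first factor clips the approximation to the range of the sign, which keeps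
    its limit and gives domination. The second is 0 once \<open>T - t\<close> is at most
    \<open>1 / real (Suc n)\<close> and 1 once it is at least twice that, so it tends to 1 at every
    \<open>t < T\<close>.\<close>
  define \<eta> where "\<eta> n t = max (-1) (min 1 (g n t)) * max 0 (min 1 (real (Suc n) * (T - t) - 1))" for n :: nat and t
  have \<eta>: "continuous_on UNIV (\<eta> n)" for n
    unfolding \<eta>_def by (intro continuous_intros g)
  have \<eta>_zero: "\<eta> n t = 0" if t: "T - 1 / real (Suc n) \<le> t" for n t
  proof -
    have "real (Suc n) * (T - t) \<le> real (Suc n) * (1 / real (Suc n))"
      using t by (intro mult_left_mono) auto
    then have "real (Suc n) * (T - t) - 1 \<le> 0" by simp
    then show ?thesis by (simp add: \<eta>_def max_def min_def)
  qed
  have \<eta>_le: "\<bar>\<eta> n t\<bar> \<le> 1" for n t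
    unfolding \<eta>_def abs_mult by (rule mult_le_one) auto
  have \<eta>_lim: "(\<lambda>n. \<eta> n t) \<longlonglongrightarrow> sgn (h t)" if t: "t \<in> {0<..<T}" "t \<notin> N" for t
  proof -
    obtain k :: nat where "2 / (T - t) < real k" using reals_Archimedean2 by blast
    then have k: "2 \<le> real k * (T - t)" using t by (simp add: field_simps)
    have "\<forall>\<^sub>F n in sequentially. max 0 (min 1 (real (Suc n) * (T - t) - 1)) = 1"
      using eventually_ge_at_top[of k]
    proof eventually_elim
      case (elim n)
      then have "real k * (T - t) \<le> real (Suc n) * (T - t)"
        using t by (intro mult_right_mono) auto
      then show ?case using k by linarith
    qed
    then have "(\<lambda>n. max 0 (min 1 (real (Suc n) * (T - t) - 1))) \<longlonglongrightarrow> 1"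
      by (rule tendsto_eventually)
    moreover have "(\<lambda>n. max (-1) (min 1 (g n t))) \<longlonglongrightarrow> max (-1) (min 1 (sgn (h t)))"
      using lim[of t] t by (intro tendsto_intros) auto
    moreover have "max (-1) (min 1 (sgn (h t))) = sgn (h t)" by (simp add: sgn_real_def)
    ultimately show ?thesis
      unfolding \<eta>_def using tendsto_mult by fastforce
  qed
  have "(\<lambda>n. LINT t|?Q. \<eta> n t * h t) \<longlonglongrightarrow> (LINT t|?Q. sgn (h t) * h t)"
  proof (rule integral_dominated_convergence)
    show "integrable ?Q (\<lambda>t. \<bar>h t\<bar>)" using h by simp
    show "(\<lambda>t. sgn (h t) * h t) \<in> borel_measurable ?Q"
      using borel_measurable_integrable[OF h] by measurable
    show "(\<lambda>t. \<eta> n t * h t) \<in> borel_measurable ?Q" for n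
      by (intro borel_measurable_times borel_measurable_integrable[OF h]
          continuous_imp_measurable_on_sets_lebesgue continuous_on_subset[OF \<eta>]) auto
    show "AE t in ?Q. norm (\<eta> n t * h t) \<le> \<bar>h t\<bar>" for n
      using \<eta>_le by (intro AE_I2) (simp add: abs_mult mult_left_le_one_le)
    have "AE t in lebesgue. t \<notin> N"
      using N by (intro AE_not_in) (simp add: negligible_iff_null_sets)
    then have "AE t in ?Q. t \<notin> N" by (auto simp: AE_restrict_space_iff elim: eventually_mono)
    then show "AE t in ?Q. (\<lambda>n. \<eta> n t * h t) \<longlonglongrightarrow> sgn (h t) * h t"
      using AE_space by eventually_elim (auto intro!: tendsto_mult_right \<eta>_lim)
  qed
  moreover have "(LINT t|?Q. \<eta> n t * h t) = 0" for n
    using \<eta>_zero[of n] by (intro orth[OF C1c_antiderivative[OF \<open>T > 0\<close> \<eta>, of "T - 1 / real (Suc n)"]]) auto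
  ultimately have "(LINT t|?Q. sgn (h t) * h t) = 0"
    by (simp add: LIMSEQ_const_iff)
  then have "(LINT t|?Q. \<bar>h t\<bar>) = 0" by (simp add: abs_sgn mult.commute)
  then show ?thesis
    using h by (simp add: integral_nonneg_eq_0_iff_AE)
qed

text \<open>The indefinite integral started at \<open>a0\<close> solves the same weak equation with
  the same initial term, so its difference from \<open>a\<close> is orthogonal to every
  \<open>\<psi>'\<close>.\<close>

lemma weak_derivative_imp_AE_indefinite_integral:
  fixes a G :: "real \<Rightarrow> real"
  assumes T: "T > 0" and a: "integrable (lebesgue_on {0<..<T}) a" and G: "integrable (lebesgue_on {0<..<T}) G"
    and weak: "\<And>\<psi> \<psi>'. C1c T \<psi> \<psi>' \<Longrightarrow>
      - (LINT t|lebesgue_on {0<..<T}. \<psi>' t * a t) = (LINT t|lebesgue_on {0<..<T}. \<psi> t * G t) + \<psi> 0 * a0"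
  shows "AE t in lebesgue_on {0<..<T}. a t = a0 + (LINT s|lebesgue_on {0<..<t}. G s)"
proof -
  let ?Q = "lebesgue_on {0<..<T}" and ?g = "\<lambda>t. a0 + (LINT s|lebesgue_on {0<..<t}. G s)"
  have "continuous_on {0..T} ?g"
    by (intro continuous_intros continuous_on_indefinite_integral G)
  then have "integrable (lebesgue_on {0..T}) ?g"
    by (rule continuous_imp_integrable_real)
  then have g: "integrable ?Q ?g"
    by (rule integrable_lebesgue_on_subset) auto
  have "AE t in ?Q. a t - ?g t = 0"
  proof (rule AE_zero_if_C1c_derivative_orthogonal[OF T])
    show "integrable ?Q (\<lambda>t. a t - ?g t)" using a g by simp
    fix \<psi> \<psi>' assume \<psi>: "C1c T \<psi> \<psi>'"
    obtain c where c: "\<And>t. t \<in> {0..<T} \<Longrightarrow> \<bar>\<psi>' t\<bar> \<le> c"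
      using C1c_derivative_bounded[OF T \<psi>] by blast
    have i: "integrable ?Q (\<lambda>t. \<psi>' t * f t)" if "integrable ?Q f" for f :: "real \<Rightarrow> real"
      using integrable_lebesgue_on_bounded_mult[OF that C1c_derivative_measurable[OF \<psi>], of c] c by simp
    have "(LINT t|?Q. \<psi>' t * (a t - ?g t)) = (LINT t|?Q. \<psi>' t * a t) - (LINT t|?Q. \<psi>' t * ?g t)"
      using i[OF a] i[OF g] by (subst Bochner_Integration.integral_diff[symmetric]) (simp_all add: right_diff_distrib)
    moreover have "- (LINT t|?Q. \<psi>' t * ?g t) = (LINT t|?Q. \<psi> t * G t) + \<psi> 0 * a0"
      by (rule weak_derivative_of_indefinite_integral[OF T \<psi> G]) simp
    ultimately show "(LINT t|?Q. \<psi>' t * (a t - ?g t)) = 0" using weak[OF \<psi>] by linarith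
  qed
  then show ?thesis by eventually_elim simp
qed

section \<open>From scalar to vector-valued equations\<close>

lemma integral_Ioo_inner_left:
  fixes F :: "real \<Rightarrow> 'l::{real_inner, complete_space, second_countable_topology}"
  assumes "integrable (lebesgue_on {0<..<T}) F" "t \<le> T"
  shows "(LINT s|lebesgue_on {0<..<t}. inner (F s) d) = inner (LINT s|lebesgue_on {0<..<t}. F s) d"
proof (rule integral_inner_left)
  have "integrable (lebesgue_on {0<..<t}) F"
    using assms by (intro integrable_lebesgue_on_subset[OF assms(1)]) auto
  then show "d \<noteq> 0 \<Longrightarrow> integrable (lebesgue_on {0<..<t}) F" .
qed

text \<open>The null set may depend on \<open>p\<close>, so the relation is first collected over a
  countable dense subset of \<open>P\<close>; for fixed \<open>t\<close> it is closed in
  \<open>p\<close>. Density is taken in the product, since both components of a pair have to be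
  approximated simultaneously.\<close>

lemma AE_ball_inner_eq_iff:
  fixes P :: "('l::{real_inner, second_countable_topology} \<times> 'l) set"
  assumes "\<And>p. p \<in> P \<Longrightarrow> AE t in M. inner (u t) (fst p) = - inner (w t) (snd p)"
  shows "AE t in M. \<forall>p\<in>P. inner (u t) (fst p) = - inner (w t) (snd p)"
proof -
  obtain D where D: "countable D" "D \<subseteq> P" "P \<subseteq> closure D"
    using separable by blast
  have "AE t in M. \<forall>p\<in>D. inner (u t) (fst p) = - inner (w t) (snd p)"
    using D assms by (auto simp: AE_ball_countable)
  then show ?thesis
  proof eventually_elim
    case (elim t)
    have "closed {p. inner (u t) (fst p) = - inner (w t) (snd p)}"
      by (intro closed_Collect_eq continuous_intros)
    then have "closure D \<subseteq> {p. inner (u t) (fst p) = - inner (w t) (snd p)}"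
      using elim by (intro closure_minimal) auto
    then show ?case using D(3) by blast
  qed
qed

text \<open>The pair of \<open>w\<close> and \<open>u\<close> is approximated by simple functions in
  the product space, whose values are then moved onto the graph of \<open>A\<close>. By
  \<open>diff\<close>, the graph norm of a difference is the product distance of the corresponding
  graph points.\<close>

lemma strongly_measurable_graph:
  fixes w :: "real \<Rightarrow> 'l::{real_normed_vector, second_countable_topology}"
  assumes T: "T > 0" and w: "w \<in> borel_measurable (lebesgue_on {0<..<T})"
    and u: "(u :: real \<Rightarrow> 'l) \<in> borel_measurable (lebesgue_on {0<..<T})"
    and graph: "AE t in lebesgue_on {0<..<T}. w t \<in> D \<and> A (w t) = u t"
    and D: "D \<noteq> {}"
    and diff: "\<And>f g. f \<in> D \<Longrightarrow> g \<in> D \<Longrightarrow> A (f - g) = A f - A g"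
  shows "strongly_measurable (lebesgue_on {0<..<T}) D (\<lambda>f. sqrt ((norm f)\<^sup>2 + (norm (A f))\<^sup>2)) w"
proof -
  let ?Q = "lebesgue_on {0<..<T}"
  define G where "G = (\<lambda>f. (f, A f)) ` D"
  have "(\<lambda>t. (w t, u t)) \<in> borel_measurable ?Q"
    using w u by (rule borel_measurable_Pair)
  from borel_measurable_implies_sequence_metric[OF this, of 0]
  obtain s where s: "\<And>n. simple_function ?Q (s n)"
    "\<And>t. t \<in> space ?Q \<Longrightarrow> (\<lambda>n. s n t) \<longlonglongrightarrow> (w t, u t)"
    by blast
  have approx: "\<exists>f\<in>D. dist z (f, A f) \<le> infdist z G + 1 / real (Suc n)" for z and n :: nat
  proof -
    have G: "G \<noteq> {}" using D by (simp add: G_def)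
    have "Inf (dist z ` G) < infdist z G + 1 / real (Suc n)"
      unfolding infdist_notempty[OF G] by simp
    moreover have "dist z ` G \<noteq> {}" using G by blast
    ultimately obtain x where "x \<in> dist z ` G" "x < infdist z G + 1 / real (Suc n)"
      using cInf_lessD[of "dist z ` G" "infdist z G + 1 / real (Suc n)"] by blast
    then show ?thesis unfolding G_def by (blast intro: less_imp_le)
  qed
  \<comment> \<open>A nearly nearest graph point, with slack because the infimum need not be
    attained. It depends on the value \<open>z\<close> only, so composing it with a simple function
    gives a simple function.\<close>
  define p where "p n z = (SOME f. f \<in> D \<and> dist z (f, A f) \<le> infdist z G + 1 / real (Suc n))" for n z
  have p: "p n z \<in> D" "dist z (p n z, A (p n z)) \<le> infdist z G + 1 / real (Suc n)" for n z
    using someI_ex[OF approx[of z n, unfolded Bex_def]] unfolding p_def by blast+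
  have "simple_function ?Q (\<lambda>t. p n (s n t))" for n
    using simple_function_compose[OF s(1), of "p n"] by (simp add: o_def)
  moreover have "AE t in ?Q. (\<lambda>n. sqrt ((norm (w t - p n (s n t)))\<^sup>2 + (norm (A (w t - p n (s n t))))\<^sup>2)) \<longlonglongrightarrow> 0"
    using graph AE_space
  proof eventually_elim
    case (elim t)
    have lim: "(\<lambda>n. dist (s n t) (w t, u t)) \<longlonglongrightarrow> 0"
      using s(2)[of t] elim by (intro tendsto_dist_iff[THEN iffD1]) blast
    have eq: "sqrt ((norm (w t - p n (s n t)))\<^sup>2 + (norm (A (w t - p n (s n t))))\<^sup>2) =
        dist (w t, u t) (p n (s n t), A (p n (s n t)))" for n
      using elim p(1) by (simp add: diff dist_norm norm_Pair)
    \<comment> \<open>The limit point lies on the graph, so moving an approximant onto the graph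
      costs at most its own error plus the slack.\<close>
    have le: "dist (w t, u t) (p n (s n t), A (p n (s n t))) \<le> 2 * dist (s n t) (w t, u t) + 1 / real (Suc n)" for n
    proof -
      have "(w t, u t) \<in> G" using elim by (auto simp: G_def)
      then have "infdist (s n t) G \<le> dist (s n t) (w t, u t)" by (rule infdist_le)
      moreover have "dist (w t, u t) (p n (s n t), A (p n (s n t))) \<le>
          dist (s n t) (w t, u t) + dist (s n t) (p n (s n t), A (p n (s n t)))"
        by (rule dist_triangle3)
      ultimately show ?thesis using p(2)[of "s n t" n] by linarith
    qed
    have "(\<lambda>n. 2 * dist (s n t) (w t, u t) + 1 / real (Suc n)) \<longlonglongrightarrow> 2 * 0 + 0"
      by (intro tendsto_add tendsto_mult_left lim LIMSEQ_inverse_real_of_nat[unfolded inverse_eq_divide])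
    then have lim2: "(\<lambda>n. 2 * dist (s n t) (w t, u t) + 1 / real (Suc n)) \<longlonglongrightarrow> 0" by simp
    have "(\<lambda>n. dist (w t, u t) (p n (s n t), A (p n (s n t)))) \<longlonglongrightarrow> 0"
    proof (rule Lim_null_comparison[OF always_eventually lim2], rule allI)
      show "norm (dist (w t, u t) (p n (s n t), A (p n (s n t)))) \<le> 2 * dist (s n t) (w t, u t) + 1 / real (Suc n)" for n
        using le[of n] by (simp only: real_norm_def abs_of_nonneg zero_le_dist)
    qed
    then show ?case unfolding eq .
  qed
  moreover have "AE t in ?Q. w t \<in> D" using graph by eventually_elim simp
  ultimately show ?thesis
    unfolding strongly_measurable_def
    by (intro conjI exI[of _ "\<lambda>n t. p n (s n t)"] allI image_subsetI p(1))
qed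

text \<open>Here \<open>c\<close> stands for the class of a test function and \<open>d\<close> for
  the inverse dual of its gradient. By \<open>init\<close>, the indefinite integral of
  \<open>inner (F s) d\<close> started at \<open>inner u0 c\<close> is
  \<open>- inner (w t) d\<close>, and the scalar equivalence applies.\<close>

lemma weak_form_iff_AE:
  fixes u F :: "real \<Rightarrow> 'l::{real_inner, complete_space, second_countable_topology}"
  assumes T: "T > 0" and u: "integrable (lebesgue_on {0<..<T}) u"
    and F: "integrable (lebesgue_on {0<..<T}) F"
    and w: "\<And>t. t \<in> {0..T} \<Longrightarrow> w t = w0 - (LINT s|lebesgue_on {0<..<t}. F s)"
    and init: "inner u0 c = - inner w0 d"
  shows "(\<forall>\<psi> \<psi>'. C1c T \<psi> \<psi>' \<longrightarrow>
      - (LINT t|lebesgue_on {0<..<T}. \<psi>' t * inner (u t) c) =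
        (LINT t|lebesgue_on {0<..<T}. \<psi> t * inner (F t) d) + \<psi> 0 * inner u0 c)
    \<longleftrightarrow> (AE t in lebesgue_on {0<..<T}. inner (u t) c = - inner (w t) d)" (is "?weak \<longleftrightarrow> ?ae")
proof -
  let ?Q = "lebesgue_on {0<..<T}"
  have i: "integrable ?Q (\<lambda>t. inner (u t) c)" "integrable ?Q (\<lambda>t. inner (F t) d)"
    using u F by auto
  have rhs: "inner u0 c + (LINT s|lebesgue_on {0<..<t}. inner (F s) d) = - inner (w t) d"
    if "t \<in> {0..T}" for t
    using that init by (simp add: integral_Ioo_inner_left[OF F] w inner_diff_left)
  have "?ae \<longleftrightarrow> (AE t in ?Q. inner (u t) c = inner u0 c + (LINT s|lebesgue_on {0<..<t}. inner (F s) d))"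
    by (rule AE_cong) (simp add: rhs)
  moreover have "\<dots> \<longleftrightarrow> ?weak"
    using weak_derivative_imp_AE_indefinite_integral[OF T i, of "inner u0 c"]
      weak_derivative_of_indefinite_integral[OF T _ i(2), where a="\<lambda>t. inner (u t) c" and ?a0.0="inner u0 c"]
    by (intro iffI allI impI) blast+
  ultimately show ?thesis by blast
qed

section \<open>Signed integrals and parallel vectors\<close>

text \<open>For indicators both sides are the value of \<open>\<mu>\<close>; monotone approximation
  extends this to bounded nonnegative functions. As the right side does not mention \<open>P\<close>
  and \<open>N\<close>, the value is independent of the decomposition.\<close>

lemma difference_of_measures_integral:
  assumes diff: "difference_of_measures \<mu> P N" and rn: "is_RN_deriv M \<mu> h" and M: "sets M = sets borel"
    and g: "g \<in> borel_measurable borel" and bound: "\<And>x. \<bar>g x\<bar> \<le> c"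
  shows "(LINT x|P. g x) - (LINT x|N. g x) = (LINT x|M. g x * h x)"
proof -
  interpret P: finite_measure P using diff by (simp add: difference_of_measures_def)
  interpret N: finite_measure N using diff by (simp add: difference_of_measures_def)
  have sets: "sets P = sets borel" "sets N = sets borel"
    using diff by (auto simp: difference_of_measures_def)
  have h: "integrable M h" using rn by (simp add: is_RN_deriv_def)
  have mP: "borel_measurable P = borel_measurable borel" and mN: "borel_measurable N = borel_measurable borel"
    and mM: "borel_measurable M = borel_measurable borel"
    using sets M by (simp_all cong: measurable_cong_sets)
  have iP: "integrable P f" and iN: "integrable N f" and iM: "integrable M (\<lambda>x. f x * h x)"
    if f: "f \<in> borel_measurable borel" "\<And>x. \<bar>f x\<bar> \<le> d" for f :: "'a \<Rightarrow> real" and d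
  proof -
    show "integrable P f" "integrable N f"
      using f by (auto intro!: P.integrable_const_bound[where B=d] N.integrable_const_bound[where B=d] simp: mP mN)
    show "integrable M (\<lambda>x. f x * h x)"
    proof (rule Bochner_Integration.integrable_bound)
      show "integrable M (\<lambda>x. d * \<bar>h x\<bar>)" using h by simp
      show "(\<lambda>x. f x * h x) \<in> borel_measurable M"
        using f borel_measurable_integrable[OF h] by (simp add: mM)
      show "AE x in M. norm (f x * h x) \<le> norm (d * \<bar>h x\<bar>)"
      proof (rule AE_I2)
        fix x
        have "\<bar>f x\<bar> * \<bar>h x\<bar> \<le> \<bar>d\<bar> * \<bar>h x\<bar>"
          using f(2)[of x] by (intro mult_right_mono) auto
        then show "norm (f x * h x) \<le> norm (d * \<bar>h x\<bar>)" by (simp add: abs_mult)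
      qed
    qed
  qed
  have nonneg: "(LINT x|P. f x) - (LINT x|N. f x) = (LINT x|M. f x * h x)"
    if f: "f \<in> borel_measurable borel" "\<And>x. 0 \<le> f x" and fd: "\<And>x. f x \<le> d" for f :: "'a \<Rightarrow> real" and d
    using f fd
  proof (induction arbitrary: d rule: borel_measurable_induct_real)
    case (set A d)
    have "\<mu> A = measure P A - measure N A" "\<mu> A = (LINT x:A|M. h x)"
      using diff rn set(1) by (auto simp: difference_of_measures_def is_RN_deriv_def)
    then show ?case
      using set(1) by (simp add: set_lebesgue_integral_def sets)
  next
    \<comment> \<open>The factor \<open>u\<close> is bounded by \<open>d / k\<close>, hence the
      induction with varying bound; for \<open>k = 0\<close> there is no such bound, but both sides
      vanish.\<close>
    case (mult u k d)
    show ?case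
    proof (cases "k = 0")
      case False
      then have "0 < k" using mult by simp
      then have ub: "u x \<le> d / k" for x
        using mult.prems[of x] by (simp add: field_simps)
      show ?thesis using mult.IH[OF ub] by (simp add: right_diff_distrib[symmetric] mult.assoc)
    qed simp
  next
    case (add u v d)
    have ub: "u x \<le> d" "v x \<le> d" for x
      using add.hyps(2)[of x] add.hyps(4)[of x] add.prems[of x] by linarith+
    have b: "\<bar>u x\<bar> \<le> d" "\<bar>v x\<bar> \<le> d" for x
      using ub[of x] add.hyps(2)[of x] add.hyps(4)[of x] by auto
    show ?case
      using add.IH(1)[OF ub(1)] add.IH(2)[OF ub(2)] iP[OF add.hyps(1) b(1)] iP[OF add.hyps(3) b(2)]
        iN[OF add.hyps(1) b(1)] iN[OF add.hyps(3) b(2)] iM[OF add.hyps(1) b(1)] iM[OF add.hyps(3) b(2)]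
      by (simp add: distrib_right)
  next
    case (seq U d)
    have lim: "(\<lambda>i. U i x) \<longlonglongrightarrow> f x" for x using seq.hyps(4)[of x] by simp
    have ub: "U i x \<le> d" for i x
      using incseq_le[of "\<lambda>i. U i x" "f x" i] seq.hyps(3) lim[of x] seq.prems[of x]
      by (fastforce simp: incseq_def le_fun_def)
    have b: "\<bar>U i x\<bar> \<le> d" for i x using ub[of i x] seq.hyps(2)[of i x] by simp
    have "(\<lambda>i. LINT x|P. U i x) \<longlonglongrightarrow> (LINT x|P. f x)"
      by (rule integral_dominated_convergence[where w="\<lambda>_. d"]) (use f(1) seq.hyps(1) b lim in \<open>auto simp: mP\<close>)
    moreover have "(\<lambda>i. LINT x|N. U i x) \<longlonglongrightarrow> (LINT x|N. f x)"
      by (rule integral_dominated_convergence[where w="\<lambda>_. d"]) (use f(1) seq.hyps(1) b lim in \<open>auto simp: mN\<close>)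
    ultimately have L: "(\<lambda>i. LINT x|M. U i x * h x) \<longlonglongrightarrow> (LINT x|P. f x) - (LINT x|N. f x)"
      unfolding seq.IH[OF ub, symmetric] by (rule tendsto_diff)
    have "(\<lambda>i. LINT x|M. U i x * h x) \<longlonglongrightarrow> (LINT x|M. f x * h x)"
    proof (rule integral_dominated_convergence)
      show "integrable M (\<lambda>x. d * \<bar>h x\<bar>)" using h by simp
      show "AE x in M. norm (U i x * h x) \<le> d * \<bar>h x\<bar>" for i
        using b by (intro AE_I2) (auto simp: abs_mult intro!: mult_right_mono)
      show "AE x in M. (\<lambda>i. U i x * h x) \<longlonglongrightarrow> f x * h x"
        by (intro AE_I2 tendsto_mult_right lim)
    qed (use f(1) seq.hyps(1) borel_measurable_integrable[OF h] in \<open>auto simp: mM\<close>)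
    with L show ?case using LIMSEQ_unique by blast
  qed
  have c: "0 \<le> c" using bound[of undefined] by linarith
  \<comment> \<open>Shifting by \<open>c\<close> makes the integrand nonnegative; the same identity
    for the constant \<open>c\<close> removes the shift.\<close>
  have g2: "(\<lambda>x. g x + c) \<in> borel_measurable borel" using g by simp
  have gc: "0 \<le> g x + c" "g x + c \<le> 2 * c" for x using bound[of x] by auto
  have "(LINT x|P. g x + c) - (LINT x|N. g x + c) = (LINT x|M. (g x + c) * h x)"
    by (rule nonneg[OF g2 gc])
  moreover have "(LINT x|P. c) - (LINT x|N. c) = (LINT x|M. c * h x)"
    using nonneg[of "\<lambda>_. c" c] c by simp
  ultimately show ?thesis
    using iP[OF g bound] iN[OF g bound] iM[OF g bound] h
    by (simp add: distrib_right)
qed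

lemma signed_integral_RN_deriv:
  assumes \<mu>: "finite_signed_measure \<mu>" and rn: "is_RN_deriv M \<mu> h" and M: "sets M = sets borel"
    and g: "g \<in> borel_measurable borel" and bound: "\<And>x. \<bar>g x\<bar> \<le> c"
  shows "signed_integral \<mu> g = (LINT x|M. g x * h x)"
  unfolding signed_integral_def
proof (rule the_equality)
  show "\<exists>P N. difference_of_measures \<mu> P N \<and> (LINT x|M. g x * h x) = (LINT x|P. g x) - (LINT x|N. g x)"
    using \<mu> difference_of_measures_integral[OF _ rn M g bound] unfolding finite_signed_measure_def by metis
  show "i = (LINT x|M. g x * h x)"
    if "\<exists>P N. difference_of_measures \<mu> P N \<and> i = (LINT x|P. g x) - (LINT x|N. g x)" for i
    using that difference_of_measures_integral[OF _ rn M g bound] by auto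
qed

lemma Cc_borel_measurable: "f \<in> Cc \<Longrightarrow> f \<in> borel_measurable borel"
  by (auto simp: Cc_def intro: borel_measurable_continuous_onI)

lemma Cc_bounded:
  assumes "f \<in> Cc"
  obtains c where "\<And>x. \<bar>f x\<bar> \<le> c"
proof -
  have "compact (f ` supp f)"
    using assms by (intro compact_continuous_image) (auto simp: Cc_def intro: continuous_on_subset)
  then have "bounded (f ` supp f)" by (rule compact_imp_bounded)
  then obtain c where "\<forall>y\<in>f ` supp f. norm y \<le> c"
    unfolding bounded_iff by blast
  then have c: "\<bar>f x\<bar> \<le> c" if "x \<in> supp f" for x using that by auto
  have "\<bar>f x\<bar> \<le> max c 0" for x
  proof (cases "x \<in> supp f")
    case True
    then show ?thesis using c by (simp add: le_max_iff_disj)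
  next
    case False
    then have "x \<notin> {x. f x \<noteq> 0}" unfolding supp_def using closure_subset by (rule contra_subsetD[rotated])
    then have "f x = 0" by simp
    then show ?thesis by simp
  qed
  then show ?thesis by (rule that)
qed

section \<open>Parallel vectors and degenerate Gram matrices\<close>

text \<open>The squared norm of the defect of linearity expands into inner products of images, which
  can be replaced by those of the arguments and cancel.\<close>

lemma inner_preserving_imp_linear:
  fixes T :: "'a::real_inner \<Rightarrow> 'b::real_inner"
  assumes T: "\<And>x y. inner (T x) (T y) = inner x y"
  shows "T (a *\<^sub>R x + b *\<^sub>R y) = a *\<^sub>R T x + b *\<^sub>R T y"
proof -
  let ?d = "T (a *\<^sub>R x + b *\<^sub>R y) - (a *\<^sub>R T x + b *\<^sub>R T y)"
  have "inner ?d ?d = 0"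
    by (simp add: inner_diff_left inner_diff_right inner_add_left inner_add_right T) (simp add: algebra_simps)
  then show ?thesis by simp
qed

text \<open>The vanishing of the exterior product of \<open>a\<close> and \<open>b\<close>, tested
  against all pairs. Without a proportionality factor the condition is symmetric, admits zero
  vectors, and passes to sums and limits.\<close>

definition parallel :: "'a::real_inner \<Rightarrow> 'a \<Rightarrow> bool" where
  "parallel a b \<longleftrightarrow> (\<forall>c d. inner a c * inner b d = inner a d * inner b c)"

lemma parallel_iff_Cauchy_Schwarz_eq:
  "parallel a b \<longleftrightarrow> inner a a * inner b b = (inner a b)\<^sup>2"
proof
  assume "parallel a b"
  then have "inner a a * inner b b = inner a b * inner b a" by (simp add: parallel_def)
  then show "inner a a * inner b b = (inner a b)\<^sup>2" by (simp add: power2_eq_square inner_commute)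
next
  assume eq: "inner a a * inner b b = (inner a b)\<^sup>2"
  show "parallel a b"
  proof (cases "b = 0")
    case False
    \<comment> \<open>The coefficient of the projection of \<open>a\<close> onto \<open>b\<close>;
      the squared length of the residual is the Cauchy-Schwarz defect divided by
      \<open>inner b b\<close>.\<close>
    let ?k = "inner a b / inner b b"
    have "inner (a - ?k *\<^sub>R b) (a - ?k *\<^sub>R b) = inner a a - (inner a b)\<^sup>2 / inner b b"
      using False by (simp add: inner_diff_left inner_diff_right inner_commute[of b a] power2_eq_square)
    also have "\<dots> = 0" using False by (simp flip: eq)
    finally have "a = ?k *\<^sub>R b" by simp
    then obtain k where "a = k *\<^sub>R b" by blast
    then show ?thesis by (simp add: parallel_def)
  qed (simp add: parallel_def)
qed

lemma parallel_commute: "parallel a b \<longleftrightarrow> parallel b a"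
  by (auto simp: parallel_def mult.commute)

lemma parallel_sum_left:
  assumes "\<And>i. i \<in> I \<Longrightarrow> parallel (a i) b"
  shows "parallel (\<Sum>i\<in>I. k i *\<^sub>R a i) b"
  unfolding parallel_def
proof (intro allI)
  fix c d
  have "inner (k i *\<^sub>R a i) c * inner b d = inner (k i *\<^sub>R a i) d * inner b c" if "i \<in> I" for i
    using assms[OF that] by (simp add: parallel_def)
  then show "inner (\<Sum>i\<in>I. k i *\<^sub>R a i) c * inner b d = inner (\<Sum>i\<in>I. k i *\<^sub>R a i) d * inner b c"
    unfolding inner_sum_left sum_distrib_right by (rule sum.cong[OF refl])
qed

lemma parallel_sums:
  assumes "\<And>i l. i \<in> I \<Longrightarrow> l \<in> L \<Longrightarrow> parallel (a i) (b l)"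
  shows "parallel (\<Sum>i\<in>I. k i *\<^sub>R a i) (\<Sum>l\<in>L. m l *\<^sub>R b l)"
proof (rule parallel_sum_left)
  fix i assume "i \<in> I"
  have "parallel (\<Sum>l\<in>L. m l *\<^sub>R b l) (a i)"
    using assms[OF \<open>i \<in> I\<close>] by (intro parallel_sum_left) (simp add: parallel_commute)
  then show "parallel (a i) (\<Sum>l\<in>L. m l *\<^sub>R b l)" by (simp add: parallel_commute)
qed

text \<open>A nonzero kernel vector forces the Gram determinant to vanish, which is equality in the
  Cauchy-Schwarz inequality. The factor \<open>t\<close> will be a density between two reference
  measures.\<close>

lemma gram_rank_less_2_imp_parallel:
  fixes a :: "nat \<Rightarrow> 'k::real_inner"
  assumes "vec_space.rank 2 (Matrix.mat 2 2 (\<lambda>(i, k). t * inner (a i) (a k))) < 2" and "t \<noteq> 0"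
  shows "parallel (a 0) (a 1)"
proof -
  let ?A = "Matrix.mat 2 2 (\<lambda>(i, k). t * inner (a i) (a k))"
  have "Determinant.det ?A = 0"
    using assms(1) vec_space.det_rank_iff[of ?A 2] by auto
  then obtain v where v: "v \<in> carrier_vec 2" "v \<noteq> 0\<^sub>v 2" "?A *\<^sub>v v = 0\<^sub>v 2"
    using det_0_iff_vec_prod_zero_field[of ?A 2] by auto
  define x y where "x = vec_index v 0" and "y = vec_index v 1"
  have "vec_index (?A *\<^sub>v v) i = 0" if "i < 2" for i using v(3) that by simp
  from this[of 0] this[of 1]
  have eqs: "t * inner (a 0) (a 0) * x + t * inner (a 0) (a 1) * y = 0"
    "t * inner (a 1) (a 0) * x + t * inner (a 1) (a 1) * y = 0"
    using v(1) by (auto simp: scalar_prod_def x_def y_def numeral_2_eq_2)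
  have "x \<noteq> 0 \<or> y \<noteq> 0"
  proof (rule ccontr)
    assume "\<not> (x \<noteq> 0 \<or> y \<noteq> 0)"
    then have "v = 0\<^sub>v 2"
      using v(1) by (intro eq_vecI) (auto simp: x_def y_def less_2_cases_iff)
    with v(2) show False by simp
  qed
  moreover have "t * inner (a 0) (a 0) * x + t * inner (a 0) (a 1) * y = t * (inner (a 0) (a 0) * x + inner (a 0) (a 1) * y)"
    "t * inner (a 1) (a 0) * x + t * inner (a 1) (a 1) * y = t * (inner (a 0) (a 1) * x + inner (a 1) (a 1) * y)"
    by (simp_all add: algebra_simps inner_commute)
  ultimately have e: "inner (a 0) (a 0) * x = - inner (a 0) (a 1) * y" "inner (a 0) (a 1) * x = - inner (a 1) (a 1) * y"
    using eqs \<open>t \<noteq> 0\<close> by auto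
  \<comment> \<open>Cramer's rule: the kernel relations annihilate the product of the determinant
    with each entry of the kernel vector.\<close>
  have elim: "(p * r - q\<^sup>2) * z = 0" "(p * r - q\<^sup>2) * z' = 0" if "p * z = - q * z'" "q * z = - r * z'"
    for p q r z z' :: real
  proof -
    have "(p * r - q\<^sup>2) * z = r * (p * z) - q * (q * z)"
      by (simp add: algebra_simps power2_eq_square)
    also have "\<dots> = r * (- q * z') - q * (- r * z')" by (simp only: that)
    finally show "(p * r - q\<^sup>2) * z = 0" by simp
    have "(p * r - q\<^sup>2) * z' = - p * (- r * z') + q * (- q * z')"
      by (simp add: algebra_simps power2_eq_square)
    also have "\<dots> = - p * (q * z) + q * (p * z)" by (simp only: that)
    finally show "(p * r - q\<^sup>2) * z' = 0" by simp
  qed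
  from elim[OF e] show ?thesis
    using \<open>x \<noteq> 0 \<or> y \<noteq> 0\<close> by (auto simp: parallel_iff_Cauchy_Schwarz_eq)
qed

section \<open>Direct integrals of Hilbert spaces\<close>

locale direct_integral =
  fixes C :: "('a::metric_space \<Rightarrow> real) set"
    and \<nu> :: "('a \<Rightarrow> real) \<Rightarrow> ('a \<Rightarrow> real) \<Rightarrow> 'a set \<Rightarrow> real"
    and j :: "('a \<times> 'a \<Rightarrow> real) \<Rightarrow> 'h::{real_inner, complete_space}"
    and M :: "'a measure"
    and K :: "'a \<Rightarrow> 'k::{real_inner, complete_space} set"
    and S :: "('a \<Rightarrow> 'k) set"
    and sec :: "'h \<Rightarrow> 'a \<Rightarrow> 'k"
  assumes direct_integral: "is_direct_integral C \<nu> j M K S sec"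
begin

lemma sec_in_S: "sec v \<in> S"
  and integrable_norm_sec: "integrable M (\<lambda>x. (norm (sec v x))\<^sup>2)"
  and inner_eq_integral: "inner v w = (LINT x|M. inner (sec v x) (sec w x))"
  and section_ex: "\<sigma> \<in> S \<Longrightarrow> integrable M (\<lambda>x. (norm (\<sigma> x))\<^sup>2) \<Longrightarrow> \<exists>v. AE x in M. sec v x = \<sigma> x"
  and sec_pre_form: "g \<in> Cc \<Longrightarrow> f \<in> C \<Longrightarrow> AE x in M. sec (j (pre_form g f)) x = g x *\<^sub>R sec (j (d_u f)) x"
  and RN_deriv_energy: "f \<in> C \<Longrightarrow> f' \<in> C \<Longrightarrow>
    is_RN_deriv M (\<nu> f f') (\<lambda>x. inner (sec (j (d_u f)) x) (sec (j (d_u f')) x))"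
  using direct_integral by (simp_all add: is_direct_integral_def)

lemma fibre: "Real_Vector_Spaces.subspace (K x)" "\<sigma> \<in> S \<Longrightarrow> \<sigma> x \<in> K x"
  and measurable_inner: "\<sigma> \<in> S \<Longrightarrow> \<tau> \<in> S \<Longrightarrow> (\<lambda>x. inner (\<sigma> x) (\<tau> x)) \<in> borel_measurable M"
  and S_I: "(\<And>x. \<sigma> x \<in> K x) \<Longrightarrow> (\<And>\<tau>. \<tau> \<in> S \<Longrightarrow> (\<lambda>x. inner (\<sigma> x) (\<tau> x)) \<in> borel_measurable M) \<Longrightarrow> \<sigma> \<in> S"
  using direct_integral by (simp_all add: is_direct_integral_def measurable_field_def)

lemma measurable_norm:
  assumes "\<sigma> \<in> S"
  shows "(\<lambda>x. norm (\<sigma> x)) \<in> borel_measurable M"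
  using measurable_inner[OF assms assms] unfolding norm_eq_sqrt_inner by measurable

lemma S_scale:
  assumes "\<sigma> \<in> S" "g \<in> borel_measurable M"
  shows "(\<lambda>x. g x *\<^sub>R \<sigma> x) \<in> S"
proof (rule S_I)
  show "(\<lambda>x. inner (g x *\<^sub>R \<sigma> x) (\<tau> x)) \<in> borel_measurable M" if "\<tau> \<in> S" for \<tau>
    using assms(2) measurable_inner[OF assms(1) that] by simp
qed (simp add: fibre assms subspace_scale)

lemma S_diff:
  assumes "\<sigma> \<in> S" "\<tau> \<in> S"
  shows "(\<lambda>x. \<sigma> x - \<tau> x) \<in> S"
proof (rule S_I)
  show "(\<lambda>x. inner (\<sigma> x - \<tau> x) (\<rho> x)) \<in> borel_measurable M" if "\<rho> \<in> S" for \<rho>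
    using measurable_inner[OF assms(1) that] measurable_inner[OF assms(2) that] by (simp add: inner_diff_left)
qed (simp add: fibre assms subspace_diff)


lemma integrable_inner_sec: "integrable M (\<lambda>x. inner (sec v x) (sec w x))"
proof (rule Bochner_Integration.integrable_bound)
  show "integrable M (\<lambda>x. (norm (sec v x))\<^sup>2 + (norm (sec w x))\<^sup>2)"
    using integrable_norm_sec by simp
  have "\<bar>inner a b\<bar> \<le> \<bar>(norm a)\<^sup>2 + (norm b)\<^sup>2\<bar>" for a b :: 'k
  proof -
    have "\<bar>inner a b\<bar> \<le> norm a * norm b" by (rule Cauchy_Schwarz_ineq2)
    moreover have "2 * norm a * norm b \<le> (norm a)\<^sup>2 + (norm b)\<^sup>2" by (rule sum_squares_bound)
    moreover have "0 \<le> norm a * norm b" by simp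
    ultimately show ?thesis by linarith
  qed
  then show "AE x in M. norm (inner (sec v x) (sec w x)) \<le> norm ((norm (sec v x))\<^sup>2 + (norm (sec w x))\<^sup>2)"
    by simp
qed (rule measurable_inner[OF sec_in_S sec_in_S])

text \<open>The squared pointwise defect is a combination of fibre inner products. Each integrates
  to an inner product in the Hilbert space, where the combination is 0.\<close>

lemma sec_linear: "AE x in M. sec (a *\<^sub>R v + b *\<^sub>R w) x = a *\<^sub>R sec v x + b *\<^sub>R sec w x"
proof -
  let ?u = "a *\<^sub>R v + b *\<^sub>R w" and ?i = "\<lambda>v w x. inner (sec v x) (sec w x)"
  let ?e = "\<lambda>x. ?i ?u ?u x + a\<^sup>2 * ?i v v x + b\<^sup>2 * ?i w w x + 2 * a * b * ?i v w x - 2 * a * ?i ?u v x - 2 * b * ?i ?u w x"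
  have "(norm (p - (a *\<^sub>R q + b *\<^sub>R r)))\<^sup>2 = inner p p + a\<^sup>2 * inner q q + b\<^sup>2 * inner r r + 2 * a * b * inner q r - 2 * a * inner p q - 2 * b * inner p r"
    for p q r :: 'k
    by (simp add: power2_norm_eq_inner inner_diff_left inner_diff_right inner_add_left inner_add_right
        inner_commute[of r p] inner_commute[of q p] inner_commute[of r q])
      (simp add: power2_eq_square algebra_simps)
  then have e: "?e x = (norm (sec ?u x - (a *\<^sub>R sec v x + b *\<^sub>R sec w x)))\<^sup>2" for x
    by simp
  have int: "integrable M ?e"
    by (intro Bochner_Integration.integrable_add Bochner_Integration.integrable_diff integrable_mult_right
        integrable_inner_sec)
  have "(LINT x|M. ?e x) = inner ?u ?u + a\<^sup>2 * inner v v + b\<^sup>2 * inner w w + 2 * a * b * inner v w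
      - 2 * a * inner ?u v - 2 * b * inner ?u w"
    by (simp add: integrable_inner_sec inner_eq_integral)
  also have "\<dots> = 0"
    by (simp add: inner_add_left inner_add_right inner_commute[of w v]) (simp add: power2_eq_square algebra_simps)
  finally have "(LINT x|M. (norm (sec ?u x - (a *\<^sub>R sec v x + b *\<^sub>R sec w x)))\<^sup>2) = 0"
    unfolding e .
  then have "AE x in M. (norm (sec ?u x - (a *\<^sub>R sec v x + b *\<^sub>R sec w x)))\<^sup>2 = 0"
    using int unfolding e by (subst (asm) integral_nonneg_eq_0_iff_AE) auto
  then show ?thesis by eventually_elim simp
qed

lemma sec_diff: "AE x in M. sec (v - w) x = sec v x - sec w x"
  using sec_linear[of 1 v "-1" w] by simp

lemma sec_zero: "AE x in M. sec 0 x = 0"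
  using sec_linear[of 0 0 0 0] by simp

lemma norm_eq_integral: "(norm v)\<^sup>2 = (LINT x|M. (norm (sec v x))\<^sup>2)"
  by (simp add: power2_norm_eq_inner inner_eq_integral)

lemma sec_AE_eqI:
  assumes "AE x in M. sec v x = sec w x"
  shows "v = w"
proof -
  have "AE x in M. (norm (sec (v - w) x))\<^sup>2 = 0"
    using sec_diff[of v w] assms by eventually_elim simp
  then have "(norm (v - w))\<^sup>2 = 0"
    unfolding norm_eq_integral by (rule integral_eq_zero_AE)
  then show ?thesis by simp
qed

lemma elem_of_section_eqI: "AE x in M. sec v x = \<sigma> x \<Longrightarrow> elem_of_section M sec \<sigma> = v"
  unfolding elem_of_section_def
proof (rule the_equality)
  fix w assume "AE x in M. sec v x = \<sigma> x" "AE x in M. sec w x = \<sigma> x"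
  then have "AE x in M. sec w x = sec v x" by eventually_elim simp
  then show "w = v" by (rule sec_AE_eqI)
qed

lemma sec_elem_of_section:
  assumes "\<sigma> \<in> S" "integrable M (\<lambda>x. (norm (\<sigma> x))\<^sup>2)"
  shows "AE x in M. sec (elem_of_section M sec \<sigma>) x = \<sigma> x"
proof -
  obtain v where v: "AE x in M. sec v x = \<sigma> x" using section_ex[OF assms] by blast
  with elem_of_section_eqI[OF v] show ?thesis by simp
qed

text \<open>Norm convergence says that the squared fibre norms of \<open>v n - w\<close> tend to 0
  in the mean, so a subsequence does so almost everywhere. Only countably many null sets are needed
  to split \<open>sec\<close> of the differences.\<close>

lemma sec_LIMSEQ_AE_subseq:
  assumes "v \<longlonglongrightarrow> w"
  obtains r :: "nat \<Rightarrow> nat" where "strict_mono r" "AE x in M. (\<lambda>n. sec (v (r n)) x) \<longlonglongrightarrow> sec w x"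
proof -
  have "(\<lambda>n. (norm (v n - w))\<^sup>2) \<longlonglongrightarrow> 0\<^sup>2"
    using assms by (intro tendsto_power tendsto_norm_zero LIM_zero)
  then have "(\<lambda>n. LINT x|M. norm ((norm (sec (v n - w) x))\<^sup>2)) \<longlonglongrightarrow> 0"
    by (simp add: norm_eq_integral)
  from tendsto_L1_AE_subseq[OF integrable_norm_sec this] obtain r :: "nat \<Rightarrow> nat"
    where r: "strict_mono r" "AE x in M. (\<lambda>n. (norm (sec (v (r n) - w) x))\<^sup>2) \<longlonglongrightarrow> 0"
    by auto
  have "AE x in M. \<forall>n. sec (v (r n) - w) x = sec (v (r n)) x - sec w x"
    unfolding AE_all_countable using sec_diff by blast
  with r(2) have "AE x in M. (\<lambda>n. sec (v (r n)) x) \<longlonglongrightarrow> sec w x"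
  proof eventually_elim
    case (elim x)
    have "(\<lambda>n. sqrt ((norm (sec (v (r n) - w) x))\<^sup>2)) \<longlonglongrightarrow> sqrt 0"
      by (intro tendsto_real_sqrt elim(1))
    moreover have "sqrt ((norm (sec (v (r n) - w) x))\<^sup>2) = norm (sec (v (r n)) x - sec w x)" for n
      unfolding elim(2)[rule_format] by simp
    ultimately have "(\<lambda>n. norm (sec (v (r n)) x - sec w x)) \<longlonglongrightarrow> 0"
      by simp
    then show ?case
      by (rule LIM_zero_cancel[OF tendsto_norm_zero_cancel])
  qed
  with r(1) show ?thesis by (rule that)
qed

end

section \<open>The energy measure of the reference form\<close>

locale duality_setting = direct_integral C \<nu> j M K S sec
  for C :: "('a::metric_space \<Rightarrow> real) set" and \<nu> and j :: "('a \<times> 'a \<Rightarrow> real) \<Rightarrow> 'h::{real_inner, complete_space}"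
    and M :: "'a measure" and K :: "'a \<Rightarrow> 'k::{real_inner, complete_space} set" and S sec +
  fixes E :: "('a \<Rightarrow> real) \<Rightarrow> ('a \<Rightarrow> real) \<Rightarrow> real"
    and \<omega> :: 'h
    and cls :: "('a \<Rightarrow> real) \<Rightarrow> 'l::{real_inner, complete_space, second_countable_topology}"
  assumes locally_compact: "locally_compact_space (euclidean :: 'a topology)"
    and separable: "separable_space (euclidean :: 'a topology)"
    and admissible: "admissible_form E C"
    and energy_measures: "is_energy_measures E C \<nu>"
    and form_space: "is_form_space C \<nu> j"
    and dimension_one: "has_martingale_dimension C \<nu> 1"
    and M_eq: "M = form_measure C \<nu> j \<omega>"
    and minimal: "minimal_energy_dominant C \<nu> M"
    and L2_space: "is_L2_space M cls"
    and closure_dirichlet: "closure_is_dirichlet_form E C M cls"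
begin

lemma sets_M [measurable_cong]: "sets M = sets borel"
  and sigma_finite_M: "sigma_finite_measure M"
  using minimal by (auto simp: minimal_energy_dominant_def energy_dominant_def)

lemma borel_measurable_M: "borel_measurable M = borel_measurable borel"
  using sets_M by (rule measurable_cong_sets) simp

lemma space_M: "space M = UNIV"
  using sets_eq_imp_space_eq[OF sets_M] by simp

lemma pre_formsI: "g \<in> G \<Longrightarrow> f \<in> C \<Longrightarrow> pre_form g f \<in> pre_forms G C"
  unfolding pre_forms_def
  by (intro CollectI exI[of _ "1::nat"] exI[of _ "\<lambda>_. 1"] exI[of _ "\<lambda>_. g"] exI[of _ "\<lambda>_. f"]) simp

lemma j_linear:
  assumes "F1 \<in> pre_forms (insert (\<lambda>x. 1) Cc) C" "F2 \<in> pre_forms (insert (\<lambda>x. 1) Cc) C"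
  shows "j (\<lambda>z. a * F1 z + b * F2 z) = a *\<^sub>R j F1 + b *\<^sub>R j F2"
  using form_space assms by (simp add: is_form_space_def Let_def)

lemma closure_j: "closure (j ` pre_forms Cc C) = UNIV"
  using form_space by (simp add: is_form_space_def)

lemma j_zero: "j (\<lambda>z. 0) = 0"
proof -
  have "(\<lambda>z. 0) \<in> pre_forms (insert (\<lambda>x. 1) Cc) C"
    unfolding pre_forms_def by (intro CollectI exI[of _ "0::nat"]) simp
  from j_linear[OF this this, of 0 0] show ?thesis by simp
qed

lemma j_sum:
  fixes n :: nat
  assumes "\<And>i. i < n \<Longrightarrow> g i \<in> Cc \<and> f i \<in> C"
  shows "j (\<lambda>z. \<Sum>i<n. c i * pre_form (g i) (f i) z) = (\<Sum>i<n. c i *\<^sub>R j (pre_form (g i) (f i)))"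
  using assms
proof (induction n)
  case 0
  then show ?case by (simp add: j_zero)
next
  case (Suc n)
  have "(\<lambda>z. \<Sum>i<n. c i * pre_form (g i) (f i) z) \<in> pre_forms (insert (\<lambda>x. 1) Cc) C"
    unfolding pre_forms_def using Suc.prems
    by (intro CollectI exI[of _ n] exI[of _ c] exI[of _ g] exI[of _ f]) auto
  moreover have "pre_form (g n) (f n) \<in> pre_forms (insert (\<lambda>x. 1) Cc) C"
    using Suc.prems by (intro pre_formsI) auto
  ultimately show ?case
    using j_linear[of _ _ 1 "c n"] Suc by simp
qed

lemma j_pre_formsE:
  assumes "v \<in> j ` pre_forms Cc C"
  obtains n :: nat and c g f where "\<And>i. i < n \<Longrightarrow> g i \<in> Cc \<and> f i \<in> C"
    "v = (\<Sum>i<n. c i *\<^sub>R j (pre_form (g i) (f i)))"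
proof -
  obtain n :: nat and c g f where *: "\<And>i. i < n \<Longrightarrow> g i \<in> Cc \<and> f i \<in> C"
    and v: "v = j (\<lambda>z. \<Sum>i<n. c i * pre_form (g i) (f i) z)"
    using assms unfolding pre_forms_def by auto
  show ?thesis by (rule that[OF *]) (simp_all add: v j_sum[OF *])
qed

section \<open>Energy measures of elements of the Hilbert space\<close>

text \<open>Continuity and density extend agreement from the generators to one argument at a time.
  This is the uniqueness needed by the description in \<open>form_energy\<close>.\<close>

lemma bounded_bilinear_eqI:
  fixes B B' :: "'h \<Rightarrow> 'h \<Rightarrow> real"
  assumes B: "bounded_bilinear B" and B': "bounded_bilinear B'"
    and eq: "\<And>g1 g2 f1 f2. g1 \<in> Cc \<Longrightarrow> g2 \<in> Cc \<Longrightarrow> f1 \<in> C \<Longrightarrow> f2 \<in> C \<Longrightarrow>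
      B (j (pre_form g1 f1)) (j (pre_form g2 f2)) = B' (j (pre_form g1 f1)) (j (pre_form g2 f2))"
  shows "B v w = B' v w"
proof -
  have dense: "P v" if "closed {v. P v}" "\<And>v. v \<in> j ` pre_forms Cc C \<Longrightarrow> P v" for P v
  proof -
    have "closure (j ` pre_forms Cc C) \<subseteq> {v. P v}"
      using that by (intro closure_minimal) auto
    then show ?thesis using closure_j by auto
  qed
  have 1: "B (j (pre_form g f)) w = B' (j (pre_form g f)) w" if gf: "g \<in> Cc" "f \<in> C" for g f w
  proof (rule dense[of "\<lambda>w. B (j (pre_form g f)) w = B' (j (pre_form g f)) w"])
    show "closed {w. B (j (pre_form g f)) w = B' (j (pre_form g f)) w}"
      by (intro closed_Collect_eq linear_continuous_on bounded_bilinear.bounded_linear_right[OF B]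
          bounded_bilinear.bounded_linear_right[OF B'])
    fix w assume "w \<in> j ` pre_forms Cc C"
    then show "B (j (pre_form g f)) w = B' (j (pre_form g f)) w"
      by (elim j_pre_formsE) (simp add: bounded_bilinear.sum_right[OF B] bounded_bilinear.sum_right[OF B']
          bounded_bilinear.scaleR_right[OF B] bounded_bilinear.scaleR_right[OF B'] eq gf)
  qed
  show ?thesis
  proof (rule dense[of "\<lambda>v. B v w = B' v w"])
    show "closed {v. B v w = B' v w}"
      by (intro closed_Collect_eq linear_continuous_on bounded_bilinear.bounded_linear_left[OF B]
          bounded_bilinear.bounded_linear_left[OF B'])
    fix v assume "v \<in> j ` pre_forms Cc C"
    then show "B v w = B' v w"
      by (elim j_pre_formsE) (simp add: bounded_bilinear.sum_left[OF B] bounded_bilinear.sum_left[OF B']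
          bounded_bilinear.scaleR_left[OF B] bounded_bilinear.scaleR_left[OF B'] 1)
  qed
qed

lemma finite_signed_measure_energy: "f \<in> C \<Longrightarrow> f' \<in> C \<Longrightarrow> finite_signed_measure (\<nu> f f')"
  using energy_measures by (simp add: is_energy_measures_def)

lemma signed_integral_energy:
  assumes "f \<in> C" "f' \<in> C" "g \<in> borel_measurable borel" "\<And>x. \<bar>g x\<bar> \<le> c"
  shows "signed_integral (\<nu> f f') g = (LINT x|M. g x * inner (sec (j (d_u f)) x) (sec (j (d_u f')) x))"
  by (rule signed_integral_RN_deriv[OF finite_signed_measure_energy RN_deriv_energy sets_M])
    (use assms in auto)

text \<open>Multiplying sections by the indicator of \<open>A\<close> is a linear contraction
  \<open>R\<close>, and the form is the inner product composed with \<open>R\<close> in its first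
  argument.\<close>

lemma bounded_bilinear_restricted_inner:
  assumes A: "A \<in> sets borel"
  shows "bounded_bilinear (\<lambda>v w. LINT x|M. indicator A x * inner (sec v x) (sec w x))"
proof -
  define R where "R v = elem_of_section M sec (\<lambda>x. indicator A x *\<^sub>R sec v x)" for v
  have A': "indicator A \<in> borel_measurable M" using A by (simp add: borel_measurable_M)
  have R: "AE x in M. sec (R v) x = indicator A x *\<^sub>R sec v x" for v
    unfolding R_def
  proof (rule sec_elem_of_section)
    show S: "(\<lambda>x. indicator A x *\<^sub>R sec v x) \<in> S" by (intro S_scale sec_in_S A')
    show "integrable M (\<lambda>x. (norm (indicator A x *\<^sub>R sec v x))\<^sup>2)"
      by (rule Bochner_Integration.integrable_bound[OF integrable_norm_sec[of v]])
        (use measurable_norm[OF S] in \<open>auto simp: indicator_def\<close>)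
  qed
  have R_inner: "(LINT x|M. indicator A x * inner (sec v x) (sec w x)) = inner (R v) w" for v w
    unfolding inner_eq_integral
  proof (rule integral_cong_AE)
    show "AE x in M. indicator A x * inner (sec v x) (sec w x) = inner (sec (R v) x) (sec w x)"
      using R[of v] by eventually_elim simp
  qed (intro borel_measurable_times A' measurable_inner sec_in_S)+
  have R_lin: "R (a *\<^sub>R v + b *\<^sub>R w) = a *\<^sub>R R v + b *\<^sub>R R w" for a b v w
    by (rule sec_AE_eqI, use R[of "a *\<^sub>R v + b *\<^sub>R w"] R[of v] R[of w] sec_linear[of a v b w] sec_linear[of a "R v" b "R w"]
        in eventually_elim) (simp add: algebra_simps)
  have R_norm: "norm (R v) \<le> norm v" for v
  proof -
    have "(norm (R v))\<^sup>2 \<le> (norm v)\<^sup>2"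
      unfolding norm_eq_integral
      by (rule integral_mono_AE, rule integrable_norm_sec, rule integrable_norm_sec, use R[of v] in eventually_elim)
        (simp add: indicator_def)
    then show ?thesis by (simp add: power2_le_iff_abs_le)
  qed
  have "bounded_linear R"
  proof (rule bounded_linear_intro[of _ 1])
    show "R (v + w) = R v + R w" for v w using R_lin[of 1 v 1 w] by simp
    show "R (a *\<^sub>R v) = a *\<^sub>R R v" for a v using R_lin[of a v 0 v] by simp
  qed (simp add: R_norm)
  then show ?thesis
    unfolding R_inner by (rule bounded_bilinear.comp1[OF bounded_bilinear_inner])
qed

text \<open>On generators the right side integrates the densities of the energy measures, hence has
  the prescribed values; uniqueness does the rest. Thus the fibre inner product is the density of
  the energy measure of a pair with respect to \<open>M\<close>.\<close>

lemma form_energy_eq: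
  assumes A: "A \<in> sets borel"
  shows "form_energy C \<nu> j v w A = (LINT x|M. indicator A x * inner (sec v x) (sec w x))"
proof -
  let ?B = "\<lambda>v w. LINT x|M. indicator A x * inner (sec v x) (sec w x)"
  let ?P = "\<lambda>B. bounded_bilinear B \<and> (\<forall>g1\<in>Cc. \<forall>g2\<in>Cc. \<forall>f1\<in>C. \<forall>f2\<in>C.
    B (j (pre_form g1 f1)) (j (pre_form g2 f2)) = signed_integral (\<nu> f1 f2) (\<lambda>x. indicator A x * (g1 x * g2 x)))"
  have val: "?B (j (pre_form g1 f1)) (j (pre_form g2 f2)) = signed_integral (\<nu> f1 f2) (\<lambda>x. indicator A x * (g1 x * g2 x))"
    if g: "g1 \<in> Cc" "g2 \<in> Cc" and f: "f1 \<in> C" "f2 \<in> C" for g1 g2 f1 f2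
  proof -
    have [measurable]: "g1 \<in> borel_measurable borel" "g2 \<in> borel_measurable borel"
      using g by (auto intro: Cc_borel_measurable)
    have m: "(\<lambda>x. indicator A x * (g1 x * g2 x)) \<in> borel_measurable borel" using A by measurable
    obtain c1 where c1: "\<And>x. \<bar>g1 x\<bar> \<le> c1" by (rule Cc_bounded[OF g(1)]) blast
    obtain c2 where c2: "\<And>x. \<bar>g2 x\<bar> \<le> c2" by (rule Cc_bounded[OF g(2)]) blast
    have "\<bar>indicator A x * (g1 x * g2 x)\<bar> \<le> 1 * (c1 * c2)" for x
      unfolding abs_mult using c1[of x] c2[of x] by (intro mult_mono) (auto simp: indicator_def)
    from signed_integral_energy[OF f m this]
    have "signed_integral (\<nu> f1 f2) (\<lambda>x. indicator A x * (g1 x * g2 x)) =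
        (LINT x|M. indicator A x * (g1 x * g2 x) * inner (sec (j (d_u f1)) x) (sec (j (d_u f2)) x))" .
    also have "\<dots> = ?B (j (pre_form g1 f1)) (j (pre_form g2 f2))"
    proof (rule integral_cong_AE)
      show "AE x in M. indicator A x * (g1 x * g2 x) * inner (sec (j (d_u f1)) x) (sec (j (d_u f2)) x) =
          indicator A x * inner (sec (j (pre_form g1 f1)) x) (sec (j (pre_form g2 f2)) x)"
        using sec_pre_form[OF g(1) f(1)] sec_pre_form[OF g(2) f(2)] by eventually_elim simp
    qed (use m A measurable_inner[OF sec_in_S sec_in_S] in \<open>auto simp: borel_measurable_M\<close>)
    finally show ?thesis by simp
  qed
  have "(THE B. ?P B) = ?B"
  proof (rule the_equality)
    show "?P ?B" using val bounded_bilinear_restricted_inner[OF A] by simp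
    fix B assume B: "?P B"
    have "B v w = ?B v w" for v w
      by (rule bounded_bilinear_eqI) (use B val bounded_bilinear_restricted_inner[OF A] in auto)
    then show "B = ?B" by blast
  qed
  then show ?thesis unfolding form_energy_def by simp
qed

text \<open>\<open>M\<close> occurs both as reference measure of the direct integral and as energy
  measure of \<open>\<omega>\<close>; the previous density formula, applied to
  \<open>\<omega>\<close>, relates the two roles.\<close>

lemma M_eq_density: "M = density M (\<lambda>x. ennreal ((norm (sec \<omega> x))\<^sup>2))"
proof -
  let ?N = "density M (\<lambda>x. ennreal ((norm (sec \<omega> x))\<^sup>2))"
  have m: "(\<lambda>x. ennreal ((norm (sec \<omega> x))\<^sup>2)) \<in> borel_measurable M"
    using measurable_norm[OF sec_in_S] by measurable
  have eq: "ennreal (form_energy C \<nu> j \<omega> \<omega> A) = emeasure ?N A" if A: "A \<in> sets borel" for A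
  proof -
    have "emeasure ?N A = (\<integral>\<^sup>+x. ennreal (indicator A x * inner (sec \<omega> x) (sec \<omega> x)) \<partial>M)"
      using A m sets_M
      by (subst emeasure_density) (auto simp: indicator_def power2_norm_eq_inner intro!: nn_integral_cong)
    also have "\<dots> = ennreal (LINT x|M. indicator A x * inner (sec \<omega> x) (sec \<omega> x))"
    proof (rule nn_integral_eq_integral)
      show "integrable M (\<lambda>x. indicator A x * inner (sec \<omega> x) (sec \<omega> x))"
        using integrable_mult_indicator[OF _ integrable_inner_sec, of A \<omega> \<omega>] A sets_M by simp
    qed simp
    finally show ?thesis by (simp add: form_energy_eq[OF A])
  qed
  have "M = measure_of UNIV (sets borel) (\<lambda>A. ennreal (form_energy C \<nu> j \<omega> \<omega> A))"
    using M_eq by (simp add: form_measure_def measure_from_def)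
  also have "\<dots> = measure_of UNIV (sets borel) (emeasure ?N)"
    by (rule measure_of_eq) (use eq sets.sigma_sets_eq[of "borel :: 'a measure"] in auto)
  also have "\<dots> = ?N"
    using measure_of_of_measure[of ?N] by (simp add: sets_M space_M)
  finally show ?thesis .
qed

text \<open>Densities with respect to a sigma-finite measure are unique almost everywhere, and the
  constant 1 is another density of \<open>M\<close>.\<close>

lemma norm_sec_omega: "AE x in M. norm (sec \<omega> x) = 1"
proof -
  have m: "(\<lambda>x. ennreal ((norm (sec \<omega> x))\<^sup>2)) \<in> borel_measurable M"
    using measurable_norm[OF sec_in_S] by measurable
  have "AE x in M. ennreal ((norm (sec \<omega> x))\<^sup>2) = 1"
    by (rule sigma_finite_measure.density_unique[OF sigma_finite_M m])
      (use M_eq_density in \<open>simp_all add: density_1\<close>)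
  then show ?thesis
  proof eventually_elim
    case (elim x)
    then have "(norm (sec \<omega> x))\<^sup>2 = 1" by (metis ennreal_eq_1)
    then show ?case by (simp add: power2_eq_1_iff) (metis norm_ge_zero le_minus_one_simps(3))
  qed
qed

text \<open>The constant 1 agrees almost everywhere with the squared fibre norm of
  \<open>\<omega>\<close>, which is integrable.\<close>

sublocale finite_measure M
proof
  have "integrable M (\<lambda>x. 1::real)"
  proof (rule integrable_cong_AE_imp[OF integrable_norm_sec[of \<omega>]])
    show "AE x in M. (norm (sec \<omega> x))\<^sup>2 = 1"
      using norm_sec_omega by eventually_elim simp
  qed simp
  then show "emeasure M (space M) \<noteq> \<infinity>"
    by (simp add: integrable_iff_bounded)
qed

end

section \<open>Fibres in martingale dimension one\<close>

context duality_setting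
begin

text \<open>The dimension is witnessed by some minimal energy-dominant \<open>M'\<close>, possibly
  different from \<open>M\<close>. With \<open>D\<close> the density of \<open>M\<close> relative to
  \<open>M'\<close>, the energy densities relative to \<open>M'\<close> are \<open>D\<close> times
  the fibre inner products, so the rank bound concerns a rescaled Gram matrix.\<close>

lemma parallel_sec_gradients:
  assumes f: "f1 \<in> C" "f2 \<in> C"
  shows "AE x in M. parallel (sec (j (d_u f1)) x) (sec (j (d_u f2)) x)"
proof -
  obtain M' p where M': "minimal_energy_dominant C \<nu> M'" and p: "is_pointwise_index C \<nu> M' p"
    and sup: "esssup M' (\<lambda>x. ereal_of_enat (p x)) = ereal_of_enat 1"
    using dimension_one by (auto simp: has_martingale_dimension_def)
  have sets: "sets M' = sets borel" and sf: "sigma_finite_measure M'"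
    using M' by (auto simp: minimal_energy_dominant_def energy_dominant_def)
  interpret M': sigma_finite_measure M' by fact
  have ac: "absolutely_continuous M' M"
    using minimal M' by (simp add: minimal_energy_dominant_def)
  obtain D where D: "D \<in> borel_measurable M'" "AE x in M'. RN_deriv M' M x = ennreal (D x)"
    "AE x in M. 0 < D x" "\<And>x. 0 \<le> D x"
    by (rule M'.real_RN_deriv[OF finite_measure_axioms ac]) (simp_all add: sets sets_M)
  have "M = density M' (RN_deriv M' M)"
    using M'.density_RN_deriv[OF ac] by (simp add: sets sets_M)
  also have "\<dots> = density M' (\<lambda>x. ennreal (D x))"
    using D(1,2) by (intro density_cong) auto
  finally have M: "M = density M' (\<lambda>x. ennreal (D x))" .
  have "AE x in M'. ereal_of_enat (p x) \<le> ereal_of_enat 1"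
    unfolding sup[symmetric] by (rule esssup_AE)
  then have p1: "AE x in M'. p x \<le> 1" by simp
  \<comment> \<open>The two functions as a sequence, so that the rank bound can be used with
    \<open>N = 2\<close>.\<close>
  define f where "f i = (if i = 0 then f1 else f2)" for i :: nat
  define h where "h i k x = inner (sec (j (d_u (f i))) x) (sec (j (d_u (f k))) x)" for i k x
  have fC: "f i \<in> C" for i using f by (simp add: f_def)
  have rn: "is_RN_deriv M' (\<nu> (f i) (f k)) (\<lambda>x. D x * h i k x)" for i k
  proof -
    have rn: "is_RN_deriv M (\<nu> (f i) (f k)) (h i k)"
      unfolding h_def by (rule RN_deriv_energy[OF fC fC])
    have hm: "h i k \<in> borel_measurable M'"
      using rn sets by (auto simp: is_RN_deriv_def borel_measurable_M cong: measurable_cong_sets dest!: borel_measurable_integrable)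
    have "integrable M' (\<lambda>x. D x * h i k x)"
      using rn integrable_real_density[OF D(1) _ hm] D(4) M by (simp add: is_RN_deriv_def)
    moreover have "\<nu> (f i) (f k) A = (LINT x:A|M'. D x * h i k x)" if A: "A \<in> sets borel" for A
    proof -
      have "\<nu> (f i) (f k) A = (LINT x|M. indicator A x * h i k x)"
        using rn A by (simp add: is_RN_deriv_def set_lebesgue_integral_def)
      also have "\<dots> = (LINT x|density M' (\<lambda>x. ennreal (D x)). indicator A x * h i k x)"
        using M by simp
      also have "\<dots> = (LINT x|M'. D x * (indicator A x * h i k x))"
        by (rule integral_real_density) (use D A hm sets in auto)
      finally show ?thesis by (simp add: set_lebesgue_integral_def mult_ac)
    qed
    ultimately show ?thesis by (simp add: is_RN_deriv_def)
  qed
  have "bounds_energy_rank C \<nu> M' p" using p by (simp add: is_pointwise_index_def)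
  then have "AE x in M'. enat (vec_space.rank 2 (Matrix.mat 2 2 (\<lambda>(i, k). D x * h i k x))) \<le> p x"
    unfolding bounds_energy_rank_def
    by (elim allE[of _ "2::nat"] allE[of _ f] allE[of _ "\<lambda>i k x. D x * h i k x"]) (simp add: fC rn)
  with p1 have "AE x in M'. vec_space.rank 2 (Matrix.mat 2 2 (\<lambda>(i, k). D x * h i k x)) < 2"
  proof eventually_elim
    case (elim x)
    then have "enat (vec_space.rank 2 (Matrix.mat 2 2 (\<lambda>(i, k). D x * h i k x))) \<le> 1"
      by (rule order_trans[rotated])
    then show ?case by (simp add: one_enat_def)
  qed
  \<comment> \<open>Absolute continuity transports the bound to \<open>M\<close>, for which
    \<open>D\<close> is positive almost everywhere and can be divided out.\<close>
  then have "AE x in M. vec_space.rank 2 (Matrix.mat 2 2 (\<lambda>(i, k). D x * h i k x)) < 2"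
    by (rule absolutely_continuous_AE[OF sets_M[folded sets] ac])
  with D(3) show ?thesis
  proof eventually_elim
    case (elim x)
    from gram_rank_less_2_imp_parallel[of "D x" "\<lambda>i. sec (j (d_u (f i))) x"] elim
    show ?case by (simp add: h_def f_def)
  qed
qed

lemma sec_sum:
  fixes n :: nat
  shows "AE x in M. sec (\<Sum>i<n. c i *\<^sub>R v i) x = (\<Sum>i<n. c i *\<^sub>R sec (v i) x)"
proof (induction n)
  case 0
  then show ?case using sec_zero by simp
next
  case (Suc n)
  then show ?case
    using sec_linear[of 1 "\<Sum>i<n. c i *\<^sub>R v i" "c n" "v n"] by eventually_elim simp
qed

text \<open>Multiplying by functions and adding finitely many gradients only forms linear
  combinations in each fibre, where all the gradients involved are pairwise parallel.\<close>

lemma parallel_sec_pre_forms: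
  assumes v: "v \<in> j ` pre_forms Cc C" and w: "w \<in> j ` pre_forms Cc C"
  shows "AE x in M. parallel (sec v x) (sec w x)"
proof -
  obtain n :: nat and c g f where gf: "\<And>i. i < n \<Longrightarrow> g i \<in> Cc \<and> f i \<in> C"
    and v: "v = (\<Sum>i<n. c i *\<^sub>R j (pre_form (g i) (f i)))"
    by (rule j_pre_formsE[OF v]) (rule that)
  obtain n' :: nat and c' g' f' where gf': "\<And>i. i < n' \<Longrightarrow> g' i \<in> Cc \<and> f' i \<in> C"
    and w: "w = (\<Sum>i<n'. c' i *\<^sub>R j (pre_form (g' i) (f' i)))"
    by (rule j_pre_formsE[OF w]) (rule that)
  have "AE x in M. \<forall>i\<in>{..<n}. sec (j (pre_form (g i) (f i))) x = g i x *\<^sub>R sec (j (d_u (f i))) x"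
    using gf sec_pre_form by (intro AE_finite_allI) auto
  moreover have "AE x in M. \<forall>i\<in>{..<n'}. sec (j (pre_form (g' i) (f' i))) x = g' i x *\<^sub>R sec (j (d_u (f' i))) x"
    using gf' sec_pre_form by (intro AE_finite_allI) auto
  moreover have "AE x in M. \<forall>i\<in>{..<n}. \<forall>k\<in>{..<n'}. parallel (sec (j (d_u (f i))) x) (sec (j (d_u (f' k))) x)"
    using gf gf' parallel_sec_gradients by (intro AE_finite_allI) auto
  moreover have "AE x in M. sec v x = (\<Sum>i<n. c i *\<^sub>R sec (j (pre_form (g i) (f i))) x)"
    unfolding v by (rule sec_sum)
  moreover have "AE x in M. sec w x = (\<Sum>i<n'. c' i *\<^sub>R sec (j (pre_form (g' i) (f' i))) x)"
    unfolding w by (rule sec_sum)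
  ultimately show ?thesis
  proof eventually_elim
    case (elim x)
    have "sec v x = (\<Sum>i<n. (c i * g i x) *\<^sub>R sec (j (d_u (f i))) x)"
      unfolding elim(4) by (rule sum.cong) (use elim(1) in auto)
    moreover have "sec w x = (\<Sum>k<n'. (c' k * g' k x) *\<^sub>R sec (j (d_u (f' k))) x)"
      unfolding elim(5) by (rule sum.cong) (use elim(2) in auto)
    moreover have "parallel (\<Sum>i<n. (c i * g i x) *\<^sub>R sec (j (d_u (f i))) x)
        (\<Sum>k<n'. (c' k * g' k x) *\<^sub>R sec (j (d_u (f' k))) x)"
      by (rule parallel_sums) (use elim(3) in blast)
    ultimately show ?case by (simp only:)
  qed
qed

lemma parallel_LIMSEQ:
  fixes a b :: "'c::real_inner"
  assumes "\<And>n. parallel (s n) b" "s \<longlonglongrightarrow> a"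
  shows "parallel a b"
  unfolding parallel_def
proof (intro allI)
  fix c d
  have "(\<lambda>n. inner (s n) c * inner b d) \<longlonglongrightarrow> inner a c * inner b d"
    "(\<lambda>n. inner (s n) d * inner b c) \<longlonglongrightarrow> inner a d * inner b c"
    by (intro tendsto_intros assms)+
  moreover have "inner (s n) c * inner b d = inner (s n) d * inner b c" for n
    using assms(1) by (simp add: parallel_def)
  ultimately show "inner a c * inner b d = inner a d * inner b c"
    using LIMSEQ_unique by simp
qed

text \<open>Every \<open>v\<close> is a limit of generators; along a subsequence the sections
  converge almost everywhere, and being parallel to a fixed vector is a closed condition.\<close>

lemma parallel_sec_closure:
  assumes "\<And>u. u \<in> j ` pre_forms Cc C \<Longrightarrow> AE x in M. parallel (sec u x) (sec w x)"
  shows "AE x in M. parallel (sec v x) (sec w x)"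
proof -
  have "v \<in> closure (j ` pre_forms Cc C)" using closure_j by simp
  then obtain s where s: "\<And>n. s n \<in> j ` pre_forms Cc C" "s \<longlonglongrightarrow> v"
    unfolding closure_sequential by blast
  obtain r :: "nat \<Rightarrow> nat" where r: "AE x in M. (\<lambda>n. sec (s (r n)) x) \<longlonglongrightarrow> sec v x"
    using sec_LIMSEQ_AE_subseq[OF s(2)] by blast
  have "AE x in M. \<forall>n. parallel (sec (s (r n)) x) (sec w x)"
    unfolding AE_all_countable using assms s(1) by blast
  with r show ?thesis
  proof eventually_elim
    case (elim x)
    show ?case by (rule parallel_LIMSEQ[OF elim(2)[rule_format] elim(1)])
  qed
qed

text \<open>Martingale dimension one means that almost all fibres are at most one-dimensional.\<close>

lemma parallel_sec: "AE x in M. parallel (sec v x) (sec w x)"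
proof (rule parallel_sec_closure)
  \<comment> \<open>The closure argument is applied once to each argument, with symmetry in
    between.\<close>
  fix u assume u: "u \<in> j ` pre_forms Cc C"
  have "AE x in M. parallel (sec w x) (sec u x)"
    by (rule parallel_sec_closure, rule parallel_sec_pre_forms[OF _ u])
  then show "AE x in M. parallel (sec u x) (sec w x)"
    by (simp add: parallel_commute)
qed

text \<open>Parallel means equality in the Cauchy-Schwarz inequality; as the fibre of
  \<open>\<omega>\<close> is a unit vector, the residual of the projection onto it has norm
  0.\<close>

lemma sec_eq_inner_omega: "AE x in M. sec v x = inner (sec v x) (sec \<omega> x) *\<^sub>R sec \<omega> x"
  using parallel_sec[of v \<omega>] norm_sec_omega
proof eventually_elim
  case (elim x)
  let ?v = "sec v x" and ?w = "sec \<omega> x"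
  have w: "inner ?w ?w = 1" using elim(2) by (simp add: dot_square_norm)
  have "inner ?v ?v = (inner ?v ?w)\<^sup>2"
    using elim(1) w by (simp add: parallel_iff_Cauchy_Schwarz_eq)
  then have "inner (?v - inner ?v ?w *\<^sub>R ?w) (?v - inner ?v ?w *\<^sub>R ?w) = 0"
    using w by (simp add: inner_diff_left inner_diff_right inner_commute[of ?w ?v] power2_eq_square)
  then show ?case by simp
qed

end

section \<open>The duality map\<close>

context duality_setting
begin

abbreviation "star_\<omega> \<equiv> star M cls sec \<omega>"
abbreviation "star_inv_\<omega> \<equiv> star_inv M cls sec \<omega>"
abbreviation "rep_M \<equiv> rep M cls"

lemma cls_linear: "f \<in> L2_functions M \<Longrightarrow> g \<in> L2_functions M \<Longrightarrow>
    cls (\<lambda>x. a * f x + b * g x) = a *\<^sub>R cls f + b *\<^sub>R cls g"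
  and inner_cls: "f \<in> L2_functions M \<Longrightarrow> g \<in> L2_functions M \<Longrightarrow> inner (cls f) (cls g) = (LINT x|M. f x * g x)"
  and cls_surj: "cls ` L2_functions M = UNIV"
  using L2_space by (simp_all add: is_L2_space_def)

lemma rep_in_L2: "rep_M u \<in> L2_functions M"
  and cls_rep: "cls (rep_M u) = u"
proof -
  have "\<exists>f. f \<in> L2_functions M \<and> cls f = u" using cls_surj by (metis UNIV_I imageE)
  from someI_ex[OF this] show "rep_M u \<in> L2_functions M" "cls (rep_M u) = u"
    by (simp_all add: rep_def)
qed

lemma rep_measurable: "rep_M u \<in> borel_measurable M"
  and rep_square_integrable: "integrable M (\<lambda>x. (rep_M u x)\<^sup>2)"
  using rep_in_L2 by (auto simp: L2_functions_def)

lemma inner_rep: "inner u v = (LINT x|M. rep_M u x * rep_M v x)"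
  using inner_cls[OF rep_in_L2 rep_in_L2, of u v] by (simp add: cls_rep)

lemma inner_rep_cls: "f \<in> L2_functions M \<Longrightarrow> inner u (cls f) = (LINT x|M. rep_M u x * f x)"
  using inner_cls[OF rep_in_L2, of f u] by (simp add: cls_rep)

lemma L2_bounded_mult:
  assumes f: "f \<in> L2_functions M" and g: "g \<in> borel_measurable M" and c: "AE x in M. \<bar>g x\<bar> \<le> c"
  shows "(\<lambda>x. f x * g x) \<in> L2_functions M"
proof -
  have fm: "f \<in> borel_measurable M" using f by (simp add: L2_functions_def)
  have "integrable M (\<lambda>x. (f x * g x)\<^sup>2)"
  proof (rule Bochner_Integration.integrable_bound)
    show "integrable M (\<lambda>x. c\<^sup>2 * (f x)\<^sup>2)" using f by (simp add: L2_functions_def)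
    show "(\<lambda>x. (f x * g x)\<^sup>2) \<in> borel_measurable M"
      by (intro borel_measurable_power borel_measurable_times fm g)
    show "AE x in M. norm ((f x * g x)\<^sup>2) \<le> norm (c\<^sup>2 * (f x)\<^sup>2)"
      using c
    proof eventually_elim
      case (elim x)
      then have "(g x)\<^sup>2 \<le> c\<^sup>2" using abs_le_square_iff[of "g x" c] by simp
      then have "(f x)\<^sup>2 * (g x)\<^sup>2 \<le> (f x)\<^sup>2 * c\<^sup>2" by (rule mult_left_mono) simp
      then show ?case by (simp add: power_mult_distrib mult.commute)
    qed
  qed
  then show ?thesis using borel_measurable_times[OF fm g] by (simp add: L2_functions_def)
qed

text \<open>\<open>rep\<close> is an arbitrary choice within the class; the squared distance from
  \<open>f\<close> expands into inner products of equal classes and vanishes.\<close>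

lemma rep_cls:
  assumes f: "f \<in> L2_functions M"
  shows "AE x in M. rep_M (cls f) x = f x"
proof -
  let ?r = "rep_M (cls f)"
  have r: "?r \<in> L2_functions M" by (rule rep_in_L2)
  have i: "integrable M (\<lambda>x. p x * q x)" if "p \<in> L2_functions M" "q \<in> L2_functions M" for p q :: "'a \<Rightarrow> real"
  proof (rule Bochner_Integration.integrable_bound)
    show "integrable M (\<lambda>x. (p x)\<^sup>2 + (q x)\<^sup>2)" using that by (simp add: L2_functions_def)
    have "\<bar>a * b\<bar> \<le> \<bar>a\<^sup>2 + b\<^sup>2\<bar>" for a b :: real
    proof -
      have "2 * \<bar>a\<bar> * \<bar>b\<bar> \<le> \<bar>a\<bar>\<^sup>2 + \<bar>b\<bar>\<^sup>2" by (rule sum_squares_bound)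
      moreover have "0 \<le> \<bar>a\<bar> * \<bar>b\<bar>" by simp
      ultimately show ?thesis unfolding abs_mult power2_abs by linarith
    qed
    then show "AE x in M. norm (p x * q x) \<le> norm ((p x)\<^sup>2 + (q x)\<^sup>2)" by simp
  qed (use that in \<open>auto simp: L2_functions_def\<close>)
  have eq: "(?r x - f x)\<^sup>2 = ?r x * ?r x - 2 * (?r x * f x) + f x * f x" for x
    by (simp add: power2_eq_square algebra_simps)
  have "(LINT x|M. (?r x - f x)\<^sup>2) = (LINT x|M. ?r x * ?r x) - 2 * (LINT x|M. ?r x * f x) + (LINT x|M. f x * f x)"
    unfolding eq using i[OF r r] i[OF r f] i[OF f f] by simp
  also have "\<dots> = 0"
    by (simp add: inner_cls[symmetric] r f cls_rep)
  finally have "(LINT x|M. (?r x - f x)\<^sup>2) = 0" .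
  moreover have "integrable M (\<lambda>x. (?r x - f x)\<^sup>2)"
    unfolding eq using i[OF r r] i[OF r f] i[OF f f] by simp
  ultimately have "AE x in M. (?r x - f x)\<^sup>2 = 0"
    by (simp add: integral_nonneg_eq_0_iff_AE)
  then show ?thesis by eventually_elim simp
qed

lemma sec_star: "AE x in M. sec (star_\<omega> u) x = rep_M u x *\<^sub>R sec \<omega> x"
  unfolding star_def section_mult_def
proof (rule sec_elem_of_section)
  show S: "(\<lambda>x. rep_M u x *\<^sub>R sec \<omega> x) \<in> S" by (intro S_scale sec_in_S rep_measurable)
  show "integrable M (\<lambda>x. (norm (rep_M u x *\<^sub>R sec \<omega> x))\<^sup>2)"
  proof (rule integrable_cong_AE_imp[OF rep_square_integrable[of u]])
    show "(\<lambda>x. (norm (rep_M u x *\<^sub>R sec \<omega> x))\<^sup>2) \<in> borel_measurable M"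
      using measurable_norm[OF S] by measurable
    show "AE x in M. (rep_M u x)\<^sup>2 = (norm (rep_M u x *\<^sub>R sec \<omega> x))\<^sup>2"
      using norm_sec_omega by eventually_elim simp
  qed
qed

lemma inner_star: "inner (star_\<omega> u) (star_\<omega> v) = inner u v"
  unfolding inner_rep inner_eq_integral
proof (rule integral_cong_AE)
  show "AE x in M. inner (sec (star_\<omega> u) x) (sec (star_\<omega> v) x) = rep_M u x * rep_M v x"
    using sec_star[of u] sec_star[of v] norm_sec_omega by eventually_elim (simp add: dot_square_norm)
qed (intro borel_measurable_times rep_measurable measurable_inner sec_in_S)+

lemma star_linear: "star_\<omega> (a *\<^sub>R u + b *\<^sub>R v) = a *\<^sub>R star_\<omega> u + b *\<^sub>R star_\<omega> v"
  by (rule inner_preserving_imp_linear[OF inner_star])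

lemma star_diff: "star_\<omega> (u - v) = star_\<omega> u - star_\<omega> v"
  using star_linear[of 1 u "-1" v] by simp

lemma norm_star: "norm (star_\<omega> u) = norm u"
  by (simp add: norm_eq_sqrt_inner inner_star)

lemma star_inj: "star_\<omega> u = star_\<omega> v \<Longrightarrow> u = v"
  using norm_star[of "u - v"] by (simp add: star_diff)

lemma rep_star_eq: "AE x in M. rep_M u x = inner (sec (star_\<omega> u) x) (sec \<omega> x)"
  using sec_star[of u] norm_sec_omega by eventually_elim (simp add: dot_square_norm)

text \<open>The candidate is the class of the coefficient of \<open>v\<close> along
  \<open>\<omega>\<close>. Its image has the same inner products as \<open>v\<close> with all
  images, in particular with itself, and the same norm as \<open>v\<close>; so the difference is
  0.\<close>

lemma star_surj: "\<exists>u. star_\<omega> u = v"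
proof -
  let ?g = "\<lambda>x. inner (sec v x) (sec \<omega> x)"
  have m: "?g \<in> borel_measurable M" by (rule measurable_inner[OF sec_in_S sec_in_S])
  have "integrable M (\<lambda>x. (?g x)\<^sup>2)"
  proof (rule Bochner_Integration.integrable_bound[OF integrable_norm_sec[of v]])
    show "AE x in M. norm ((?g x)\<^sup>2) \<le> norm ((norm (sec v x))\<^sup>2)"
      using norm_sec_omega
    proof eventually_elim
      case (elim x)
      then have "\<bar>?g x\<bar> \<le> norm (sec v x)" using Cauchy_Schwarz_ineq2[of "sec v x" "sec \<omega> x"] by simp
      then have "\<bar>?g x\<bar>\<^sup>2 \<le> (norm (sec v x))\<^sup>2" by (rule power_mono) simp
      then show ?case by simp
    qed
  qed (use m in simp)
  with m have g: "?g \<in> L2_functions M" by (simp add: L2_functions_def)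
  let ?u = "cls ?g"
  have star: "inner (star_\<omega> ?u) (star_\<omega> w) = inner v (star_\<omega> w)" for w
  proof -
    have "inner (star_\<omega> ?u) (star_\<omega> w) = (LINT x|M. rep_M w x * ?g x)"
      by (simp add: inner_star inner_commute[of ?u] inner_rep_cls[OF g])
    also have "\<dots> = inner v (star_\<omega> w)"
      unfolding inner_eq_integral
    proof (rule integral_cong_AE)
      show "AE x in M. rep_M w x * ?g x = inner (sec v x) (sec (star_\<omega> w) x)"
        using sec_star[of w] by eventually_elim simp
    qed (intro borel_measurable_times rep_measurable measurable_inner sec_in_S)+
    finally show ?thesis .
  qed
  \<comment> \<open>Dimension one enters here: the component along \<open>\<omega>\<close> is all of
    the fibre vector, so no norm is lost.\<close>
  have "inner v v = inner ?u ?u"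
  proof -
    have "inner v v = (LINT x|M. ?g x * ?g x)"
      unfolding inner_eq_integral
    proof (rule integral_cong_AE)
      show "AE x in M. inner (sec v x) (sec v x) = ?g x * ?g x"
        using sec_eq_inner_omega[of v]
      proof eventually_elim
        case (elim x)
        have "inner (sec v x) (sec v x) = inner (sec v x) (?g x *\<^sub>R sec \<omega> x)"
          using elim by (rule arg_cong)
        then show ?case by simp
      qed
    qed (intro borel_measurable_times measurable_inner sec_in_S)+
    then show ?thesis by (simp add: inner_cls[OF g g])
  qed
  then have "inner (star_\<omega> ?u - v) (star_\<omega> ?u - v) = 0"
    using star[of ?u] inner_star[of ?u ?u] inner_commute[of v "star_\<omega> ?u"]
    unfolding inner_diff_left inner_diff_right by linarith
  then have "star_\<omega> ?u = v" by simp
  then show ?thesis ..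
qed

lemma star_star_inv: "star_\<omega> (star_inv_\<omega> v) = v"
  unfolding star_inv_def using star_surj by (metis f_inv_into_f rangeI)

text \<open>The adjoint of a unitary map is its inverse; this moves pairings with gradients into the
  space of square integrable functions.\<close>

lemma inner_star_left: "inner (star_\<omega> u) v = inner u (star_inv_\<omega> v)"
  using inner_star[of u "star_inv_\<omega> v"] by (simp add: star_star_inv)

section \<open>Bounded sections as multipliers\<close>

lemma Linf_sections_L2:
  assumes "\<sigma> \<in> Linf_sections M S"
  shows "integrable M (\<lambda>x. (norm (\<sigma> x))\<^sup>2)"
proof -
  obtain c where \<sigma>: "\<sigma> \<in> S" and c: "AE x in M. norm (\<sigma> x) \<le> c"
    using assms by (auto simp: Linf_sections_def)
  show ?thesis
  proof (rule integrable_const_bound[where B="c\<^sup>2"])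
    show "AE x in M. norm ((norm (\<sigma> x))\<^sup>2) \<le> c\<^sup>2"
      using c by eventually_elim (simp add: power_mono)
  qed (use measurable_norm[OF \<sigma>] in measurable)
qed

lemma Linf_sections_diff:
  assumes "\<sigma> \<in> Linf_sections M S" "\<tau> \<in> Linf_sections M S"
  shows "\<sigma> - \<tau> \<in> Linf_sections M S"
proof -
  obtain c d where S: "\<sigma> \<in> S" "\<tau> \<in> S" and c: "AE x in M. norm (\<sigma> x) \<le> c" and d: "AE x in M. norm (\<tau> x) \<le> d"
    using assms by (auto simp: Linf_sections_def)
  from c d have "AE x in M. norm ((\<sigma> - \<tau>) x) \<le> c + d"
  proof eventually_elim
    case (elim x)
    then show ?case using norm_triangle_ineq4[of "\<sigma> x" "\<tau> x"] by (simp add: fun_diff_def)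
  qed
  moreover have "\<sigma> - \<tau> \<in> S" using S_diff[OF S] by (simp add: fun_diff_def)
  ultimately show ?thesis by (auto simp: Linf_sections_def)
qed

lemma norm_le_Linf_norm:
  assumes \<sigma>: "\<sigma> \<in> Linf_sections M S"
  shows "AE x in M. norm (\<sigma> x) \<le> Linf_norm M \<sigma>"
proof (cases "emeasure M (space M) = 0")
  case True
  then have "AE x in M. False"
    by (auto simp: AE_iff_measurable[OF _ refl])
  then show ?thesis by eventually_elim simp
next
  case False
  obtain c where S: "\<sigma> \<in> S" and c: "AE x in M. norm (\<sigma> x) \<le> c"
    using \<sigma> by (auto simp: Linf_sections_def)
  have m: "(\<lambda>x. ereal (norm (\<sigma> x))) \<in> borel_measurable M" using measurable_norm[OF S] by measurable
  let ?s = "esssup M (\<lambda>x. ereal (norm (\<sigma> x)))"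
  have "?s \<le> ereal c"
    by (rule esssup_I[OF m]) (use c in simp)
  moreover have "esssup M (\<lambda>_. 0) \<le> ?s"
    by (rule esssup_mono) simp_all
  then have "0 \<le> ?s" by (simp add: esssup_const[OF False])
  ultimately have "ereal (Linf_norm M \<sigma>) = ?s"
    unfolding Linf_norm_def by (intro ereal_real') auto
  then have "AE x in M. ereal (norm (\<sigma> x)) \<le> ereal (Linf_norm M \<sigma>)"
    using esssup_AE[of "\<lambda>x. ereal (norm (\<sigma> x))" M] by (simp only:)
  then show ?thesis by simp
qed

text \<open>The flux of the transport equation at a fixed time. For essentially bounded
  \<open>\<sigma>\<close> the second factor is an essentially bounded function, which makes
  \<open>L2_mult\<close> meaningful.\<close>

definition section_product :: "'l \<Rightarrow> ('a \<Rightarrow> 'k) \<Rightarrow> 'l" where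
  "section_product u \<sigma> = L2_mult M cls u (star_inv_\<omega> (elem_of_section M sec \<sigma>))"

text \<open>Surjectivity of the duality map writes \<open>\<sigma>\<close> as \<open>?g\<close>
  times the section of \<open>\<omega>\<close>, and \<open>?g\<close> inherits its bound. In the
  fibres the product becomes plain scaling, from which its norm bound and additivity are
  derived.\<close>

lemma sec_star_section_product:
  assumes \<sigma>: "\<sigma> \<in> Linf_sections M S"
  shows "AE x in M. sec (star_\<omega> (section_product u \<sigma>)) x = rep_M u x *\<^sub>R \<sigma> x"
proof -
  have S: "\<sigma> \<in> S" using \<sigma> by (simp add: Linf_sections_def)
  let ?g = "rep_M (star_inv_\<omega> (elem_of_section M sec \<sigma>))"
  have g: "AE x in M. \<sigma> x = ?g x *\<^sub>R sec \<omega> x"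
    using sec_elem_of_section[OF S Linf_sections_L2[OF \<sigma>]] sec_star[of "star_inv_\<omega> (elem_of_section M sec \<sigma>)"]
    unfolding star_star_inv by eventually_elim simp
  have "AE x in M. \<bar>?g x\<bar> \<le> Linf_norm M \<sigma>"
    using g norm_le_Linf_norm[OF \<sigma>] norm_sec_omega by eventually_elim simp
  then have L2: "(\<lambda>x. rep_M u x * ?g x) \<in> L2_functions M"
    by (intro L2_bounded_mult rep_in_L2 rep_measurable)
  show ?thesis
    unfolding section_product_def L2_mult_def
    using sec_star[of "cls (\<lambda>x. rep_M u x * ?g x)"] rep_cls[OF L2] g by eventually_elim simp
qed

text \<open>The link between the two equations: the flux of the continuity equation is the dual of
  the integrand of the transport equation.\<close>

lemma section_mult_eq_star:
  assumes "\<sigma> \<in> Linf_sections M S"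
  shows "section_mult M sec (rep_M u) \<sigma> = star_\<omega> (section_product u \<sigma>)"
  unfolding section_mult_def by (rule elem_of_section_eqI[OF sec_star_section_product[OF assms]])

lemma norm_section_product:
  assumes \<sigma>: "\<sigma> \<in> Linf_sections M S"
  shows "norm (section_product u \<sigma>) \<le> \<bar>Linf_norm M \<sigma>\<bar> * norm u"
proof -
  have sq: "(norm u)\<^sup>2 = (LINT x|M. (rep_M u x)\<^sup>2)"
    unfolding power2_norm_eq_inner inner_rep by (simp add: power2_eq_square)
  have "(norm (section_product u \<sigma>))\<^sup>2 = (LINT x|M. (norm (sec (star_\<omega> (section_product u \<sigma>)) x))\<^sup>2)"
    by (simp add: norm_eq_integral[symmetric] norm_star)
  also have "\<dots> \<le> (LINT x|M. (Linf_norm M \<sigma>)\<^sup>2 * (rep_M u x)\<^sup>2)"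
  proof (rule integral_mono_AE[OF integrable_norm_sec])
    show "integrable M (\<lambda>x. (Linf_norm M \<sigma>)\<^sup>2 * (rep_M u x)\<^sup>2)" using rep_square_integrable by simp
    show "AE x in M. (norm (sec (star_\<omega> (section_product u \<sigma>)) x))\<^sup>2 \<le> (Linf_norm M \<sigma>)\<^sup>2 * (rep_M u x)\<^sup>2"
      using sec_star_section_product[OF \<sigma>, of u] norm_le_Linf_norm[OF \<sigma>]
    proof eventually_elim
      case (elim x)
      then have "(norm (\<sigma> x))\<^sup>2 \<le> (Linf_norm M \<sigma>)\<^sup>2" by (intro power_mono) auto
      then have "(rep_M u x)\<^sup>2 * (norm (\<sigma> x))\<^sup>2 \<le> (rep_M u x)\<^sup>2 * (Linf_norm M \<sigma>)\<^sup>2" by (intro mult_left_mono) auto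
      then show ?case unfolding elim(1) by (simp add: power_mult_distrib mult.commute)
    qed
  qed
  also have "\<dots> = (\<bar>Linf_norm M \<sigma>\<bar> * norm u)\<^sup>2"
    by (simp add: sq power_mult_distrib)
  finally show ?thesis by (rule power2_le_imp_le) simp
qed

text \<open>Chosen representatives need not be additive; their values are read off as coefficients
  along \<open>\<omega>\<close>, which are additive almost everywhere.\<close>

lemma rep_diff: "AE x in M. rep_M (u - v) x = rep_M u x - rep_M v x"
  using rep_star_eq[of "u - v"] rep_star_eq[of u] rep_star_eq[of v] sec_diff[of "star_\<omega> u" "star_\<omega> v"]
  by eventually_elim (simp add: star_diff inner_diff_left)

lemma section_product_diff_left:
  assumes \<sigma>: "\<sigma> \<in> Linf_sections M S"
  shows "section_product (u - v) \<sigma> = section_product u \<sigma> - section_product v \<sigma>"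
proof (rule star_inj, rule sec_AE_eqI)
  show "AE x in M. sec (star_\<omega> (section_product (u - v) \<sigma>)) x = sec (star_\<omega> (section_product u \<sigma> - section_product v \<sigma>)) x"
    using sec_star_section_product[OF \<sigma>, of "u - v"] sec_star_section_product[OF \<sigma>, of u]
      sec_star_section_product[OF \<sigma>, of v] sec_diff[of "star_\<omega> (section_product u \<sigma>)" "star_\<omega> (section_product v \<sigma>)"] rep_diff[of u v]
    by eventually_elim (simp add: star_diff scaleR_diff_left)
qed

lemma section_product_diff_right:
  assumes \<sigma>: "\<sigma> \<in> Linf_sections M S" "\<tau> \<in> Linf_sections M S"
  shows "section_product u (\<sigma> - \<tau>) = section_product u \<sigma> - section_product u \<tau>"
proof (rule star_inj, rule sec_AE_eqI)
  show "AE x in M. sec (star_\<omega> (section_product u (\<sigma> - \<tau>))) x = sec (star_\<omega> (section_product u \<sigma> - section_product u \<tau>)) x"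
    using sec_star_section_product[OF Linf_sections_diff[OF \<sigma>], of u] sec_star_section_product[OF \<sigma>(1), of u]
      sec_star_section_product[OF \<sigma>(2), of u] sec_diff[of "star_\<omega> (section_product u \<sigma>)" "star_\<omega> (section_product u \<tau>)"]
    by eventually_elim (simp add: star_diff scaleR_diff_right)
qed

end

section \<open>Energies, gradients and the operator \<open>\<partial>\<^sup>\<bottom>\<close>\<close>

text \<open>Closed balls centred in a countable dense set, with radii
  \<open>1 / real (Suc n)\<close>, are kept if they are compact. Local compactness puts every point
  into one of these countably many balls, and \<open>L\<close> collects finitely many of them at a
  time.\<close>

lemma compact_exhaustion:
  assumes lc: "locally_compact_space (euclidean :: 'a::metric_space topology)"
    and sep: "separable_space (euclidean :: 'a::metric_space topology)"
  obtains L :: "nat \<Rightarrow> 'a::metric_space set" where "\<And>n. compact (L n)" "\<And>x. \<forall>\<^sub>F n in sequentially. x \<in> L n"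
proof -
  obtain D :: "'a set" where D: "countable D" "closure D = UNIV"
    using sep by (auto simp: separable_space_def)
  define I where "I = {(d, n::nat). d \<in> D \<and> compact (cball d (1 / real (Suc n)))}"
  have cover: "\<exists>d n. (d, n) \<in> I \<and> x \<in> cball d (1 / real (Suc n))" for x
  proof -
    obtain U K where U: "open U" "x \<in> U" "U \<subseteq> K" and K: "compact K"
      using lc unfolding locally_compact_space_def by (auto dest!: spec[of _ x])
    obtain e where e: "0 < e" "ball x e \<subseteq> U" using U openE by blast
    \<comment> \<open>The centre is less than one radius from \<open>x\<close>, so half of
      \<open>e\<close> as bound on the radius keeps the ball inside the compact
      neighbourhood.\<close>
    obtain n :: nat where n: "1 / real (Suc n) < e / 2"
      using e nat_approx_posE[of "e / 2"] by auto
    have "x \<in> closure D" using D by simp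
    then obtain d where d: "d \<in> D" "dist d x < 1 / real (Suc n)"
      unfolding closure_approachable by (metis of_nat_0_less_iff zero_less_Suc zero_less_divide_1_iff)
    have "cball d (1 / real (Suc n)) \<subseteq> ball x e"
    proof
      fix y assume "y \<in> cball d (1 / real (Suc n))"
      then show "y \<in> ball x e"
        using d n dist_triangle2[of x y d] by (simp add: dist_commute)
    qed
    then have "compact (K \<inter> cball d (1 / real (Suc n)))" "K \<inter> cball d (1 / real (Suc n)) = cball d (1 / real (Suc n))"
      using e U K by (auto intro: compact_Int_closed)
    then have "(d, n) \<in> I" using d by (simp add: I_def)
    moreover have "x \<in> cball d (1 / real (Suc n))" using d by simp
    ultimately show ?thesis by blast
  qed
  have I: "countable I"
    by (rule countable_subset[of _ "D \<times> UNIV"]) (use D in \<open>auto simp: I_def\<close>)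
  have I_ne: "I \<noteq> {}" using cover by blast
  define q where "q i = from_nat_into I i" for i
  define L where "L n = (\<Union>i\<le>n. cball (fst (q i)) (1 / real (Suc (snd (q i)))))" for n
  show ?thesis
  proof (rule that)
    show "compact (L n)" for n
      unfolding L_def
    proof (rule compact_UN)
      fix i
      have "q i \<in> I" unfolding q_def by (rule from_nat_into[OF I_ne])
      then show "compact (cball (fst (q i)) (1 / real (Suc (snd (q i)))))"
        by (auto simp: I_def)
    qed simp
    fix x
    obtain d n where dn: "(d, n) \<in> I" "x \<in> cball d (1 / real (Suc n))" using cover by blast
    then obtain k where k: "q k = (d, n)" unfolding q_def using from_nat_into_surj[OF I] by blast
    show "\<forall>\<^sub>F m in sequentially. x \<in> L m"
      using eventually_ge_at_top[of k]
    proof eventually_elim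
      case (elim m)
      then show ?case using dn k unfolding L_def by (intro UN_I[of k]) auto
    qed
  qed
qed

context duality_setting
begin

lemma C_Cc: "C \<subseteq> Cc"
  and C_zero: "(\<lambda>x. 0) \<in> C"
  and C_add_mult: "\<forall>f\<in>C. \<forall>g\<in>C. (\<lambda>x. f x + g x) \<in> C \<and> (\<lambda>x. f x * g x) \<in> C"
  and C_scale_all: "\<forall>f\<in>C. \<forall>a. (\<lambda>x. a * f x) \<in> C"
  and C_dense_all: "\<forall>f\<in>Cc. \<forall>e>0. \<exists>g\<in>C. sup_norm (\<lambda>x. f x - g x) < e"
  and C_contraction_all: "\<forall>f\<in>C. unit_contraction f \<in> C \<and> E (unit_contraction f) (unit_contraction f) \<le> E f f"
  and E_local_all: "\<forall>f\<in>C. \<forall>g\<in>C. (\<exists>U c. open U \<and> supp f \<subseteq> U \<and> (\<forall>x\<in>U. g x = c)) \<longrightarrow> E f g = 0"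
  using admissible unfolding admissible_form_def by - (elim conjE, assumption)+

lemma C_add: "f \<in> C \<Longrightarrow> g \<in> C \<Longrightarrow> (\<lambda>x. f x + g x) \<in> C"
  and C_mult: "f \<in> C \<Longrightarrow> g \<in> C \<Longrightarrow> (\<lambda>x. f x * g x) \<in> C"
  using C_add_mult by simp_all

lemma C_scale: "f \<in> C \<Longrightarrow> (\<lambda>x. a * f x) \<in> C"
  using C_scale_all by simp

lemma E_local:
  assumes "f \<in> C" "g \<in> C" "open U" "supp f \<subseteq> U" "\<And>x. x \<in> U \<Longrightarrow> g x = c"
  shows "E f g = 0"
  by (rule E_local_all[rule_format, OF assms(1,2)], rule exI[of _ U], rule exI[of _ c]) (use assms in simp)

lemma C_diff: "f \<in> C \<Longrightarrow> g \<in> C \<Longrightarrow> (\<lambda>x. f x - g x) \<in> C"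
  using C_add[OF _ C_scale[of g "-1"], of f] by simp

section \<open>Cutoff functions and the energy of a gradient\<close>

text \<open>Density only gives functions of \<open>C\<close> that are uniformly close to a bump. A
  bump well above 1 near \<open>A\<close> leaves room for the error, and the unit contraction then
  makes the value exactly 1 without leaving \<open>C\<close>.\<close>

lemma cutoff_in_C:
  assumes K: "compact A"
  obtains g U where "g \<in> C" "open U" "A \<subseteq> U" "\<And>x. x \<in> U \<Longrightarrow> g x = 1" "\<And>x. 0 \<le> g x \<and> g x \<le> 1"
proof (cases "A = {}")
  case True
  \<comment> \<open>The bump uses the distance to \<open>A\<close>, which has no such meaning for
    the empty set; there the zero function serves.\<close>
  show ?thesis by (rule that[OF C_zero open_empty]) (use True in auto)
next
  case False
  obtain V L where V: "open V" "A \<subseteq> V" "V \<subseteq> L" and L: "compact L"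
  proof -
    have "\<exists>U L. openin euclidean U \<and> compactin euclidean L \<and> A \<subseteq> U \<and> U \<subseteq> L"
      using locally_compact_space_compact_closed_compact[THEN iffD1, OF _ locally_compact] K
      by (metis compactin_euclidean_iff Hausdorff_space_euclidean)
    then show ?thesis using that by (metis compactin_euclidean_iff open_openin)
  qed
  obtain d where d: "0 < d" "(\<Union>x\<in>A. ball x d) \<subseteq> V"
    using compact_subset_open_imp_ball_epsilon_subset[OF K V(1,2)] by blast
  \<comment> \<open>Equal to 4 on \<open>A\<close>, at least 2 within distance \<open>d / 4\<close>,
    and 0 beyond \<open>d / 2\<close>, so the support stays in the compact neighbourhood; an error
    below 1 leaves more than 1 near \<open>A\<close>.\<close>
  define \<eta> where "\<eta> x = max 0 (4 - 8 * infdist x A / d)" for x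
  have cont: "continuous_on UNIV \<eta>" unfolding \<eta>_def using d by (intro continuous_intros) auto
  have near: "\<exists>k\<in>A. dist x k < d" if "infdist x A < d" for x
    using that False cInf_lessD[of "dist x ` A" d] by (auto simp: infdist_notempty)
  have "{x. \<eta> x \<noteq> 0} \<subseteq> {x. infdist x A \<le> d / 2}"
    using d by (auto simp: \<eta>_def max_def field_simps split: if_splits)
  then have "supp \<eta> \<subseteq> {x. infdist x A \<le> d / 2}"
    unfolding supp_def by (rule closure_minimal) (intro closed_Collect_le continuous_intros)
  also have "\<dots> \<subseteq> L"
  proof
    fix x assume "x \<in> {x. infdist x A \<le> d / 2}"
    then obtain k where "k \<in> A" "dist x k < d" using near[of x] d by auto
    then have "x \<in> (\<Union>x\<in>A. ball x d)" by (auto simp: dist_commute)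
    then show "x \<in> L" using d V by blast
  qed
  finally have "compact (L \<inter> supp \<eta>)" "L \<inter> supp \<eta> = supp \<eta>"
    using L by (auto simp: supp_def intro: compact_Int_closed)
  then have \<eta>: "\<eta> \<in> Cc" using cont by (simp add: Cc_def)
  obtain g where g: "g \<in> C" "sup_norm (\<lambda>x. \<eta> x - g x) < 1"
    using C_dense_all[rule_format, OF \<eta>, of 1] by auto
  obtain c1 where c1: "\<And>x. \<bar>\<eta> x\<bar> \<le> c1" by (rule Cc_bounded[OF \<eta>]) blast
  have "g \<in> Cc" using g C_Cc by blast
  obtain c2 where c2: "\<And>x. \<bar>g x\<bar> \<le> c2" by (rule Cc_bounded[OF \<open>g \<in> Cc\<close>]) blast
  have bdd: "bdd_above (range (\<lambda>x. \<bar>\<eta> x - g x\<bar>))"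
  proof (rule bdd_aboveI2)
    show "\<bar>\<eta> x - g x\<bar> \<le> c1 + c2" for x using c1[of x] c2[of x] by linarith
  qed
  have close: "\<bar>\<eta> x - g x\<bar> < 1" for x
    using cSUP_upper[OF UNIV_I bdd, of x] g(2) unfolding sup_norm_def by linarith
  let ?U = "{x. infdist x A < d / 4}"
  show ?thesis
  proof (rule that[of "unit_contraction g" ?U])
    show "unit_contraction g \<in> C" using C_contraction_all g(1) by simp
    show "open ?U" by (intro open_Collect_less continuous_intros)
    show "A \<subseteq> ?U" using d by auto
    show "unit_contraction g x = 1" if "x \<in> ?U" for x
    proof -
      have "8 * infdist x A / d < 2" using that d by (simp add: field_simps)
      then have "2 \<le> \<eta> x" by (simp add: \<eta>_def)
      then have "1 \<le> g x" using close[of x] by linarith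
      then show ?thesis by (simp add: unit_contraction_def)
    qed
    show "0 \<le> unit_contraction g x \<and> unit_contraction g x \<le> 1" for x
      by (simp add: unit_contraction_def)
  qed
qed

text \<open>The energy measure of \<open>f\<close> is integrated against cutoffs equal to one near the support of \<open>f\<close>;
  for these the defining formula reduces to \<open>E(f)\<close> by locality.\<close>

lemma norm_gradient:
  assumes f: "f \<in> C"
  shows "(norm (j (d_u f)))\<^sup>2 = E f f"
proof -
  let ?h = "\<lambda>x. inner (sec (j (d_u f)) x) (sec (j (d_u f)) x)"
  obtain L where L: "\<And>n. compact (L n)" "\<And>x::'a. \<forall>\<^sub>F n in sequentially. x \<in> L n"
    by (rule compact_exhaustion[OF locally_compact separable]) blast
  have fc: "compact (supp f)" using f C_Cc by (auto simp: Cc_def)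
  \<comment> \<open>The sets \<open>L n\<close> make the cutoffs converge to 1 everywhere; including
    the support of \<open>f\<close> makes locality applicable for every \<open>n\<close>.\<close>
  have "\<exists>g U. g \<in> C \<and> open U \<and> L n \<union> supp f \<subseteq> U \<and> (\<forall>x\<in>U. g x = 1) \<and> (\<forall>x. 0 \<le> g x \<and> g x \<le> 1)" for n
  proof (rule cutoff_in_C[OF compact_Un[OF L(1)[of n] fc]])
    fix g U assume "g \<in> C" "open U" "L n \<union> supp f \<subseteq> U" "\<And>x. x \<in> U \<Longrightarrow> g x = 1" "\<And>x. 0 \<le> g x \<and> g x \<le> 1"
    then show ?thesis by (intro exI[of _ g] exI[of _ U] conjI ballI allI) simp_all
  qed
  then obtain g U where gU: "\<And>n. g n \<in> C" "\<And>n. open (U n)" "\<And>n. L n \<union> supp f \<subseteq> U n"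
    "\<And>n x. x \<in> U n \<Longrightarrow> g n x = 1" "\<And>n x. 0 \<le> g n x \<and> g n x \<le> 1"
    by metis
  have g_meas: "g n \<in> borel_measurable M" for n
    unfolding borel_measurable_M by (rule Cc_borel_measurable[OF subsetD[OF C_Cc gU(1)]])
  have val: "(LINT x|M. g n x * ?h x) = E f f" for n
  proof -
    have f0: "f x = 0" if "x \<notin> supp f" for x
      using that closure_subset[of "{x. f x \<noteq> 0}"] by (auto simp: supp_def)
    have fg: "(\<lambda>x. f x * g n x) = f"
    proof
      fix x
      show "f x * g n x = f x"
        using gU(3)[of n] gU(4)[of x n] f0[of x] by (cases "x \<in> supp f") auto
    qed
    have "supp (\<lambda>x. f x * f x) = supp f" by (simp add: supp_def)
    then have "E (\<lambda>x. f x * f x) (g n) = 0"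
      using gU(3)[of n] by (intro E_local[OF C_mult[OF f f] gU(1) gU(2), of n n 1] gU(4)) auto
    moreover have "signed_integral (\<nu> f f) (g n) =
        1/2 * (E (\<lambda>x. f x * g n x) f + E f (\<lambda>x. f x * g n x) - E (\<lambda>x. f x * f x) (g n))"
      using energy_measures f gU(1) by (simp add: is_energy_measures_def)
    ultimately have "signed_integral (\<nu> f f) (g n) = E f f" by (simp add: fg)
    moreover have "signed_integral (\<nu> f f) (g n) = (LINT x|M. g n x * ?h x)"
    proof (rule signed_integral_energy[OF f f])
      show "g n \<in> borel_measurable borel" using g_meas[of n] by (simp add: borel_measurable_M)
      show "\<bar>g n x\<bar> \<le> 1" for x using gU(5)[of n x] by auto
    qed
    ultimately show ?thesis by simp
  qed
  have "(\<lambda>n. LINT x|M. g n x * ?h x) \<longlonglongrightarrow> (LINT x|M. ?h x)"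
  proof (rule integral_dominated_convergence)
    show "integrable M ?h" by (rule integrable_inner_sec)
    show "AE x in M. (\<lambda>n. g n x * ?h x) \<longlonglongrightarrow> ?h x"
    proof (rule AE_I2, rule tendsto_eventually)
      fix x
      show "\<forall>\<^sub>F n in sequentially. g n x * ?h x = ?h x"
        using L(2)[of x]
      proof eventually_elim
        case (elim n)
        then have "x \<in> U n" using gU(3)[of n] by blast
        then show ?case by (simp add: gU(4))
      qed
    qed
    show "AE x in M. norm (g n x * ?h x) \<le> ?h x" for n
      using gU(5)[of n] by (intro AE_I2) (auto simp: abs_mult intro!: mult_left_le_one_le)
    show "(\<lambda>x. g n x * ?h x) \<in> borel_measurable M" for n
      by (rule borel_measurable_times[OF g_meas measurable_inner[OF sec_in_S sec_in_S]])
  qed (rule measurable_inner[OF sec_in_S sec_in_S])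
  then have "(LINT x|M. ?h x) = E f f"
    unfolding val by (simp add: LIMSEQ_const_iff)
  then show ?thesis by (simp add: power2_norm_eq_inner inner_eq_integral)
qed

lemma d_u_eq_pre_form: "d_u f = pre_form (\<lambda>x. 1) f"
  by (auto simp: fun_eq_iff d_u_def pre_form_def avg_def)

lemma gradient_diff:
  assumes "f \<in> C" "g \<in> C"
  shows "j (d_u (\<lambda>x. f x - g x)) = j (d_u f) - j (d_u g)"
proof -
  have "d_u f \<in> pre_forms (insert (\<lambda>x. 1) Cc) C" "d_u g \<in> pre_forms (insert (\<lambda>x. 1) Cc) C"
    unfolding d_u_eq_pre_form using assms by (auto intro: pre_formsI)
  from j_linear[OF this, of 1 "-1"]
  have "j (\<lambda>z. d_u f z - d_u g z) = j (d_u f) - j (d_u g)" by simp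
  moreover have "(\<lambda>z. d_u f z - d_u g z) = d_u (\<lambda>x. f x - g x)"
    by (auto simp: d_u_def fun_eq_iff)
  ultimately show ?thesis by simp
qed

lemma E_diff:
  assumes "f \<in> C" "g \<in> C"
  shows "E (\<lambda>x. f x - g x) (\<lambda>x. f x - g x) = (norm (j (d_u f) - j (d_u g)))\<^sup>2"
  using norm_gradient[OF C_diff[OF assms]] by (simp add: gradient_diff[OF assms])

lemma C_L2: "f \<in> C \<Longrightarrow> f \<in> L2_functions M"
proof -
  assume "f \<in> C"
  then have f: "f \<in> Cc" using C_Cc by blast
  obtain c where c: "\<And>x. \<bar>f x\<bar> \<le> c" by (rule Cc_bounded[OF f]) blast
  have m: "f \<in> borel_measurable M" using Cc_borel_measurable[OF f] by (simp add: borel_measurable_M)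
  have "(f x)\<^sup>2 \<le> c\<^sup>2" for x
    using power_mono[OF c[of x], of 2] by simp
  then have "integrable M (\<lambda>x. (f x)\<^sup>2)"
    using m by (intro integrable_const_bound[where B="c\<^sup>2"]) auto
  with m show ?thesis by (simp add: L2_functions_def)
qed

lemma cls_diff: "f \<in> C \<Longrightarrow> g \<in> C \<Longrightarrow> cls (\<lambda>x. f x - g x) = cls f - cls g"
  using cls_linear[OF C_L2 C_L2, of f g 1 "-1"] by simp

section \<open>Closability of the gradient and its adjoint\<close>

lemma gradient_Cauchy_iff:
  assumes "\<And>n. f n \<in> C"
  shows "(\<forall>e>0. \<exists>N. \<forall>m\<ge>N. \<forall>n\<ge>N. E (\<lambda>x. f m x - f n x) (\<lambda>x. f m x - f n x) < e)
    \<longleftrightarrow> Cauchy (\<lambda>n. j (d_u (f n)))" (is "?l \<longleftrightarrow> ?r")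
proof
  assume l: ?l
  show ?r
  proof (rule metric_CauchyI)
    fix e :: real assume "0 < e"
    then have "0 < e\<^sup>2" by simp
    with l obtain N where N: "\<forall>m\<ge>N. \<forall>n\<ge>N. E (\<lambda>x. f m x - f n x) (\<lambda>x. f m x - f n x) < e\<^sup>2" by blast
    have "dist (j (d_u (f m))) (j (d_u (f n))) < e" if "N \<le> m" "N \<le> n" for m n
    proof -
      have "E (\<lambda>x. f m x - f n x) (\<lambda>x. f m x - f n x) < e\<^sup>2"
        using N that by blast
      then have "(norm (j (d_u (f m)) - j (d_u (f n))))\<^sup>2 < e\<^sup>2"
        unfolding E_diff[OF assms assms] .
      then show ?thesis
        unfolding dist_norm by (rule power_less_imp_less_base) (use \<open>0 < e\<close> in simp)
    qed
    then show "\<exists>N. \<forall>m\<ge>N. \<forall>n\<ge>N. dist (j (d_u (f m))) (j (d_u (f n))) < e" by blast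
  qed
next
  assume r: ?r
  show ?l
  proof (intro allI impI)
    fix e :: real assume "0 < e"
    then have "0 < sqrt e" by simp
    from metric_CauchyD[OF r this] obtain N
      where N: "\<forall>m\<ge>N. \<forall>n\<ge>N. dist (j (d_u (f m))) (j (d_u (f n))) < sqrt e" by blast
    have "E (\<lambda>x. f m x - f n x) (\<lambda>x. f m x - f n x) < e" if "N \<le> m" "N \<le> n" for m n
    proof -
      have "norm (j (d_u (f m)) - j (d_u (f n))) < sqrt e"
        using N that unfolding dist_norm by blast
      then have "(norm (j (d_u (f m)) - j (d_u (f n))))\<^sup>2 < (sqrt e)\<^sup>2"
        by (rule power_strict_mono) simp_all
      then show ?thesis using \<open>0 < e\<close> unfolding E_diff[OF assms assms] by simp
    qed
    then show "\<exists>N. \<forall>m\<ge>N. \<forall>n\<ge>N. E (\<lambda>x. f m x - f n x) (\<lambda>x. f m x - f n x) < e" by blast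
  qed
qed

lemma energy_approx_iff:
  "energy_approx E C cls f u \<longleftrightarrow> (\<forall>n. f n \<in> C) \<and> (\<lambda>n. cls (f n)) \<longlonglongrightarrow> u \<and> Cauchy (\<lambda>n. j (d_u (f n)))"
  unfolding energy_approx_def using gradient_Cauchy_iff[of f] by blast

text \<open>Convergent gradients are Cauchy in energy, so closability of the form forces the
  energies to 0; these are the squared norms of the gradients.\<close>

lemma grad_closable:
  assumes f: "\<And>n. f n \<in> C" "(\<lambda>n. cls (f n)) \<longlonglongrightarrow> 0" "(\<lambda>n. j (d_u (f n))) \<longlonglongrightarrow> v"
  shows "v = 0"
proof -
  have "energy_approx E C cls f 0"
    using f LIMSEQ_imp_Cauchy[OF f(3)] by (simp add: energy_approx_iff)
  then have "(\<lambda>n. E (f n) (f n)) \<longlonglongrightarrow> 0"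
    using closure_dirichlet by (simp add: closure_is_dirichlet_form_def closable_form_def)
  then have "(\<lambda>n. (norm (j (d_u (f n))))\<^sup>2) \<longlonglongrightarrow> 0"
    by (simp add: norm_gradient f(1))
  moreover have "(\<lambda>n. (norm (j (d_u (f n))))\<^sup>2) \<longlonglongrightarrow> (norm v)\<^sup>2"
    by (intro tendsto_intros f(3))
  ultimately have "(norm v)\<^sup>2 = 0" by (rule LIMSEQ_unique[rotated])
  then show ?thesis by simp
qed

abbreviation "form_dom \<equiv> form_domain E C cls"
abbreviation "gradient \<equiv> grad C j cls"

lemma grad_eqI:
  assumes f: "\<And>n. f n \<in> C" "(\<lambda>n. cls (f n)) \<longlonglongrightarrow> u" "(\<lambda>n. j (d_u (f n))) \<longlonglongrightarrow> v"
  shows "gradient u = v"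
  unfolding grad_def
proof (rule the_equality)
  show "\<exists>f. (\<forall>n. f n \<in> C) \<and> (\<lambda>n. cls (f n)) \<longlonglongrightarrow> u \<and> (\<lambda>n. j (d_u (f n))) \<longlonglongrightarrow> v"
    using f by blast
  fix v' assume "\<exists>f. (\<forall>n. f n \<in> C) \<and> (\<lambda>n. cls (f n)) \<longlonglongrightarrow> u \<and> (\<lambda>n. j (d_u (f n))) \<longlonglongrightarrow> v'"
  then obtain g where g: "\<And>n. g n \<in> C" "(\<lambda>n. cls (g n)) \<longlonglongrightarrow> u" "(\<lambda>n. j (d_u (g n))) \<longlonglongrightarrow> v'"
    by blast
  have "v' - v = 0"
  proof (rule grad_closable[of "\<lambda>n x. g n x - f n x"])
    show "(\<lambda>x. g n x - f n x) \<in> C" for n by (rule C_diff[OF g(1) f(1)])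
    show "(\<lambda>n. cls (\<lambda>x. g n x - f n x)) \<longlonglongrightarrow> 0"
      using tendsto_diff[OF g(2) f(2)] by (simp add: cls_diff f(1) g(1))
    show "(\<lambda>n. j (d_u (\<lambda>x. g n x - f n x))) \<longlonglongrightarrow> v' - v"
      using tendsto_diff[OF g(3) f(3)] by (simp add: gradient_diff f(1) g(1))
  qed
  then show "v' = v" by simp
qed

text \<open>Cauchy sequences of gradients converge by completeness, and closability identifies the
  limit. In particular \<open>C\<close> is a core of the gradient.\<close>

lemma form_domainE:
  assumes "u \<in> form_dom"
  obtains f where "\<And>n. f n \<in> C" "(\<lambda>n. cls (f n)) \<longlonglongrightarrow> u" "(\<lambda>n. j (d_u (f n))) \<longlonglongrightarrow> gradient u"
proof -
  obtain f where f: "\<And>n. f n \<in> C" "(\<lambda>n. cls (f n)) \<longlonglongrightarrow> u" "Cauchy (\<lambda>n. j (d_u (f n)))"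
    using assms by (auto simp: form_domain_def energy_approx_iff)
  obtain v where v: "(\<lambda>n. j (d_u (f n))) \<longlonglongrightarrow> v"
    using f(3) by (auto simp: Cauchy_convergent_iff convergent_def)
  have "gradient u = v" by (rule grad_eqI[OF f(1,2) v])
  with v show ?thesis by (intro that[OF f(1,2)]) simp_all
qed

lemma cls_in_form_domain:
  assumes "f \<in> C"
  shows "cls f \<in> form_dom" "gradient (cls f) = j (d_u f)"
proof -
  have "energy_approx E C cls (\<lambda>n. f) (cls f)"
    unfolding energy_approx_iff using assms by (simp add: LIMSEQ_imp_Cauchy[OF tendsto_const])
  then show "cls f \<in> form_dom" by (auto simp: form_domain_def)
  show "gradient (cls f) = j (d_u f)"
    by (rule grad_eqI[of "\<lambda>_. f"]) (use assms in auto)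
qed

lemma closure_form_domain: "closure form_dom = UNIV"
  using closure_dirichlet by (simp add: closure_is_dirichlet_form_def dirichlet_form_def)

text \<open>The domain is dense because the closure is a Dirichlet form, so at most one vector
  represents the functional.\<close>

lemma adj_eqI:
  assumes g: "\<And>u. u \<in> form_dom \<Longrightarrow> inner v (gradient u) = inner g u"
  shows "adj form_dom gradient v = g"
  unfolding adj_def
proof (rule the_equality)
  show "\<forall>u\<in>form_dom. inner v (gradient u) = inner g u" using g by blast
  fix g' assume g': "\<forall>u\<in>form_dom. inner v (gradient u) = inner g' u"
  have "closed {u. inner g' u = inner g u}"
    by (intro closed_Collect_eq continuous_intros)
  then have "closure form_dom \<subseteq> {u. inner g' u = inner g u}"
    using g g' by (intro closure_minimal) auto
  then have "inner g' u = inner g u" for u unfolding closure_form_domain by blast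
  then have "inner (g' - g) (g' - g) = 0" by (simp add: inner_diff_left)
  then show "g' = g" by simp
qed

abbreviation "perp_dom \<equiv> perp_domain E C j M cls sec \<omega>"
abbreviation "perp_op \<equiv> perp E C j M cls sec \<omega>"

text \<open>It suffices to test \<open>\<partial>\<^sup>\<bottom>\<close> against the core \<open>C\<close>, and the pairing takes place in \<open>L\<^sup>2\<close>.\<close>

lemma perp_iff:
  "f \<in> perp_dom \<and> perp_op f = g \<longleftrightarrow> (\<forall>\<phi>\<in>C. inner g (cls \<phi>) = - inner f (star_inv_\<omega> (j (d_u \<phi>))))"
    (is "?l \<longleftrightarrow> ?r")
proof
  assume l: ?l
  then obtain g0 where g0: "\<And>u. u \<in> form_dom \<Longrightarrow> inner (star_\<omega> f) (gradient u) = inner g0 u"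
    by (auto simp: perp_domain_def adj_domain_def)
  then have "g = - g0" using l adj_eqI[OF g0] by (simp add: perp_def)
  show ?r
  proof
    fix \<phi> assume \<phi>: "\<phi> \<in> C"
    show "inner g (cls \<phi>) = - inner f (star_inv_\<omega> (j (d_u \<phi>)))"
      using g0[OF cls_in_form_domain(1)[OF \<phi>]] \<open>g = - g0\<close>
      by (simp add: cls_in_form_domain(2)[OF \<phi>] inner_star_left)
  qed
next
  assume r: ?r
  have *: "inner (star_\<omega> f) (gradient u) = inner (- g) u" if u: "u \<in> form_dom" for u
  proof -
    \<comment> \<open>The identity for functions of \<open>C\<close> extends to \<open>u\<close>
      along a sequence that converges together with its gradients.\<close>
    obtain h where h: "\<And>n. h n \<in> C" "(\<lambda>n. cls (h n)) \<longlonglongrightarrow> u" "(\<lambda>n. j (d_u (h n))) \<longlonglongrightarrow> gradient u"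
      by (rule form_domainE[OF u]) (rule that)
    have eq: "inner (star_\<omega> f) (j (d_u (h n))) = inner (- g) (cls (h n))" for n
      using r h(1)[of n] by (simp add: inner_star_left)
    have "(\<lambda>n. inner (star_\<omega> f) (j (d_u (h n)))) \<longlonglongrightarrow> inner (star_\<omega> f) (gradient u)"
      by (intro tendsto_intros h)
    moreover have "(\<lambda>n. inner (- g) (cls (h n))) \<longlonglongrightarrow> inner (- g) u"
      by (intro tendsto_intros h)
    ultimately show ?thesis unfolding eq by (rule LIMSEQ_unique)
  qed
  then have "star_\<omega> f \<in> adj_domain form_dom gradient" unfolding adj_domain_def by blast
  moreover have "adj form_dom gradient (star_\<omega> f) = - g" by (rule adj_eqI[OF *])
  ultimately show ?l by (simp add: perp_domain_def perp_def)
qed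

text \<open>The weak characterisation is linear and yields membership in the domain together with
  the value.\<close>

lemma perp_diff:
  assumes "f \<in> perp_dom" "g \<in> perp_dom"
  shows "perp_op (f - g) = perp_op f - perp_op g"
proof -
  have "\<forall>\<phi>\<in>C. inner (perp_op f - perp_op g) (cls \<phi>) = - inner (f - g) (star_inv_\<omega> (j (d_u \<phi>)))"
    using perp_iff[of f "perp_op f"] perp_iff[of g "perp_op g"] assms by (simp add: inner_diff_left)
  then show ?thesis using perp_iff by blast
qed

end

section \<open>Solutions\<close>

lemma AE_lebesgue_on_subset:
  assumes "AE t in lebesgue_on S. P t" "A \<subseteq> S" "A \<in> sets lebesgue" "S \<in> sets lebesgue"
  shows "AE t in lebesgue_on A. P t"
proof -
  have "AE t in lebesgue. t \<in> S \<longrightarrow> P t"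
    using assms by (simp add: AE_restrict_space_iff)
  then have "AE t in lebesgue. t \<in> A \<longrightarrow> P t"
    by eventually_elim (use assms(2) in blast)
  then show ?thesis using assms by (simp add: AE_restrict_space_iff)
qed

lemma L2_time_cong_AE:
  fixes u v :: "real \<Rightarrow> 'b::{real_normed_vector}"
  assumes u: "L2_time T UNIV norm u" and ae: "AE t in lebesgue_on {0<..<T}. u t = v t"
  shows "L2_time T UNIV norm v"
proof -
  let ?Q = "lebesgue_on {0<..<T}"
  obtain s where s: "\<And>n. simple_function ?Q (s n)" "AE t in ?Q. (\<lambda>n. norm (u t - s n t)) \<longlonglongrightarrow> 0"
    and int: "integrable ?Q (\<lambda>t. (norm (u t))\<^sup>2)"
    using u by (auto simp: L2_time_def strongly_measurable_def)
  have "AE t in ?Q. (\<lambda>n. norm (v t - s n t)) \<longlonglongrightarrow> 0"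
    using s(2) ae by eventually_elim simp
  moreover have "integrable ?Q (\<lambda>t. (norm (v t))\<^sup>2)"
    by (rule integrable_lebesgue_on_cong_AE[OF _ int], simp, use ae in eventually_elim) simp
  ultimately show ?thesis
    unfolding L2_time_def strongly_measurable_def using s(1)
    by (intro conjI exI[of _ s]) simp_all
qed

context duality_setting
begin

lemma section_product_diff_le:
  assumes \<sigma>: "\<sigma> \<in> Linf_sections M S" and \<tau>: "\<tau> \<in> Linf_sections M S"
  shows "norm (section_product u \<sigma> - section_product v \<tau>) \<le>
    \<bar>Linf_norm M \<sigma>\<bar> * norm (u - v) + \<bar>Linf_norm M (\<sigma> - \<tau>)\<bar> * norm v"
proof -
  have "section_product u \<sigma> - section_product v \<tau> = section_product (u - v) \<sigma> + section_product v (\<sigma> - \<tau>)"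
    by (simp add: section_product_diff_left[OF \<sigma>] section_product_diff_right[OF \<sigma> \<tau>])
  then show ?thesis
    using norm_triangle_ineq[of "section_product (u - v) \<sigma>" "section_product v (\<sigma> - \<tau>)"]
      norm_section_product[OF \<sigma>, of "u - v"] norm_section_product[OF Linf_sections_diff[OF \<sigma> \<tau>], of v]
    by simp
qed

text \<open>A product formed from two simple functions takes finitely many values, so it is simple
  whatever the measurability or separability properties of the section space; these products
  approximate the integrand. The bound comes from
  \<open>2 * x * y \<le> x\<^sup>2 + y\<^sup>2\<close>.\<close>

lemma integrable_section_product:
  assumes u: "L2_time T UNIV norm u" and b: "L2_time T (Linf_sections M S) (Linf_norm M) b"
  shows "integrable (lebesgue_on {0<..<T}) (\<lambda>t. section_product (u t) (b t))"
proof -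
  let ?Q = "lebesgue_on {0<..<T}"
  obtain s where s: "\<And>n. simple_function ?Q (s n)" "AE t in ?Q. (\<lambda>n. norm (u t - s n t)) \<longlonglongrightarrow> 0"
    using u by (auto simp: L2_time_def strongly_measurable_def)
  obtain r where bL: "AE t in ?Q. b t \<in> Linf_sections M S"
    and r: "\<And>n. simple_function ?Q (r n)" "\<And>n. r n ` space ?Q \<subseteq> Linf_sections M S"
      "AE t in ?Q. (\<lambda>n. Linf_norm M (b t - r n t)) \<longlonglongrightarrow> 0"
    using b unfolding L2_time_def strongly_measurable_def by blast
  have meas: "(\<lambda>t. section_product (u t) (b t)) \<in> borel_measurable ?Q"
  proof (rule borel_measurable_lebesgue_on_AE_LIMSEQ)
    show "(\<lambda>t. section_product (s n t) (r n t)) \<in> borel_measurable ?Q" for n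
      by (rule borel_measurable_simple_function[OF simple_function_compose2[OF s(1) r(1)]])
    show "AE t in ?Q. (\<lambda>n. norm (section_product (u t) (b t) - section_product (s n t) (r n t))) \<longlonglongrightarrow> 0"
      using s(2) bL r(3) AE_space
    proof eventually_elim
      case (elim t)
      have rL: "r n t \<in> Linf_sections M S" for n using r(2) elim(4) by blast
      have "(\<lambda>n. s n t) \<longlonglongrightarrow> u t"
        by (rule tendsto_dist_iff[THEN iffD2]) (use elim(1) in \<open>simp add: dist_norm norm_minus_commute\<close>)
      \<comment> \<open>The norms of the approximants converge, hence stay bounded, so the second
        error term tends to 0 as well.\<close>
      then have ns: "(\<lambda>n. norm (s n t)) \<longlonglongrightarrow> norm (u t)" by (rule tendsto_norm)
      have "(\<lambda>n. \<bar>Linf_norm M (b t)\<bar> * norm (u t - s n t) + \<bar>Linf_norm M (b t - r n t)\<bar> * norm (s n t))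
          \<longlonglongrightarrow> \<bar>Linf_norm M (b t)\<bar> * 0 + \<bar>0\<bar> * norm (u t)"
        by (intro tendsto_add tendsto_mult tendsto_rabs tendsto_const elim ns)
      then have lim: "(\<lambda>n. \<bar>Linf_norm M (b t)\<bar> * norm (u t - s n t) + \<bar>Linf_norm M (b t - r n t)\<bar> * norm (s n t)) \<longlonglongrightarrow> 0"
        by simp
      show ?case
      proof (rule Lim_null_comparison[OF always_eventually lim], rule allI)
        show "norm (norm (section_product (u t) (b t) - section_product (s n t) (r n t))) \<le>
            \<bar>Linf_norm M (b t)\<bar> * norm (u t - s n t) + \<bar>Linf_norm M (b t - r n t)\<bar> * norm (s n t)" for n
          using section_product_diff_le[OF elim(2) rL, of "u t" "s n t" n] by simp
      qed
    qed
  qed simp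
  show ?thesis
  proof (rule integrable_bound_complete[OF meas])
    show "integrable ?Q (\<lambda>t. (Linf_norm M (b t))\<^sup>2 + (norm (u t))\<^sup>2)"
      using u b by (simp add: L2_time_def)
    show "AE t in ?Q. norm (section_product (u t) (b t)) \<le> (Linf_norm M (b t))\<^sup>2 + (norm (u t))\<^sup>2"
      using bL
    proof eventually_elim
      case (elim t)
      have "norm (section_product (u t) (b t)) \<le> \<bar>Linf_norm M (b t)\<bar> * norm (u t)"
        by (rule norm_section_product[OF elim])
      moreover have "2 * \<bar>Linf_norm M (b t)\<bar> * norm (u t) \<le> \<bar>Linf_norm M (b t)\<bar>\<^sup>2 + (norm (u t))\<^sup>2"
        by (rule sum_squares_bound)
      moreover have "0 \<le> \<bar>Linf_norm M (b t)\<bar> * norm (u t)" by simp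
      ultimately show ?case unfolding power2_abs by linarith
    qed
  qed
qed

text \<open>For each test function the scalar equivalence applies; separability merges the null
  sets, and testing on the core characterises the operator. Both parts of the theorem are instances,
  differing in which of \<open>u\<close> and \<open>w\<close> is given.\<close>

lemma weak_solution_CE_iff_AE_perp:
  assumes T: "T > 0" and u: "L2_time T UNIV norm u" and b: "L2_time T (Linf_sections M S) (Linf_norm M) b"
    and w0: "w0 \<in> perp_dom" and u0: "u0 = perp_op w0"
    and w: "\<And>t. t \<in> {0..T} \<Longrightarrow> w t = w0 - (LINT s|lebesgue_on {0<..<t}. section_product (u s) (b s))"
  shows "weak_solution_CE C j M cls sec T b u0 u \<longleftrightarrow>
    (AE t in lebesgue_on {0<..<T}. w t \<in> perp_dom \<and> perp_op (w t) = u t)"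
proof -
  let ?Q = "lebesgue_on {0<..<T}" and ?F = "\<lambda>t. section_product (u t) (b t)"
  let ?d = "\<lambda>\<phi>. star_inv_\<omega> (j (d_u \<phi>))"
  have bL: "AE t in ?Q. b t \<in> Linf_sections M S"
    using b by (simp add: L2_time_def strongly_measurable_def)
  have pairing: "(LINT x|M. rep_M v x * \<phi> x) = inner v (cls \<phi>)" if "\<phi> \<in> C" for v \<phi>
    by (rule inner_rep_cls[OF C_L2[OF that], symmetric])
  \<comment> \<open>The identification of the flux needs a bounded section, which \<open>b t\<close>
    is only for almost every \<open>t\<close>.\<close>
  have flux: "(LINT t|?Q. \<psi> t * inner (section_mult M sec (rep_M (u t)) (b t)) (j (d_u \<phi>))) =
      (LINT t|?Q. \<psi> t * inner (?F t) (?d \<phi>))" for \<psi> \<phi>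
    by (rule integral_lebesgue_on_cong_AE, simp, use bL in eventually_elim)
      (simp add: section_mult_eq_star inner_star_left)
  have "weak_solution_CE C j M cls sec T b u0 u \<longleftrightarrow>
      (\<forall>\<phi>\<in>C. \<forall>\<psi> \<psi>'. C1c T \<psi> \<psi>' \<longrightarrow>
        - (LINT t|?Q. \<psi>' t * inner (u t) (cls \<phi>)) =
          (LINT t|?Q. \<psi> t * inner (?F t) (?d \<phi>)) + \<psi> 0 * inner u0 (cls \<phi>))"
    unfolding weak_solution_CE_def flux using u by (simp add: pairing cong: ball_cong) blast
  also have "\<dots> \<longleftrightarrow> (\<forall>\<phi>\<in>C. AE t in ?Q. inner (u t) (cls \<phi>) = - inner (w t) (?d \<phi>))"
  proof (rule ball_cong[OF refl])
    fix \<phi> assume \<phi>: "\<phi> \<in> C"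
    have init: "inner u0 (cls \<phi>) = - inner w0 (?d \<phi>)"
      using perp_iff[of w0 u0] w0 u0 \<phi> by simp
    show "(\<forall>\<psi> \<psi>'. C1c T \<psi> \<psi>' \<longrightarrow>
        - (LINT t|?Q. \<psi>' t * inner (u t) (cls \<phi>)) =
          (LINT t|?Q. \<psi> t * inner (?F t) (?d \<phi>)) + \<psi> 0 * inner u0 (cls \<phi>)) \<longleftrightarrow>
        (AE t in ?Q. inner (u t) (cls \<phi>) = - inner (w t) (?d \<phi>))"
      by (rule weak_form_iff_AE[OF T L2_time_integrable[OF u] integrable_section_product[OF u b] w init])
  qed
  also have "\<dots> \<longleftrightarrow> (AE t in ?Q. \<forall>\<phi>\<in>C. inner (u t) (cls \<phi>) = - inner (w t) (?d \<phi>))"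
  proof
    assume "\<forall>\<phi>\<in>C. AE t in ?Q. inner (u t) (cls \<phi>) = - inner (w t) (?d \<phi>)"
    \<comment> \<open>Pairing each class with its dual gradient turns the family of test functions
      into a subset of a separable product space.\<close>
    then have "AE t in ?Q. \<forall>p\<in>(\<lambda>\<phi>. (cls \<phi>, ?d \<phi>)) ` C. inner (u t) (fst p) = - inner (w t) (snd p)"
      by (intro AE_ball_inner_eq_iff) auto
    then show "AE t in ?Q. \<forall>\<phi>\<in>C. inner (u t) (cls \<phi>) = - inner (w t) (?d \<phi>)"
      by simp
  next
    assume *: "AE t in ?Q. \<forall>\<phi>\<in>C. inner (u t) (cls \<phi>) = - inner (w t) (?d \<phi>)"
    show "\<forall>\<phi>\<in>C. AE t in ?Q. inner (u t) (cls \<phi>) = - inner (w t) (?d \<phi>)"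
      by (rule ballI, use * in eventually_elim) blast
  qed
  finally show ?thesis unfolding perp_iff .
qed

text \<open>The equivalence gives \<open>perp_op (w t) = u t\<close> for almost every
  \<open>t\<close>, which allows the replacement of \<open>u\<close> in the integral defining
  \<open>w\<close>. Measurability in the graph norm follows from that of \<open>w\<close> and
  \<open>u\<close>.\<close>

lemma integral_solution_TE_if_weak_solution_CE:
  assumes T: "T > 0" and b: "L2_time T (Linf_sections M S) (Linf_norm M) b"
    and w0: "w0 \<in> perp_dom" and u0: "u0 = perp_op w0"
    and CE: "weak_solution_CE C j M cls sec T b u0 u"
  shows "integral_solution_TE E C j M cls sec \<omega> T b w0
    (\<lambda>t. w0 - (LINT s|lebesgue_on {0<..<t}. section_product (u s) (b s)))"
proof -
  let ?Q = "lebesgue_on {0<..<T}" and ?F = "\<lambda>t. section_product (u t) (b t)"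
  let ?w = "\<lambda>t. w0 - (LINT s|lebesgue_on {0<..<t}. ?F s)"
  have u: "L2_time T UNIV norm u" using CE by (simp add: weak_solution_CE_def)
  have ae: "AE t in ?Q. ?w t \<in> perp_dom \<and> perp_op (?w t) = u t"
    using weak_solution_CE_iff_AE_perp[OF T u b w0 u0, of ?w] CE by simp
  have cont: "continuous_on {0..T} ?w"
    by (intro continuous_intros continuous_on_indefinite_integral integrable_section_product u b)
  show ?thesis
    unfolding integral_solution_TE_def section_product_def[symmetric]
  proof (intro conjI ballI)
    show "continuous_on {0..T} ?w" by (rule cont)
    have "continuous_on {0<..<T} ?w" by (rule continuous_on_subset[OF cont]) auto
    then have "?w \<in> borel_measurable ?Q"
      by (rule continuous_imp_measurable_on_sets_lebesgue) simp
    then show "strongly_measurable ?Q perp_dom (\<lambda>f. sqrt ((norm f)\<^sup>2 + (norm (perp_op f))\<^sup>2)) ?w"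
      using w0 by (intro strongly_measurable_graph[OF T _ L2_time_borel_measurable[OF u] ae] perp_diff) auto
    show "L2_time T UNIV norm (\<lambda>t. perp_op (?w t))"
      by (rule L2_time_cong_AE[OF u], use ae in eventually_elim) simp
    fix t assume t: "t \<in> {0..T}"
    have "AE s in lebesgue_on {0<..<t}. ?w s \<in> perp_dom \<and> perp_op (?w s) = u s"
      by (rule AE_lebesgue_on_subset[OF ae]) (use t in auto)
    then have "AE s in lebesgue_on {0<..<t}. ?F s = section_product (perp_op (?w s)) (b s)"
      by eventually_elim simp
    then have "(LINT s|lebesgue_on {0<..<t}. ?F s) = (LINT s|lebesgue_on {0<..<t}. section_product (perp_op (?w s)) (b s))"
      by (intro integral_lebesgue_on_cong_AE) simp_all
    then show "?w t = w0 - (LINT s|lebesgue_on {0<..<t}. section_product (perp_op (?w s)) (b s))"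
      by (rule arg_cong)
  qed
qed

text \<open>With \<open>u\<close> taken as \<open>perp_op (w t)\<close>, the right side of the
  equivalence reduces to membership of \<open>w t\<close> in the domain, which is part of strong
  measurability.\<close>

lemma weak_solution_CE_if_integral_solution_TE:
  assumes T: "T > 0" and b: "L2_time T (Linf_sections M S) (Linf_norm M) b"
    and w0: "w0 \<in> perp_dom" and u0: "u0 = perp_op w0"
    and TE: "integral_solution_TE E C j M cls sec \<omega> T b w0 w"
  shows "weak_solution_CE C j M cls sec T b u0 (\<lambda>t. perp_op (w t))"
proof -
  have u: "L2_time T UNIV norm (\<lambda>t. perp_op (w t))"
    and dom: "AE t in lebesgue_on {0<..<T}. w t \<in> perp_dom"
    and w: "\<And>t. t \<in> {0..T} \<Longrightarrow> w t = w0 - (LINT s|lebesgue_on {0<..<t}. section_product (perp_op (w s)) (b s))"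
    using TE unfolding integral_solution_TE_def strongly_measurable_def section_product_def[symmetric] by blast+
  show ?thesis
    using weak_solution_CE_iff_AE_perp[OF T u b w0 u0 w] dom by simp
qed

end

theorem theorem4p5:
  fixes E :: "('a::metric_space \<Rightarrow> real) \<Rightarrow> ('a \<Rightarrow> real) \<Rightarrow> real"
    and C :: "('a \<Rightarrow> real) set"
    and \<nu> :: "('a \<Rightarrow> real) \<Rightarrow> ('a \<Rightarrow> real) \<Rightarrow> 'a set \<Rightarrow> real"
    and j :: "('a \<times> 'a \<Rightarrow> real) \<Rightarrow> 'h::{real_inner, complete_space}"
    and \<omega> :: 'h
    and M :: "'a measure"
    and cls :: "('a \<Rightarrow> real) \<Rightarrow> 'l::{real_inner, complete_space, second_countable_topology}"
    and K :: "'a \<Rightarrow> 'k::{real_inner, complete_space} set"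
    and S :: "('a \<Rightarrow> 'k) set"
    and sec :: "'h \<Rightarrow> 'a \<Rightarrow> 'k"
    and T :: real
    and b :: "real \<Rightarrow> 'a \<Rightarrow> 'k"
    and w0 u0 :: 'l
  assumes "locally_compact_space (euclidean :: 'a topology)"
    and "separable_space (euclidean :: 'a topology)"
    and "admissible_form E C"
    and "is_energy_measures E C \<nu>"
    and "is_form_space C \<nu> j"
    and "has_martingale_dimension C \<nu> 1"
    and M_def: "M = form_measure C \<nu> j \<omega>"
    and "minimal_energy_dominant C \<nu> M"
    and "is_L2_space M cls"
    and "is_direct_integral C \<nu> j M K S sec"
    and "closure_is_dirichlet_form E C M cls"
    and "T > 0"
    and "L2_time T (Linf_sections M S) (Linf_norm M) b"
    and "w0 \<in> perp_domain E C j M cls sec \<omega>"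
    and "u0 = perp E C j M cls sec \<omega> w0"
  shows
    "(\<forall>u. weak_solution_CE C j M cls sec T b u0 u \<longrightarrow>
        integral_solution_TE E C j M cls sec \<omega> T b w0
          (\<lambda>t. w0 - (LINT s|lebesgue_on {0<..<t}.
             L2_mult M cls (u s) (star_inv M cls sec \<omega> (elem_of_section M sec (b s))))))
   \<and> (\<forall>w. integral_solution_TE E C j M cls sec \<omega> T b w0 w \<longrightarrow>
        weak_solution_CE C j M cls sec T b u0 (\<lambda>t. perp E C j M cls sec \<omega> (w t)))"
proof -
  interpret duality_setting C \<nu> j M K S sec E \<omega> cls
    by unfold_locales (fact assms)+
  show ?thesis
    using integral_solution_TE_if_weak_solution_CE[OF assms(12-15)]
      weak_solution_CE_if_integral_solution_TE[OF assms(12-15)]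
    unfolding section_product_def by blast
qed

end
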